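(* Let $\mathfrak{A}$ be an essentially small Karoubian $\mathbb{Q}$-linear tensor category in which every object has a dual, let $k=\mathrm{End}_{\mathfrak A}(\mathbb{1})$, and let $G$ be a group (or monoid). For any object $X$ of $\mathrm{Rep}_{\mathfrak A}(G)$, any $g\in G$ and any integer $n\ge1$, we have in $\Lambda(k)$ $$\overline{\chi}_X(g^n)=\psi_n\bigl(\overline{\chi}_X(g)\bigr),$$ where $\overline{\chi}_X(g)=\sum_{i\ge0}\mathrm{tr}(g;\mathrm{Alt}^i(X))\,t^i\in\Lambda(k)$ and $\psi_n\colon\Lambda(k)\to\Lambda(k)$ is the $n$-th Adams operation of the $\lambda$-ring $\Lambda(k)$.
   Context: A $\mathbb{Q}$-linear tensor category is a $\mathbb{Q}$-linear additive category with a $\mathbb{Q}$-bilinear associative, commutative, unital tensor product (a symmetric monoidal structure), with unit $\mathbb{1}$; Karoubian means every projector $p=p^2\in\mathrm{End}(X)$ has a kernel. $\mathrm{Rep}_{\mathfrak A}(G)$ is the category of objects $X$ of $\mathfrak A$ with an action of $G$ (a homomorphism $G\to\mathrm{Aut}(X)$, or $G\to\mathrm{End}(X)$ for a monoid) and $G$-equivariant morphisms. $\mathrm{Alt}^i(X)$ is the image of the antisymmetrizing projector $\frac1{i!}\sum_{\sigma\in\Sigma_i}\mathrm{sgn}(\sigma)\sigma$ on $X^{\otimes i}$, with $g$ acting through $g_X^{\otimes i}$. Since every object of $\mathfrak A$ has a dual, there is the usual $\mathbb{Q}$-linear trace $\mathrm{tr}\colon\mathrm{End}(X)\to\mathrm{End}(\mathbb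 1)=k$, $f\mapsto\mathrm{tr}(f;X)$. $\Lambda(k)=1+tk[[t]]$ is the standard (special) $\lambda$-ring whose addition is multiplication of power series, whose multiplication is determined by $\prod_i(1+x_it)*\prod_j(1+y_jt)=\prod_{i,j}(1+x_iy_jt)$, and with $\lambda^m(\prod_i(1+x_it))=\prod_{i_1<\dots<i_m}(1+x_{i_1}\cdots x_{i_m}t)$ (interpreted by universal polynomials). For a $\lambda$-ring $A$ and $x\in A$, write $\lambda(x)=\sum_i\lambda^i(x)s^i\in A[[s]]$. The Adams operations $\psi_n\colon A\to A$, $n\ge1$, are defined by $$-s\,\frac{d\lambda(x)}{ds}\Big/\lambda(x)=\sum_{n\ge1}\psi_n(x)(-s)^n .$$ *)

theory Defs
  imports
    "HOL-Algebra.Module"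
    "HOL-Library.Poly_Mapping"
    "HOL-Computational_Algebra.Polynomial"
    "HOL-Combinatorics.Permutations"
begin

definition type_ring :: "'a :: comm_ring_1 ring" where
  "type_ring = \<lparr>carrier = UNIV, monoid.mult = (*), one = 1, zero = 0, add = (+)\<rparr>"


section \<open>Tensor categories\<close>

text \<open>
  The objects of a category are the elements of the type \<open>'o\<close>, and its morphisms are elements of
  \<open>'m\<close>. The morphisms from \<open>X\<close> to \<open>Y\<close> form the rational vector space \<open>hom_mod C X Y\<close>; of this record
  only the fields \<open>carrier\<close>, \<open>zero\<close>, \<open>add\<close> and \<open>smult\<close> are used. Composition is in function order.
  Composition and tensor product of morphisms take no object arguments. As both types are sets, the essential smallness of the category is automatic.
\<close>

record ('o, 'm) tensor_cat =
  hom_mod :: "'o \<Rightarrow> 'o \<Rightarrow> (rat, 'm) Module.module"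
  cmp :: "'m \<Rightarrow> 'm \<Rightarrow> 'm"  (infixr \<open>\<bullet>\<index>\<close> 65)
  idm :: "'o \<Rightarrow> 'm"
  tens_o :: "'o \<Rightarrow> 'o \<Rightarrow> 'o"  (infixr \<open>\<otimes>\<^sub>o\<index>\<close> 75)
  tens_m :: "'m \<Rightarrow> 'm \<Rightarrow> 'm"  (infixr \<open>\<otimes>\<^sub>m\<index>\<close> 75)
  unit_o :: "'o"  (\<open>\<I>\<index>\<close>)
  associator :: "'o \<Rightarrow> 'o \<Rightarrow> 'o \<Rightarrow> 'm"
  lunitor :: "'o \<Rightarrow> 'm"
  runitor :: "'o \<Rightarrow> 'm"
  braiding :: "'o \<Rightarrow> 'o \<Rightarrow> 'm"

abbreviation mor :: "('o, 'm) tensor_cat \<Rightarrow> 'o \<Rightarrow> 'o \<Rightarrow> 'm set" where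
  "mor C X Y \<equiv> carrier (hom_mod C X Y)"

definition is_inverse :: "('o, 'm) tensor_cat \<Rightarrow> 'o \<Rightarrow> 'o \<Rightarrow> 'm \<Rightarrow> 'm \<Rightarrow> bool" where
  "is_inverse C X Y f g \<longleftrightarrow>
     f \<in> mor C X Y \<and> g \<in> mor C Y X \<and> g \<bullet>\<^bsub>C\<^esub> f = idm C X \<and> f \<bullet>\<^bsub>C\<^esub> g = idm C Y"

definition is_iso :: "('o, 'm) tensor_cat \<Rightarrow> 'o \<Rightarrow> 'o \<Rightarrow> 'm \<Rightarrow> bool" where
  "is_iso C X Y f \<longleftrightarrow> (\<exists>g. is_inverse C X Y f g)"

definition inverse_of :: "('o, 'm) tensor_cat \<Rightarrow> 'o \<Rightarrow> 'o \<Rightarrow> 'm \<Rightarrow> 'm" where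
  "inverse_of C X Y f = (THE g. is_inverse C X Y f g)"

definition is_biproduct ::
  "('o, 'm) tensor_cat \<Rightarrow> 'o \<Rightarrow> 'o \<Rightarrow> 'o \<Rightarrow> 'm \<Rightarrow> 'm \<Rightarrow> 'm \<Rightarrow> 'm \<Rightarrow> bool" where
  "is_biproduct C X Y S i\<^sub>1 i\<^sub>2 p\<^sub>1 p\<^sub>2 \<longleftrightarrow>
     i\<^sub>1 \<in> mor C X S \<and> i\<^sub>2 \<in> mor C Y S \<and> p\<^sub>1 \<in> mor C S X \<and> p\<^sub>2 \<in> mor C S Y \<and>
     p\<^sub>1 \<bullet>\<^bsub>C\<^esub> i\<^sub>1 = idm C X \<and> p\<^sub>2 \<bullet>\<^bsub>C\<^esub> i\<^sub>2 = idm C Y \<and>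
     p\<^sub>1 \<bullet>\<^bsub>C\<^esub> i\<^sub>2 = \<zero>\<^bsub>hom_mod C Y X\<^esub> \<and> p\<^sub>2 \<bullet>\<^bsub>C\<^esub> i\<^sub>1 = \<zero>\<^bsub>hom_mod C X Y\<^esub> \<and>
     (i\<^sub>1 \<bullet>\<^bsub>C\<^esub> p\<^sub>1) \<oplus>\<^bsub>hom_mod C S S\<^esub> (i\<^sub>2 \<bullet>\<^bsub>C\<^esub> p\<^sub>2) = idm C S"

definition is_kernel :: "('o, 'm) tensor_cat \<Rightarrow> 'o \<Rightarrow> 'o \<Rightarrow> 'm \<Rightarrow> 'o \<Rightarrow> 'm \<Rightarrow> bool" where
  "is_kernel C X Y f K i \<longleftrightarrow>
     i \<in> mor C K X \<and> f \<bullet>\<^bsub>C\<^esub> i = \<zero>\<^bsub>hom_mod C K Y\<^esub> \<and>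
     (\<forall>W. \<forall>h\<in>mor C W X. f \<bullet>\<^bsub>C\<^esub> h = \<zero>\<^bsub>hom_mod C W Y\<^esub> \<longrightarrow> (\<exists>!u. u \<in> mor C W K \<and> i \<bullet>\<^bsub>C\<^esub> u = h))"

definition is_dual :: "('o, 'm) tensor_cat \<Rightarrow> 'o \<Rightarrow> 'o \<Rightarrow> 'm \<Rightarrow> 'm \<Rightarrow> bool" where
  "is_dual C X D ev coev \<longleftrightarrow>
     ev \<in> mor C (D \<otimes>\<^sub>o\<^bsub>C\<^esub> X) \<I>\<^bsub>C\<^esub> \<and> coev \<in> mor C \<I>\<^bsub>C\<^esub> (X \<otimes>\<^sub>o\<^bsub>C\<^esub> D) \<and>
     runitor C X \<bullet>\<^bsub>C\<^esub> (idm C X \<otimes>\<^sub>m\<^bsub>C\<^esub> ev) \<bullet>\<^bsub>C\<^esub> associator C X D X \<bullet>\<^bsub>C\<^esub> (coev \<otimes>\<^sub>m\<^bsub>C\<^esub> idm C X)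
       = lunitor C X \<and>
     lunitor C D \<bullet>\<^bsub>C\<^esub> (ev \<otimes>\<^sub>m\<^bsub>C\<^esub> idm C D) \<bullet>\<^bsub>C\<^esub>
       inverse_of C ((D \<otimes>\<^sub>o\<^bsub>C\<^esub> X) \<otimes>\<^sub>o\<^bsub>C\<^esub> D) (D \<otimes>\<^sub>o\<^bsub>C\<^esub> (X \<otimes>\<^sub>o\<^bsub>C\<^esub> D)) (associator C D X D) \<bullet>\<^bsub>C\<^esub>
       (idm C D \<otimes>\<^sub>m\<^bsub>C\<^esub> coev)
       = runitor C D"

locale Q_linear_category =
  fixes C :: "('o, 'm) tensor_cat" (structure)
  assumes hom_module: "Module.module (type_ring :: rat ring) (hom_mod C X Y)"
    and idm_in: "idm C X \<in> mor C X X"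
    and cmp_in: "\<lbrakk>f \<in> mor C X Y; g \<in> mor C Y Z\<rbrakk> \<Longrightarrow> g \<bullet> f \<in> mor C X Z"
    and cmp_idm: "f \<in> mor C X Y \<Longrightarrow> f \<bullet> idm C X = f"
    and idm_cmp: "f \<in> mor C X Y \<Longrightarrow> idm C Y \<bullet> f = f"
    and cmp_assoc:
      "\<lbrakk>f \<in> mor C W X; g \<in> mor C X Y; h \<in> mor C Y Z\<rbrakk> \<Longrightarrow> (h \<bullet> g) \<bullet> f = h \<bullet> (g \<bullet> f)"
    and cmp_add_left: "\<lbrakk>f \<in> mor C X Y; g \<in> mor C Y Z; g' \<in> mor C Y Z\<rbrakk> \<Longrightarrow>
      (g \<oplus>\<^bsub>hom_mod C Y Z\<^esub> g') \<bullet> f = (g \<bullet> f) \<oplus>\<^bsub>hom_mod C X Z\<^esub> (g' \<bullet> f)"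
    and cmp_add_right: "\<lbrakk>f \<in> mor C X Y; f' \<in> mor C X Y; g \<in> mor C Y Z\<rbrakk> \<Longrightarrow>
      g \<bullet> (f \<oplus>\<^bsub>hom_mod C X Y\<^esub> f') = (g \<bullet> f) \<oplus>\<^bsub>hom_mod C X Z\<^esub> (g \<bullet> f')"
    and cmp_smult_left: "\<lbrakk>f \<in> mor C X Y; g \<in> mor C Y Z\<rbrakk> \<Longrightarrow>
      (q \<odot>\<^bsub>hom_mod C Y Z\<^esub> g) \<bullet> f = q \<odot>\<^bsub>hom_mod C X Z\<^esub> (g \<bullet> f)"
    and cmp_smult_right: "\<lbrakk>f \<in> mor C X Y; g \<in> mor C Y Z\<rbrakk> \<Longrightarrow>
      g \<bullet> (q \<odot>\<^bsub>hom_mod C X Y\<^esub> f) = q \<odot>\<^bsub>hom_mod C X Z\<^esub> (g \<bullet> f)"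

locale Q_linear_additive_category = Q_linear_category +
  assumes zero_object: "\<exists>Z. idm C Z = \<zero>\<^bsub>hom_mod C Z Z\<^esub>"
    and biproducts: "\<exists>S i\<^sub>1 i\<^sub>2 p\<^sub>1 p\<^sub>2. is_biproduct C X Y S i\<^sub>1 i\<^sub>2 p\<^sub>1 p\<^sub>2"

locale Q_linear_tensor_category = Q_linear_additive_category +
  assumes tens_in: "\<lbrakk>f \<in> mor C X Y; f' \<in> mor C X' Y'\<rbrakk> \<Longrightarrow> f \<otimes>\<^sub>m f' \<in> mor C (X \<otimes>\<^sub>o X') (Y \<otimes>\<^sub>o Y')"
    and tens_idm: "idm C X \<otimes>\<^sub>m idm C Y = idm C (X \<otimes>\<^sub>o Y)"
    and tens_cmp: "\<lbrakk>f \<in> mor C X Y; g \<in> mor C Y Z; f' \<in> mor C X' Y'; g' \<in> mor C Y' Z'\<rbrakk> \<Longrightarrow>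
      (g \<bullet> f) \<otimes>\<^sub>m (g' \<bullet> f') = (g \<otimes>\<^sub>m g') \<bullet> (f \<otimes>\<^sub>m f')"
    and tens_add_left: "\<lbrakk>f \<in> mor C X Y; g \<in> mor C X Y; h \<in> mor C X' Y'\<rbrakk> \<Longrightarrow>
      (f \<oplus>\<^bsub>hom_mod C X Y\<^esub> g) \<otimes>\<^sub>m h =
      (f \<otimes>\<^sub>m h) \<oplus>\<^bsub>hom_mod C (X \<otimes>\<^sub>o X') (Y \<otimes>\<^sub>o Y')\<^esub> (g \<otimes>\<^sub>m h)"
    and tens_add_right: "\<lbrakk>f \<in> mor C X Y; g \<in> mor C X' Y'; h \<in> mor C X' Y'\<rbrakk> \<Longrightarrow>
      f \<otimes>\<^sub>m (g \<oplus>\<^bsub>hom_mod C X' Y'\<^esub> h) =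
      (f \<otimes>\<^sub>m g) \<oplus>\<^bsub>hom_mod C (X \<otimes>\<^sub>o X') (Y \<otimes>\<^sub>o Y')\<^esub> (f \<otimes>\<^sub>m h)"
    and tens_smult_left: "\<lbrakk>f \<in> mor C X Y; g \<in> mor C X' Y'\<rbrakk> \<Longrightarrow>
      (q \<odot>\<^bsub>hom_mod C X Y\<^esub> f) \<otimes>\<^sub>m g = q \<odot>\<^bsub>hom_mod C (X \<otimes>\<^sub>o X') (Y \<otimes>\<^sub>o Y')\<^esub> (f \<otimes>\<^sub>m g)"
    and tens_smult_right: "\<lbrakk>f \<in> mor C X Y; g \<in> mor C X' Y'\<rbrakk> \<Longrightarrow>
      f \<otimes>\<^sub>m (q \<odot>\<^bsub>hom_mod C X' Y'\<^esub> g) = q \<odot>\<^bsub>hom_mod C (X \<otimes>\<^sub>o X') (Y \<otimes>\<^sub>o Y')\<^esub> (f \<otimes>\<^sub>m g)"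
    and associator_iso: "is_iso C ((X \<otimes>\<^sub>o Y) \<otimes>\<^sub>o Z) (X \<otimes>\<^sub>o (Y \<otimes>\<^sub>o Z)) (associator C X Y Z)"
    and lunitor_iso: "is_iso C (\<I> \<otimes>\<^sub>o X) X (lunitor C X)"
    and runitor_iso: "is_iso C (X \<otimes>\<^sub>o \<I>) X (runitor C X)"
    and braiding_in: "braiding C X Y \<in> mor C (X \<otimes>\<^sub>o Y) (Y \<otimes>\<^sub>o X)"
    and associator_natural: "\<lbrakk>f \<in> mor C X X'; g \<in> mor C Y Y'; h \<in> mor C Z Z'\<rbrakk> \<Longrightarrow>
      associator C X' Y' Z' \<bullet> ((f \<otimes>\<^sub>m g) \<otimes>\<^sub>m h) = (f \<otimes>\<^sub>m (g \<otimes>\<^sub>m h)) \<bullet> associator C X Y Z"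
    and lunitor_natural: "f \<in> mor C X Y \<Longrightarrow> lunitor C Y \<bullet> (idm C \<I> \<otimes>\<^sub>m f) = f \<bullet> lunitor C X"
    and runitor_natural: "f \<in> mor C X Y \<Longrightarrow> runitor C Y \<bullet> (f \<otimes>\<^sub>m idm C \<I>) = f \<bullet> runitor C X"
    and braiding_natural: "\<lbrakk>f \<in> mor C X X'; g \<in> mor C Y Y'\<rbrakk> \<Longrightarrow>
      braiding C X' Y' \<bullet> (f \<otimes>\<^sub>m g) = (g \<otimes>\<^sub>m f) \<bullet> braiding C X Y"
    and pentagon:
      "associator C W X (Y \<otimes>\<^sub>o Z) \<bullet> associator C (W \<otimes>\<^sub>o X) Y Z =
       (idm C W \<otimes>\<^sub>m associator C X Y Z) \<bullet> associator C W (X \<otimes>\<^sub>o Y) Z \<bullet>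
         (associator C W X Y \<otimes>\<^sub>m idm C Z)"
    and triangle:
      "(idm C X \<otimes>\<^sub>m lunitor C Y) \<bullet> associator C X \<I> Y = runitor C X \<otimes>\<^sub>m idm C Y"
    and hexagon:
      "associator C Y Z X \<bullet> braiding C X (Y \<otimes>\<^sub>o Z) \<bullet> associator C X Y Z =
       (idm C Y \<otimes>\<^sub>m braiding C X Z) \<bullet> associator C Y X Z \<bullet> (braiding C X Y \<otimes>\<^sub>m idm C Z)"
    and symmetry: "braiding C Y X \<bullet> braiding C X Y = idm C (X \<otimes>\<^sub>o Y)"

locale rigid_karoubian_tensor_category = Q_linear_tensor_category +
  assumes karoubian: "\<lbrakk>p \<in> mor C X X; p \<bullet> p = p\<rbrakk> \<Longrightarrow> \<exists>K i. is_kernel C X X p K i"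
    and duals: "\<exists>D ev coev. is_dual C X D ev coev"


section \<open>Endomorphism rings, traces and representations\<close>

definition End_ring :: "('o, 'm) tensor_cat \<Rightarrow> 'o \<Rightarrow> 'm ring" where
  "End_ring C X = \<lparr>carrier = mor C X X, monoid.mult = cmp C, one = idm C X,
     zero = \<zero>\<^bsub>hom_mod C X X\<^esub>, add = add (hom_mod C X X)\<rparr>"

abbreviation scalars :: "('o, 'm) tensor_cat \<Rightarrow> 'm ring" where
  "scalars C \<equiv> End_ring C \<I>\<^bsub>C\<^esub>"

text \<open>The trace does not depend on the choice of the dual.\<close>

definition trace :: "('o, 'm) tensor_cat \<Rightarrow> 'o \<Rightarrow> 'm \<Rightarrow> 'm" where
  "trace C X f =
     (let (D, ev, coev) = (SOME (D, ev, coev). is_dual C X D ev coev)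
      in ev \<bullet>\<^bsub>C\<^esub> braiding C X D \<bullet>\<^bsub>C\<^esub> (f \<otimes>\<^sub>m\<^bsub>C\<^esub> idm C D) \<bullet>\<^bsub>C\<^esub> coev)"

text \<open>
  Objects of the category of representations of a monoid \<open>G\<close>. When \<open>G\<close> is a group, \<open>\<rho>\<close>
  takes its values in the automorphisms of \<open>X\<close>.
\<close>

definition representation ::
  "('o, 'm) tensor_cat \<Rightarrow> ('g, 'z) monoid_scheme \<Rightarrow> 'o \<Rightarrow> ('g \<Rightarrow> 'm) \<Rightarrow> bool" where
  "representation C G X \<rho> \<longleftrightarrow> \<rho> \<in> hom G (End_ring C X) \<and> \<rho> \<one>\<^bsub>G\<^esub> = idm C X"


section \<open>Exterior powers\<close>

fun tpow :: "('o, 'm) tensor_cat \<Rightarrow> 'o \<Rightarrow> nat \<Rightarrow> 'o" where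
  "tpow C X 0 = \<I>\<^bsub>C\<^esub>"
| "tpow C X (Suc n) = X \<otimes>\<^sub>o\<^bsub>C\<^esub> tpow C X n"

fun tpow_mor :: "('o, 'm) tensor_cat \<Rightarrow> 'm \<Rightarrow> nat \<Rightarrow> 'm" where
  "tpow_mor C f 0 = idm C \<I>\<^bsub>C\<^esub>"
| "tpow_mor C f (Suc n) = f \<otimes>\<^sub>m\<^bsub>C\<^esub> tpow_mor C f n"

text \<open>
  \<open>swap_mor C X n j\<close> exchanges the tensor factors \<open>j\<close> and \<open>j + 1\<close> of \<open>tpow C X (n + 2)\<close>,
  counted from \<open>0\<close>, where \<open>j \<le> n\<close>.
\<close>

fun swap_mor :: "('o, 'm) tensor_cat \<Rightarrow> 'o \<Rightarrow> nat \<Rightarrow> nat \<Rightarrow> 'm" where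
  "swap_mor C X n 0 =
     associator C X X (tpow C X n) \<bullet>\<^bsub>C\<^esub> (braiding C X X \<otimes>\<^sub>m\<^bsub>C\<^esub> idm C (tpow C X n)) \<bullet>\<^bsub>C\<^esub>
     inverse_of C ((X \<otimes>\<^sub>o\<^bsub>C\<^esub> X) \<otimes>\<^sub>o\<^bsub>C\<^esub> tpow C X n) (X \<otimes>\<^sub>o\<^bsub>C\<^esub> (X \<otimes>\<^sub>o\<^bsub>C\<^esub> tpow C X n))
       (associator C X X (tpow C X n))"
| "swap_mor C X n (Suc j) = idm C X \<otimes>\<^sub>m\<^bsub>C\<^esub> swap_mor C X (n - 1) j"

text \<open>
  The action of the symmetric group on a tensor power is the group homomorphism that sends the
  adjacent transpositions to the symmetries; \<open>perm_graph C X n\<close> is its graph.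
\<close>

inductive perm_graph :: "('o, 'm) tensor_cat \<Rightarrow> 'o \<Rightarrow> nat \<Rightarrow> (nat \<Rightarrow> nat) \<Rightarrow> 'm \<Rightarrow> bool"
  for C X n where
  perm_graph_id: "perm_graph C X n id (idm C (tpow C X n))"
| perm_graph_step: "\<lbrakk>perm_graph C X n \<sigma> f; Suc j < n\<rbrakk> \<Longrightarrow>
    perm_graph C X n (transpose j (Suc j) \<circ> \<sigma>) (swap_mor C X (n - 2) j \<bullet>\<^bsub>C\<^esub> f)"

definition perm_mor :: "('o, 'm) tensor_cat \<Rightarrow> 'o \<Rightarrow> nat \<Rightarrow> (nat \<Rightarrow> nat) \<Rightarrow> 'm" where
  "perm_mor C X n \<sigma> = (THE f. perm_graph C X n \<sigma> f)"

definition antisymmetrizer :: "('o, 'm) tensor_cat \<Rightarrow> 'o \<Rightarrow> nat \<Rightarrow> 'm" where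
  "antisymmetrizer C X n =
     (let E = hom_mod C (tpow C X n) (tpow C X n)
      in (1 / fact n) \<odot>\<^bsub>E\<^esub>
           (\<Oplus>\<^bsub>E\<^esub>\<sigma>\<in>{\<sigma>. \<sigma> permutes {..<n}}. of_int (sign \<sigma>) \<odot>\<^bsub>E\<^esub> perm_mor C X n \<sigma>))"

text \<open>
  The image \<open>Y\<close> of a projector \<open>p\<close> on \<open>X\<close>, with its inclusion \<open>i\<close> and the corestriction \<open>r\<close> of \<open>p\<close>.
\<close>

definition is_image ::
  "('o, 'm) tensor_cat \<Rightarrow> 'o \<Rightarrow> 'm \<Rightarrow> 'o \<Rightarrow> 'm \<Rightarrow> 'm \<Rightarrow> bool" where
  "is_image C X p Y i r \<longleftrightarrow>
     i \<in> mor C Y X \<and> r \<in> mor C X Y \<and> i \<bullet>\<^bsub>C\<^esub> r = p \<and> r \<bullet>\<^bsub>C\<^esub> i = idm C Y"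

definition alt_image :: "('o, 'm) tensor_cat \<Rightarrow> 'o \<Rightarrow> nat \<Rightarrow> 'o \<times> 'm \<times> 'm" where
  "alt_image C X n =
     (SOME (Y, i, r). is_image C (tpow C X n) (antisymmetrizer C X n) Y i r)"

definition Alt :: "('o, 'm) tensor_cat \<Rightarrow> 'o \<Rightarrow> nat \<Rightarrow> 'o" where
  "Alt C X n = fst (alt_image C X n)"

text \<open>The restriction of the \<open>n\<close>-th tensor power of \<open>f\<close> to \<open>Alt C X n\<close>.\<close>

definition Alt_mor :: "('o, 'm) tensor_cat \<Rightarrow> 'o \<Rightarrow> 'm \<Rightarrow> nat \<Rightarrow> 'm" where
  "Alt_mor C X f n =
     (let (Y, i, r) = alt_image C X n in r \<bullet>\<^bsub>C\<^esub> tpow_mor C f n \<bullet>\<^bsub>C\<^esub> i)"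

definition chi_bar :: "('o, 'm) tensor_cat \<Rightarrow> 'o \<Rightarrow> ('g \<Rightarrow> 'm) \<Rightarrow> 'g \<Rightarrow> nat \<Rightarrow> 'm" where
  "chi_bar C X \<rho> g = (\<lambda>i. trace C (Alt C X i) (Alt_mor C X (\<rho> g) i))"


section \<open>Lambda-rings and Adams operations\<close>

record 'a lambda_ring = "'a ring" +
  lam :: "nat \<Rightarrow> 'a \<Rightarrow> 'a"

text \<open>Formal power series are represented by their sequences of coefficients.\<close>

definition fps_ring :: "('a, 'z) ring_scheme \<Rightarrow> (nat \<Rightarrow> 'a) ring" where
  "fps_ring A =
     \<lparr>carrier = {f. \<forall>n. f n \<in> carrier A},
      monoid.mult = (\<lambda>f g n. \<Oplus>\<^bsub>A\<^esub>i\<in>{..n}. f i \<otimes>\<^bsub>A\<^esub> g (n - i)),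
      one = (\<lambda>n. if n = 0 then \<one>\<^bsub>A\<^esub> else \<zero>\<^bsub>A\<^esub>),
      zero = (\<lambda>n. \<zero>\<^bsub>A\<^esub>),
      add = (\<lambda>f g n. f n \<oplus>\<^bsub>A\<^esub> g n)\<rparr>"

text \<open>\<open>s da/ds\<close> has the coefficients \<open>n a\<^sub>n\<close>.\<close>

definition s_deriv :: "('a, 'z) ring_scheme \<Rightarrow> (nat \<Rightarrow> 'a) \<Rightarrow> nat \<Rightarrow> 'a" where
  "s_deriv A f = (\<lambda>n. [n] \<cdot>\<^bsub>A\<^esub> f n)"

definition adams :: "('a, 'z) lambda_ring_scheme \<Rightarrow> nat \<Rightarrow> 'a \<Rightarrow> 'a" where
  "adams A n x =
     (let lx = (\<lambda>i. lam A i x);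
          q = (\<ominus>\<^bsub>fps_ring A\<^esub> s_deriv A lx) \<otimes>\<^bsub>fps_ring A\<^esub> inv\<^bsub>fps_ring A\<^esub> lx
      in (\<ominus>\<^bsub>A\<^esub> \<one>\<^bsub>A\<^esub>) [^]\<^bsub>A\<^esub> n \<otimes>\<^bsub>A\<^esub> q n)"

text \<open>Polynomials with integer coefficients in variables indexed by \<open>'v\<close>.\<close>

type_synonym 'v zpoly = "('v \<Rightarrow>\<^sub>0 nat) \<Rightarrow>\<^sub>0 int"

definition zvar :: "'v \<Rightarrow> 'v zpoly" where
  "zvar v = Poly_Mapping.single (Poly_Mapping.single v 1) 1"

definition zeval :: "('a, 'z) ring_scheme \<Rightarrow> ('v \<Rightarrow> 'a) \<Rightarrow> 'v zpoly \<Rightarrow> 'a" where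
  "zeval R a P =
     (\<Oplus>\<^bsub>R\<^esub>m\<in>Poly_Mapping.keys P. [Poly_Mapping.lookup P m] \<cdot>\<^bsub>R\<^esub>
        (\<Otimes>\<^bsub>R\<^esub>v\<in>Poly_Mapping.keys m. a v [^]\<^bsub>R\<^esub> Poly_Mapping.lookup m v))"

text \<open>
  The universal polynomials. The variable \<open>i\<close> stands for the coefficient of \<open>t\<^sup>i\<^sup>+\<^sup>1\<close>, so
  that there is no variable for the constant coefficient \<open>1\<close>. The identities that
  determine the polynomials are required for every number of factors \<open>1 + x\<^sub>i t\<close> and
  \<open>1 + y\<^sub>j t\<close>, the \<open>x\<^sub>i\<close> and \<open>y\<^sub>j\<close> being variables.
\<close>

definition univ_mult_poly :: "nat \<Rightarrow> (nat + nat) zpoly" where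
  "univ_mult_poly n = (THE P. \<forall>N M.
     (let x = (\<lambda>i. zvar (Inl i) :: (nat + nat) zpoly); y = (\<lambda>j. zvar (Inr j))
      in zeval type_ring
           (case_sum (\<lambda>i. Polynomial.coeff (\<Prod>k<N. [:1, x k:]) (Suc i))
                     (\<lambda>j. Polynomial.coeff (\<Prod>k<M. [:1, y k:]) (Suc j))) P =
         Polynomial.coeff (\<Prod>i<N. \<Prod>j<M. [:1, x i * y j:]) n))"

definition univ_lam_poly :: "nat \<Rightarrow> nat \<Rightarrow> nat zpoly" where
  "univ_lam_poly m n = (THE P. \<forall>N.
     (let x = (zvar :: nat \<Rightarrow> nat zpoly)
      in zeval type_ring (\<lambda>i. Polynomial.coeff (\<Prod>k<N. [:1, x k:]) (Suc i)) P =
         Polynomial.coeff (\<Prod>S | S \<subseteq> {..<N} \<and> card S = m. [:1, \<Prod>i\<in>S. x i:]) n))"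

text \<open>The \<open>\<lambda>\<close>-ring \<open>1 + t R[[t]]\<close>; its addition is the multiplication of power series.\<close>

definition Lambda :: "('a, 'z) ring_scheme \<Rightarrow> (nat \<Rightarrow> 'a) lambda_ring" where
  "Lambda R =
     \<lparr>carrier = {f. f 0 = \<one>\<^bsub>R\<^esub> \<and> (\<forall>n. f n \<in> carrier R)},
      monoid.mult = (\<lambda>f g n. zeval R (case_sum (\<lambda>i. f (Suc i)) (\<lambda>j. g (Suc j))) (univ_mult_poly n)),
      one = (\<lambda>n. if n \<le> 1 then \<one>\<^bsub>R\<^esub> else \<zero>\<^bsub>R\<^esub>),
      zero = \<one>\<^bsub>fps_ring R\<^esub>,
      add = monoid.mult (fps_ring R),
      lam = (\<lambda>m f n. zeval R (\<lambda>i. f (Suc i)) (univ_lam_poly m n))\<rparr>"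

end

(*
  An element f = prod (1 + x_i t) of Lambda(R) has the ghost components p_r(f) = sum x_i^r, which are
  determined by the coefficients of f through Newton's identities. If R has no torsion, they determine f.
  By the theorem on symmetric polynomials, each p_r is a ring homomorphism from Lambda(R) to R, and applying
  p_r to the definition of the Adams operations gives p_r(psi_n f) = p_{rn}(f).

  On the categorical side, let chi_n be the trace of f on Alt^n(X). Expanding the antisymmetrizer according
  to the image of the first tensor factor, and using that a cycle in a tensor product of endomorphisms
  has as trace the trace of their composition, one finds that (n + 1) chi_{n+1} = sum_i (-1)^i tr(f^{i+1}) chi_{n-i}.
  These are Newton's identities, hence p_r(chi(f)) = tr(f^r) for r > 0. Both sides of the claim thus have the
  ghost components tr(g^{rn}).
*)
theory Submission
  imports
    Defs
    "HOL-Computational_Algebra.Fundamental_Theorem_Algebra"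
    "HOL-Computational_Algebra.Polynomial_FPS"
begin

section \<open>Evaluation of integer polynomials\<close>

text \<open>Ghost components are injective on \<Lambda>(k) because \<open>End(\<I>)\<close> is a
  rational vector space. The same injectivity yields the ring axioms of \<Lambda>(k), without which
  the sums and the inverse series in \<open>adams\<close> cannot be handled. Three obstacles shape
  the rest. The tensor product is not strict: tensor powers are bracketed to the right, so every
  operation on their first factors is written with a spectator object W on the right, and exchanging
  two neighbours becomes a single natural arrow \<open>SW\<close>. Next, fusing two factors of f
  \<otimes> ... \<otimes> f gives f^2 \<otimes> f \<otimes> ... \<otimes> f, so the expansion of the
  antisymmetrizer does not close up on exterior traces; it does on hook traces, with f^m in one
  factor, which must then be eliminated. Finally, the universal polynomials are definite
  descriptions quantified over every number of variables. One polynomial that serves all N must be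
  constructed, and its uniqueness shown, before anything in \<Lambda>(k) can be computed; uniqueness
  is tested at complex points, where polynomials with constant term 1 split into linear
  factors.\<close>

definition ring_of_int :: "('a, 'z) ring_scheme \<Rightarrow> int \<Rightarrow> 'a" where
  "ring_of_int R k = [k] \<cdot>\<^bsub>R\<^esub> \<one>\<^bsub>R\<^esub>"

context cring
begin

abbreviation em :: "int \<Rightarrow> 'a" where "em \<equiv> ring_of_int R"

lemma em_closed [simp, intro]: "em k \<in> carrier R"
  by (simp add: ring_of_int_def)

lemma em_1 [simp]: "em 1 = \<one>" and em_0 [simp]: "em 0 = \<zero>"
  by (simp_all add: ring_of_int_def add.int_pow_1 add_pow_int_ge)

lemma em_add: "em (k + l) = em k \<oplus> em l"
  by (simp add: ring_of_int_def add.int_pow_mult)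

lemma em_uminus: "em (- k) = \<ominus> em k"
  by (simp add: ring_of_int_def add.int_pow_neg)

lemma add_pow_int_em: fixes k :: int shows "x \<in> carrier R \<Longrightarrow> [k] \<cdot> x = em k \<otimes> x"
  by (simp add: ring_of_int_def add_pow_ldistr_int)

lemma add_pow_nat_em: fixes n :: nat shows "x \<in> carrier R \<Longrightarrow> [n] \<cdot> x = em (int n) \<otimes> x"
  by (simp flip: add_pow_int_em add: add_pow_int_ge)

lemma em_mult: "em (k * l) = em k \<otimes> em l"
proof -
  have "em k \<otimes> em l = [k] \<cdot> ([l] \<cdot> \<one>)" by (simp add: add_pow_int_em)
  then show ?thesis by (simp add: ring_of_int_def add.int_pow_pow mult.commute)
qed

lemma em_minus_1: "x \<in> carrier R \<Longrightarrow> em (- 1) \<otimes> x = \<ominus> x"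
  by (simp add: em_uminus l_minus)

text \<open>The subtracted term for (n + 1, m) is the left side for (n, m + 1), so each substitution
  flips the sign and raises the argument of \<open>T\<close> by one; the chain stops at n = 0, where
  the subtracted term carries the factor \<open>em 0\<close>. For m = 1 the outcome is Newton's
  identity.\<close>

lemma newton_chain:
  assumes c: "\<And>n m. c n m \<in> carrier R" and T: "\<And>m. T m \<in> carrier R"
    and rec: "\<And>n m. em (int (Suc n)) \<otimes> c (Suc n) m = (c n 1 \<otimes> T m) \<ominus> (em (int n) \<otimes> c n (Suc m))"
  shows "em (int (Suc n)) \<otimes> c (Suc n) m = (\<Oplus>i\<in>{..n}. em ((- 1) ^ i) \<otimes> (T (m + i) \<otimes> c (n - i) 1))"
proof (induction n arbitrary: m)
  case 0
  show ?case using c[of 0] T[of m] rec[of 0 m] by (simp add: minus_eq m_comm)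
next
  case (Suc n)
  have "em (int (Suc (Suc n))) \<otimes> c (Suc (Suc n)) m = (c (Suc n) 1 \<otimes> T m) \<ominus> (\<Oplus>i\<in>{..n}. em ((- 1) ^ i) \<otimes> (T (Suc m + i) \<otimes> c (n - i) 1))"
    using rec[of "Suc n" m] Suc.IH[of "Suc m"] by simp
  also have "\<dots> = (c (Suc n) 1 \<otimes> T m) \<oplus> em (-1) \<otimes> (\<Oplus>i\<in>{..n}. em ((- 1) ^ i) \<otimes> (T (Suc m + i) \<otimes> c (n - i) 1))"
    using c T by (subst em_minus_1) (auto simp: minus_eq)
  also have "em (-1) \<otimes> (\<Oplus>i\<in>{..n}. em ((- 1) ^ i) \<otimes> (T (Suc m + i) \<otimes> c (n - i) 1)) =
      (\<Oplus>i\<in>{..n}. em ((- 1) ^ Suc i) \<otimes> (T (m + Suc i) \<otimes> c (Suc n - Suc i) 1))"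
    using c T by (subst finsum_rdistr) (auto simp: em_mult[symmetric] m_assoc[symmetric] intro!: finsum_cong')
  also have "(c (Suc n) 1 \<otimes> T m) \<oplus> \<dots> = (\<Oplus>i\<in>{..Suc n}. em ((- 1) ^ i) \<otimes> (T (m + i) \<otimes> c (Suc n - i) 1))"
    using c T by (subst finsum_Suc2) (auto simp: m_comm a_comm)
  finally show ?case .
qed

end

lemma type_ring_sel [simp]:
  "carrier (type_ring :: 'a::comm_ring_1 ring) = UNIV" "(x::'a) \<otimes>\<^bsub>type_ring\<^esub> y = x * y"
  "(\<one>\<^bsub>type_ring\<^esub> :: 'a) = 1" "(\<zero>\<^bsub>type_ring\<^esub> :: 'a) = 0" "(x::'a) \<oplus>\<^bsub>type_ring\<^esub> y = x + y"
  by (simp_all add: type_ring_def)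

lemma type_ring_cring: "cring (type_ring :: 'a::comm_ring_1 ring)"
  by (intro cringI abelian_groupI comm_monoidI) (auto simp: algebra_simps intro: exI[of _ "- _"] add.left_inverse)

lemma type_ring_finsum: "finsum (type_ring :: 'a::comm_ring_1 ring) f A = sum f A"
proof -
  interpret R: cring "type_ring :: 'a ring" by (rule type_ring_cring)
  show ?thesis by (induction A rule: infinite_finite_induct) (auto simp: R.finsum_infinite)
qed

lemma type_ring_finprod: "finprod (type_ring :: 'a::comm_ring_1 ring) f A = prod f A"
proof -
  interpret R: cring "type_ring :: 'a ring" by (rule type_ring_cring)
  show ?thesis by (induction A rule: infinite_finite_induct) auto
qed

lemma type_ring_power: fixes x :: "'a::comm_ring_1" and n :: nat shows "x [^]\<^bsub>type_ring\<^esub> n = x ^ n"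
  by (induction n) (simp_all add: nat_pow_def mult.commute)

lemma type_ring_minus: "\<ominus>\<^bsub>type_ring\<^esub> (x :: 'a::comm_ring_1) = - x"
proof -
  interpret R: cring "type_ring :: 'a ring" by (rule type_ring_cring)
  show ?thesis by (rule R.minus_equality) auto
qed

lemma type_ring_add_pow: fixes n :: nat and k :: int
  shows "[n] \<cdot>\<^bsub>type_ring\<^esub> (x :: 'a::comm_ring_1) = of_nat n * x" "[k] \<cdot>\<^bsub>type_ring\<^esub> x = of_int k * x"
proof -
  interpret R: cring "type_ring :: 'a ring" by (rule type_ring_cring)
  show 1: "[n] \<cdot>\<^bsub>type_ring\<^esub> x = of_nat n * x" for n :: nat by (induction n) (simp_all add: algebra_simps)
  show "[k] \<cdot>\<^bsub>type_ring\<^esub> x = of_int k * x"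
    by (cases "k \<ge> 0") (simp_all add: add_pow_int_ge add_pow_int_lt 1 type_ring_minus)
qed

definition zmonom :: "('a, 'z) ring_scheme \<Rightarrow> ('v \<Rightarrow> 'a) \<Rightarrow> ('v \<Rightarrow>\<^sub>0 nat) \<Rightarrow> 'a" where
  "zmonom R a m = (\<Otimes>\<^bsub>R\<^esub>v\<in>Poly_Mapping.keys m. a v [^]\<^bsub>R\<^esub> Poly_Mapping.lookup m v)"

lemma zeval_type_ring: "zeval type_ring a P = (\<Sum>m\<in>Poly_Mapping.keys P. of_int (Poly_Mapping.lookup P m) *
   (\<Prod>v\<in>Poly_Mapping.keys m. a v ^ Poly_Mapping.lookup m v))"
  by (simp add: zeval_def type_ring_finsum type_ring_finprod type_ring_add_pow type_ring_power)

context cring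
begin

context
  fixes a :: "'v \<Rightarrow> 'a"
  assumes a: "\<And>v. a v \<in> carrier R"
begin

lemma zmonom_closed: "zmonom R a m \<in> carrier R"
  unfolding zmonom_def by (rule finprod_closed) (auto simp: a)

lemma zmonom_superset: "finite V \<Longrightarrow> Poly_Mapping.keys m \<subseteq> V \<Longrightarrow> zmonom R a m = (\<Otimes>v\<in>V. a v [^] Poly_Mapping.lookup m v)"
  unfolding zmonom_def by (rule finprod_mono_neutral_cong_left) (auto simp: a in_keys_iff)

lemma zmonom_add: "zmonom R a (m + m') = zmonom R a m \<otimes> zmonom R a m'"
proof -
  let ?V = "Poly_Mapping.keys m \<union> Poly_Mapping.keys m'"
  have "zmonom R a (m + m') = (\<Otimes>v\<in>?V. a v [^] Poly_Mapping.lookup m v \<otimes> a v [^] Poly_Mapping.lookup m' v)"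
    using keys_add[of m m'] by (subst zmonom_superset[of ?V]) (auto simp: lookup_add nat_pow_mult a)
  also have "\<dots> = (\<Otimes>v\<in>?V. a v [^] Poly_Mapping.lookup m v) \<otimes> (\<Otimes>v\<in>?V. a v [^] Poly_Mapping.lookup m' v)"
    by (rule finprod_multf) (auto simp: a)
  finally show ?thesis by (simp add: zmonom_superset[of ?V])
qed

lemma zmonom_0: "zmonom R a 0 = \<one>"
  by (simp add: zmonom_def)

lemma zmonom_single: "zmonom R a (Poly_Mapping.single v 1) = a v"
  by (simp add: zmonom_def a)

lemma zeval_zmonom: "zeval R a P = (\<Oplus>m\<in>Poly_Mapping.keys P. em (Poly_Mapping.lookup P m) \<otimes> zmonom R a m)"
  unfolding zeval_def zmonom_def[symmetric] by (intro finsum_cong') (auto simp: zmonom_closed add_pow_int_em)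

lemma zeval_superset: "finite K \<Longrightarrow> Poly_Mapping.keys P \<subseteq> K \<Longrightarrow>
    zeval R a P = (\<Oplus>m\<in>K. em (Poly_Mapping.lookup P m) \<otimes> zmonom R a m)"
  unfolding zeval_zmonom by (rule add.finprod_mono_neutral_cong_left) (auto simp: zmonom_closed in_keys_iff)

lemma zeval_closed: "zeval R a P \<in> carrier R"
  unfolding zeval_zmonom by (rule finsum_closed) (auto simp: zmonom_closed)

lemma zeval_add: "zeval R a (P + Q) = zeval R a P \<oplus> zeval R a Q"
proof -
  let ?K = "Poly_Mapping.keys P \<union> Poly_Mapping.keys Q"
  have "zeval R a (P + Q) = (\<Oplus>m\<in>?K. em (Poly_Mapping.lookup P m) \<otimes> zmonom R a m \<oplus> em (Poly_Mapping.lookup Q m) \<otimes> zmonom R a m)"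
    using keys_add[of P Q] by (subst zeval_superset[of ?K]) (auto simp: lookup_add em_add l_distr zmonom_closed)
  also have "\<dots> = (\<Oplus>m\<in>?K. em (Poly_Mapping.lookup P m) \<otimes> zmonom R a m) \<oplus> (\<Oplus>m\<in>?K. em (Poly_Mapping.lookup Q m) \<otimes> zmonom R a m)"
    by (rule finsum_addf) (auto simp: zmonom_closed)
  finally show ?thesis by (simp add: zeval_superset[of ?K])
qed

lemma zeval_0: "zeval R a 0 = \<zero>"
  by (simp add: zeval_def)

lemma zeval_diff: "zeval R a (P - Q) = zeval R a P \<ominus> zeval R a Q"
proof -
  have "zeval R a (P - Q) \<oplus> zeval R a Q = zeval R a P" by (simp flip: zeval_add)
  then have "zeval R a P \<ominus> zeval R a Q = (zeval R a (P - Q) \<oplus> zeval R a Q) \<ominus> zeval R a Q" by simp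
  also have "\<dots> = zeval R a (P - Q)"
    using zeval_closed[of "P - Q"] zeval_closed[of Q] by (simp add: minus_eq a_assoc r_neg)
  finally show ?thesis by simp
qed

lemma zeval_single: "zeval R a (Poly_Mapping.single m 1) = zmonom R a m"
  by (simp add: zeval_zmonom zmonom_closed)

text \<open>An integer polynomial is an element of the free abelian group on its monomials, so
  \<open>frag_induction\<close> reduces multiplicativity to single monomials, here in Q and in
  \<open>zeval_mult\<close> in P.\<close>

lemma zeval_mult_single: "zeval R a (Poly_Mapping.single m 1 * Q) = zmonom R a m \<otimes> zeval R a Q"
proof (induction Q rule: frag_induction[OF subset_UNIV])
  case (2 m')
  then show ?case by (simp add: mult_single zeval_single zmonom_add)
next
  case (3 P Q)
  then show ?case using zeval_closed[of P] zeval_closed[of Q]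
    by (simp add: right_diff_distrib zeval_diff minus_eq r_distr r_minus zmonom_closed)
qed (simp add: zeval_0 zmonom_closed)

lemma zeval_mult: "zeval R a (P * Q) = zeval R a P \<otimes> zeval R a Q"
proof (induction P rule: frag_induction[OF subset_UNIV])
  case (2 m')
  then show ?case by (simp add: zeval_mult_single zeval_single)
next
  case (3 P P')
  then show ?case using zeval_closed[of P] zeval_closed[of P'] zeval_closed[of Q]
    by (simp add: left_diff_distrib zeval_diff minus_eq l_distr l_minus)
qed (simp add: zeval_0 zeval_closed)

lemma zeval_zvar: "zeval R a (zvar v) = a v"
  by (simp only: zvar_def zeval_single zmonom_single)

lemma zeval_1: "zeval R a 1 = \<one>"
  using zeval_single[of 0] by (simp add: zmonom_0)

lemma zeval_ring_hom: "zeval R a \<in> ring_hom type_ring R"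
  by (rule ring_hom_memI) (auto simp: zeval_closed zeval_mult zeval_add zeval_1)

end

text \<open>An evaluation is built from ring operations, which h preserves. This is the bridge by
  which identities established in type class rings reach the ring R, which is given only as a record
  with a carrier.\<close>

lemma zeval_hom_comp:
  assumes "h \<in> ring_hom (type_ring :: 'c::comm_ring_1 ring) R"
  shows "h (zeval type_ring b P) = zeval R (h \<circ> b) P"
proof -
  interpret T: cring "type_ring :: 'c ring" by (rule type_ring_cring)
  interpret H: ring_hom_cring "type_ring :: 'c ring" R h by unfold_locales (use assms in auto)
  have pw: "h (x [^]\<^bsub>type_ring\<^esub> n) = h x [^] n" for x and n :: nat
    by (induction n) (simp_all del: type_ring_sel(2-))
  have em: "h (T.em k) = em k" for k
  proof -
    have n: "h (T.em (int n)) = em (int n)" for n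
      by (induction n) (simp_all add: T.em_add em_add del: type_ring_sel)
    show ?thesis
    proof (cases "k \<ge> 0")
      case True then show ?thesis using n[of "nat k"] by simp
    next
      case False then show ?thesis using n[of "nat (- k)"] T.em_uminus[of "- k"] em_uminus[of "- k"] by (simp del: type_ring_sel)
    qed
  qed
  have m: "h (zmonom type_ring b m) = zmonom R (h \<circ> b) m" for m
    unfolding zmonom_def by (subst H.hom_finprod) (auto simp: pw comp_def)
  have c: "(h \<circ> b) v \<in> carrier R" for v by simp
  have "h (zeval type_ring b P) = h (\<Oplus>\<^bsub>type_ring\<^esub>m\<in>Poly_Mapping.keys P. T.em (Poly_Mapping.lookup P m) \<otimes>\<^bsub>type_ring\<^esub> zmonom type_ring b m)"
    by (subst T.zeval_zmonom) simp_all
  also have "\<dots> = (\<Oplus>m\<in>Poly_Mapping.keys P. h (T.em (Poly_Mapping.lookup P m) \<otimes>\<^bsub>type_ring\<^esub> zmonom type_ring b m))"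
    by (subst H.hom_finsum) (simp_all add: comp_def)
  also have "\<dots> = (\<Oplus>m\<in>Poly_Mapping.keys P. em (Poly_Mapping.lookup P m) \<otimes> zmonom R (h \<circ> b) m)"
    by (simp add: em m del: type_ring_sel(2-))
  also have "\<dots> = zeval R (h \<circ> b) P"
    by (rule zeval_zmonom[OF c, symmetric])
  finally show ?thesis .
qed

end

section \<open>Permutations\<close>

text \<open>
  A permutation of \<open>n + 1\<close> letters is decomposed into the image \<open>s 0\<close> and the permutation \<open>red_perm s\<close>
  of \<open>n\<close> letters obtained by deleting \<open>0\<close> and \<open>s 0\<close> and renumbering; \<open>lift_perm\<close> is the inverse operation.
\<close>

definition lift_perm :: "nat \<Rightarrow> (nat \<Rightarrow> nat) \<Rightarrow> nat \<Rightarrow> nat" where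
  "lift_perm p s i = (case i of 0 \<Rightarrow> p | Suc j \<Rightarrow> if s j < p then s j else Suc (s j))"

definition red_perm :: "(nat \<Rightarrow> nat) \<Rightarrow> nat \<Rightarrow> nat" where
  "red_perm s i = (if s 0 < s (Suc i) then s (Suc i) - 1 else s (Suc i))"

lemma lift_perm_simps [simp]: "lift_perm p s 0 = p" "lift_perm p s (Suc j) = (if s j < p then s j else Suc (s j))"
  by (simp_all add: lift_perm_def)

lemma lift_perm_permutes: assumes "s permutes {..<n}" "p \<le> n" shows "lift_perm p s permutes {..<Suc n}"
proof (rule inj_imp_permutes)
  have s: "s i < n \<longleftrightarrow> i < n" for i using permutes_in_image[OF assms(1)] by simp
  have inj: "s i = s j \<longleftrightarrow> i = j" for i j using permutes_inj[OF assms(1)] by (simp add: inj_eq)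
  show "inj_on (lift_perm p s) {..<Suc n}"
    by (auto simp: inj_on_def lift_perm_def inj split: nat.splits if_splits)
  show "lift_perm p s i \<in> {..<Suc n}" if "i \<in> {..<Suc n}" for i
    using that assms(2) s[of "i - 1"] by (cases i) auto
  show "lift_perm p s i = i" if "i \<notin> {..<Suc n}" for i
    using that assms(2) permutes_not_in[OF assms(1), of "i - 1"] by (cases i) auto
qed auto

lemma red_perm_permutes: assumes "s permutes {..<Suc n}" shows "red_perm s permutes {..<n}"
proof (rule inj_imp_permutes)
  have s: "i < Suc n \<longleftrightarrow> s i < Suc n" for i using permutes_in_image[OF assms(1)] by simp
  have inj: "s i = s j \<longleftrightarrow> i = j" for i j using permutes_inj[OF assms(1)] by (simp add: inj_eq)
  have n0: "s (Suc i) \<noteq> s 0" for i by (simp add: inj)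
  show "inj_on (red_perm s) {..<n}"
  proof (rule inj_onI)
    fix i j assume "red_perm s i = red_perm s j"
    then have "s (Suc i) = s (Suc j)" using n0[of i] n0[of j] by (auto simp: red_perm_def split: if_splits)
    then show "i = j" by (simp add: inj)
  qed
  show "red_perm s i \<in> {..<n}" if "i \<in> {..<n}" for i
    using that s[of "Suc i"] s[of 0] n0[of i] by (auto simp: red_perm_def)
  show "red_perm s i = i" if "i \<notin> {..<n}" for i
    using that permutes_not_in[OF assms(1), of "Suc i"] s[of 0] by (auto simp: red_perm_def)
qed auto

lemma red_lift [simp]: "red_perm (lift_perm p s) = s"
  by (auto simp: red_perm_def)

lemma lift_red: assumes "s permutes {..<n}" shows "lift_perm (s 0) (red_perm s) = s"
proof
  fix i
  have "s (Suc j) \<noteq> s 0" for j using permutes_inj[OF assms] by (simp add: inj_eq)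
  then show "lift_perm (s 0) (red_perm s) i = s i"
  proof (cases i)
    case (Suc j)
    then show ?thesis using \<open>s (Suc j) \<noteq> s 0\<close> by (auto simp: red_perm_def)
  qed simp
qed

text \<open>The renumbering in \<open>lift_perm p\<close> skips the value p, so raising p by one
  exchanges the roles of p and p + 1. This yields both the sign (-1)^p in \<open>sign_lift\<close>
  and the generation by adjacent transpositions.\<close>

lemma lift_Suc: "lift_perm (Suc p) s = transpose p (Suc p) \<circ> lift_perm p s"
  by (rule ext) (auto simp: lift_perm_def transpose_def split: nat.splits)

lemma lift_0_transpose: "lift_perm 0 (transpose j (Suc j) \<circ> s) = transpose (Suc j) (Suc (Suc j)) \<circ> lift_perm 0 s"
  by (rule ext) (auto simp: lift_perm_def transpose_def split: nat.splits)

lemma lift_0_id: "lift_perm 0 id = id"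
  by (rule ext) (auto simp: lift_perm_def split: nat.splits)

text \<open>Mirrors the two rules of \<open>perm_graph\<close> with the morphism forgotten, so that
  a derivation here can be replayed there.\<close>

inductive adj_gen :: "nat \<Rightarrow> (nat \<Rightarrow> nat) \<Rightarrow> bool" for n where
  adj_id: "adj_gen n id"
| adj_step: "adj_gen n s \<Longrightarrow> Suc j < n \<Longrightarrow> adj_gen n (transpose j (Suc j) \<circ> s)"

lemma adj_gen_lift_0: "adj_gen n s \<Longrightarrow> adj_gen (Suc n) (lift_perm 0 s)"
  by (induction rule: adj_gen.induct) (simp_all only: lift_0_id lift_0_transpose adj_gen.intros Suc_less_eq)

lemma adj_gen_lift: "adj_gen n s \<Longrightarrow> p \<le> n \<Longrightarrow> adj_gen (Suc n) (lift_perm p s)"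
  by (induction p) (auto simp: lift_Suc adj_gen_lift_0 intro: adj_gen.intros)

lemma permutes_adj_gen: "s permutes {..<n} \<Longrightarrow> adj_gen n s"
proof (induction n arbitrary: s)
  case 0
  then show ?case using adj_id[of 0] by (simp add: id_def)
next
  case (Suc n)
  have "s 0 \<le> n" using permutes_in_image[OF Suc.prems, of 0] by simp
  then show ?case using adj_gen_lift[OF Suc.IH[OF red_perm_permutes[OF Suc.prems]], of "s 0"] lift_red[OF Suc.prems] by simp
qed

lemma transpose_permutes: "Suc j < n \<Longrightarrow> transpose j (Suc j) permutes {..<n}"
  by (rule permutes_swap_id) auto

lemma adj_gen_permutes: "adj_gen n s \<Longrightarrow> s permutes {..<n}"
  by (induction rule: adj_gen.induct) (blast intro: permutes_compose transpose_permutes permutes_id)+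

lemma sign_adj: "s permutes {..<n::nat} \<Longrightarrow> sign (transpose j (Suc j) \<circ> s) = - sign s"
  using permutation_permutes finite_lessThan
  by (subst sign_compose) (auto simp: sign_swap_id permutation_swap_id)

lemma sign_adj_right: "s permutes {..<n::nat} \<Longrightarrow> sign (s \<circ> transpose j (Suc j)) = - sign s"
  using permutation_permutes finite_lessThan
  by (subst sign_compose) (auto simp: sign_swap_id permutation_swap_id)

lemma sign_lift_0: "adj_gen n s \<Longrightarrow> sign (lift_perm 0 s) = sign s"
proof (induction rule: adj_gen.induct)
  case (adj_step s j)
  note s = adj_gen_permutes[OF adj_step.hyps(1)]
  show ?case
    by (simp only: lift_0_transpose sign_adj[OF s] sign_adj[OF lift_perm_permutes[OF s le0]] adj_step.IH)
qed (simp only: lift_0_id)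

lemma sign_lift: "s permutes {..<n} \<Longrightarrow> p \<le> n \<Longrightarrow> sign (lift_perm p s) = (-1) ^ p * sign s"
proof (induction p)
  case (Suc p)
  then have "sign (lift_perm p s) = (-1) ^ p * sign s" "lift_perm p s permutes {..<Suc n}"
    using lift_perm_permutes[of s n p] by simp_all
  then show ?case by (simp only: lift_Suc sign_adj) simp
qed (simp add: sign_lift_0[OF permutes_adj_gen])

text \<open>The cases compare k and k + 1 with the deleted value \<open>s 0\<close>. If one of them
  is \<open>s 0\<close>, the transposition disappears in the renumbering; above \<open>s 0\<close>
  it is shifted down by one, below it is unchanged. They match the ways in which a generator passes
  a cycle in \<open>perm_arrow_step\<close>.\<close>

lemma red_transpose:
  assumes "s permutes {..<Suc n}"
  shows "k = s 0 \<or> Suc k = s 0 \<Longrightarrow> red_perm (transpose k (Suc k) \<circ> s) = red_perm s"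
    and "s 0 < k \<Longrightarrow> red_perm (transpose k (Suc k) \<circ> s) = transpose (k - 1) k \<circ> red_perm s"
    and "Suc k < s 0 \<Longrightarrow> red_perm (transpose k (Suc k) \<circ> s) = transpose k (Suc k) \<circ> red_perm s"
proof -
  have n0: "s (Suc i) \<noteq> s 0" for i using permutes_inj[OF assms] by (simp add: inj_eq)
  show "k = s 0 \<or> Suc k = s 0 \<Longrightarrow> red_perm (transpose k (Suc k) \<circ> s) = red_perm s"
  proof
    fix i assume "k = s 0 \<or> Suc k = s 0"
    then show "red_perm (transpose k (Suc k) \<circ> s) i = red_perm s i"
      using n0[of i] by (auto simp: red_perm_def transpose_def)
  qed
  show "s 0 < k \<Longrightarrow> red_perm (transpose k (Suc k) \<circ> s) = transpose (k - 1) k \<circ> red_perm s"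
  proof
    fix i assume "s 0 < k"
    then show "red_perm (transpose k (Suc k) \<circ> s) i = (transpose (k - 1) k \<circ> red_perm s) i"
      using n0[of i] by (auto simp: red_perm_def transpose_def)
  qed
  show "Suc k < s 0 \<Longrightarrow> red_perm (transpose k (Suc k) \<circ> s) = transpose k (Suc k) \<circ> red_perm s"
  proof
    fix i assume "Suc k < s 0"
    then show "red_perm (transpose k (Suc k) \<circ> s) i = (transpose k (Suc k) \<circ> red_perm s) i"
      using n0[of i] by (auto simp: red_perm_def transpose_def)
  qed
qed

section \<open>Arrows with domain and codomain\<close>

context Q_linear_tensor_category
begin

text \<open>
  The morphisms of the category do not know their domain and codomain. An arrow is \<open>Some (X, Y, f)\<close> with
  \<open>f\<close> a morphism from \<open>X\<close> to \<open>Y\<close>; ill-typed expressions evaluate to \<open>None\<close>. Equations between arrows can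
  therefore often be used for rewriting without side conditions.
\<close>

definition mk :: "'a \<Rightarrow> 'a \<Rightarrow> 'b \<Rightarrow> ('a \<times> 'a \<times> 'b) option" where
  "mk X Y f = (if f \<in> mor C X Y then Some (X, Y, f) else None)"

definition ar :: "('a \<times> 'a \<times> 'b) option \<Rightarrow> bool" where
  "ar f \<longleftrightarrow> (\<exists>X Y m. f = Some (X, Y, m) \<and> m \<in> mor C X Y)"

definition dm :: "('a \<times> 'a \<times> 'b) option \<Rightarrow> 'a" where "dm f = fst (the f)"
definition cd :: "('a \<times> 'a \<times> 'b) option \<Rightarrow> 'a" where "cd f = fst (snd (the f))"
definition mp :: "('a \<times> 'a \<times> 'b) option \<Rightarrow> 'b" where "mp f = snd (snd (the f))"

definition cp :: "('a \<times> 'a \<times> 'b) option \<Rightarrow> ('a \<times> 'a \<times> 'b) option \<Rightarrow> ('a \<times> 'a \<times> 'b) option"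
    (infixr \<open>\<star>\<close> 55) where
  "g \<star> f = (if ar g \<and> ar f \<and> cd f = dm g then Some (dm f, cd g, mp g \<bullet> mp f) else None)"

definition tn :: "('a \<times> 'a \<times> 'b) option \<Rightarrow> ('a \<times> 'a \<times> 'b) option \<Rightarrow> ('a \<times> 'a \<times> 'b) option"
    (infixr \<open>\<boxtimes>\<close> 75) where
  "f \<boxtimes> g = (if ar f \<and> ar g then Some (dm f \<otimes>\<^sub>o dm g, cd f \<otimes>\<^sub>o cd g, mp f \<otimes>\<^sub>m mp g) else None)"

definition ID :: "'a \<Rightarrow> ('a \<times> 'a \<times> 'b) option" where "ID X = mk X X (idm C X)"

abbreviation whl (infixr \<open>\<triangleright>\<close> 75) where "X \<triangleright> f \<equiv> ID X \<boxtimes> f"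
abbreviation whr (infixl \<open>\<triangleleft>\<close> 75) where "f \<triangleleft> X \<equiv> f \<boxtimes> ID X"

lemma ar_mk [simp]: "ar (mk X Y f) \<longleftrightarrow> f \<in> mor C X Y"
  and dm_mk [simp]: "f \<in> mor C X Y \<Longrightarrow> dm (mk X Y f) = X"
  and cd_mk [simp]: "f \<in> mor C X Y \<Longrightarrow> cd (mk X Y f) = Y"
  and mp_mk [simp]: "f \<in> mor C X Y \<Longrightarrow> mp (mk X Y f) = f"
  by (auto simp: mk_def ar_def dm_def cd_def mp_def)

lemma ar_mp: "ar f \<Longrightarrow> mp f \<in> mor C (dm f) (cd f)"
  by (auto simp: ar_def dm_def cd_def mp_def)

lemma mk_mp: "ar f \<Longrightarrow> mk (dm f) (cd f) (mp f) = f"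
  by (auto simp: mk_def ar_def dm_def cd_def mp_def)

lemma arE: assumes "ar f" obtains X Y m where "f = mk X Y m" "m \<in> mor C X Y"
  using mk_mp[OF assms] ar_mp[OF assms] by metis

lemma cp_mk [simp]: "f \<in> mor C X Y \<Longrightarrow> g \<in> mor C Y Z \<Longrightarrow> mk Y Z g \<star> mk X Y f = mk X Z (g \<bullet> f)"
  by (auto simp: cp_def cmp_in) (simp add: mk_def cmp_in)

lemma tn_mk [simp]: "f \<in> mor C X Y \<Longrightarrow> g \<in> mor C X' Y' \<Longrightarrow>
    mk X Y f \<boxtimes> mk X' Y' g = mk (X \<otimes>\<^sub>o X') (Y \<otimes>\<^sub>o Y') (f \<otimes>\<^sub>m g)"
  by (auto simp: tn_def) (simp add: mk_def tens_in)

lemma ar_Some: "ar (Some (X, Y, m)) \<longleftrightarrow> m \<in> mor C X Y"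
  by (auto simp: ar_def)

lemma ar_cp [simp]: "ar (g \<star> f) \<longleftrightarrow> ar f \<and> ar g \<and> cd f = dm g"
  using ar_mp[of f] ar_mp[of g] cmp_in[of "mp f" "dm f" "cd f" "mp g" "cd g"]
  by (auto simp: cp_def ar_Some) (auto simp: ar_def)

lemma dm_cp [simp]: "ar f \<Longrightarrow> ar g \<Longrightarrow> cd f = dm g \<Longrightarrow> dm (g \<star> f) = dm f"
  and cd_cp [simp]: "ar f \<Longrightarrow> ar g \<Longrightarrow> cd f = dm g \<Longrightarrow> cd (g \<star> f) = cd g"
  and mp_cp: "ar f \<Longrightarrow> ar g \<Longrightarrow> cd f = dm g \<Longrightarrow> mp (g \<star> f) = mp g \<bullet> mp f"
  by (auto simp: cp_def dm_def cd_def mp_def)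

lemma ar_tn [simp]: "ar (f \<boxtimes> g) \<longleftrightarrow> ar f \<and> ar g"
  using ar_mp[of f] ar_mp[of g] tens_in
  by (auto simp: tn_def ar_Some) (auto simp: ar_def)

lemma dm_tn [simp]: "ar f \<Longrightarrow> ar g \<Longrightarrow> dm (f \<boxtimes> g) = dm f \<otimes>\<^sub>o dm g"
  and cd_tn [simp]: "ar f \<Longrightarrow> ar g \<Longrightarrow> cd (f \<boxtimes> g) = cd f \<otimes>\<^sub>o cd g"
  and mp_tn: "ar f \<Longrightarrow> ar g \<Longrightarrow> mp (f \<boxtimes> g) = mp f \<otimes>\<^sub>m mp g"
  by (auto simp: tn_def dm_def cd_def mp_def)

lemma ID_simps [simp]: "ar (ID X)" "dm (ID X) = X" "cd (ID X) = X" "mp (ID X) = idm C X"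
  by (simp_all add: ID_def idm_in)

lemma cp_None: "\<not> ar g \<or> \<not> ar f \<or> cd f \<noteq> dm g \<Longrightarrow> g \<star> f = None"
  by (auto simp: cp_def)

lemma not_ar_None [simp]: "\<not> ar None" by (simp add: ar_def)

text \<open>No typing hypotheses: if some pair of neighbours does not match, both sides are
  \<open>None\<close>. Hence it can serve as a plain rewrite rule.\<close>

lemma cp_assoc: "(h \<star> g) \<star> f = h \<star> (g \<star> f)"
proof (cases "ar f \<and> ar g \<and> ar h \<and> cd f = dm g \<and> cd g = dm h")
  case True
  then obtain X Y m Z k W l where "f = mk X Y m" "m \<in> mor C X Y" "g = mk Y Z k" "k \<in> mor C Y Z"
    "h = mk Z W l" "l \<in> mor C Z W"
    by (metis arE dm_mk cd_mk)
  then show ?thesis by (simp add: cmp_in cmp_assoc)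
next
  case False
  then show ?thesis by (subst (1 2) cp_None) auto
qed

lemma ID_cp [simp]: "ar f \<Longrightarrow> cd f = X \<Longrightarrow> ID X \<star> f = f"
  by (erule arE) (simp add: ID_def idm_in idm_cmp)

lemma cp_ID [simp]: "ar f \<Longrightarrow> dm f = X \<Longrightarrow> f \<star> ID X = f"
  by (erule arE) (simp add: ID_def idm_in cmp_idm)

lemma ID_tn_ID [simp]: "ID X \<boxtimes> ID Y = ID (X \<otimes>\<^sub>o Y)"
  by (simp add: ID_def idm_in tens_idm)

lemma interchange: "ar f \<Longrightarrow> ar g \<Longrightarrow> cd f = dm g \<Longrightarrow> ar f' \<Longrightarrow> ar g' \<Longrightarrow> cd f' = dm g' \<Longrightarrow>
    (g \<star> f) \<boxtimes> (g' \<star> f') = (g \<boxtimes> g') \<star> (f \<boxtimes> f')"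
  by (elim arE) (simp add: cmp_in tens_cmp tens_in)

lemma whl_cp [simp]: "ar f \<Longrightarrow> ar g \<Longrightarrow> cd f = dm g \<Longrightarrow> X \<triangleright> (g \<star> f) = (X \<triangleright> g) \<star> (X \<triangleright> f)"
  using interchange[of "ID X" "ID X" f g] by simp

lemma whr_cp [simp]: "ar f \<Longrightarrow> ar g \<Longrightarrow> cd f = dm g \<Longrightarrow> (g \<star> f) \<triangleleft> X = (g \<triangleleft> X) \<star> (f \<triangleleft> X)"
  using interchange[of f g "ID X" "ID X"] by simp

text \<open>Once composites are bracketed to the right, an equation for \<open>g \<star> f\<close>
  no longer matches in the middle of a longer chain. Its form with a remainder r does.\<close>

lemma tail: "g \<star> f = h \<Longrightarrow> g \<star> f \<star> r = h \<star> r" by (metis cp_assoc)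
lemma tail3: "g \<star> f \<star> e = h \<Longrightarrow> g \<star> f \<star> e \<star> r = h \<star> r" by (metis cp_assoc)

lemma mk_eqD: "f \<in> mor C X Y \<Longrightarrow> g \<in> mor C X Y \<Longrightarrow> mk X Y f = mk X Y g \<Longrightarrow> f = g"
  by (simp add: mk_def)

lemma tn_split1: "ar f \<Longrightarrow> ar g \<Longrightarrow> f \<boxtimes> g = (f \<triangleleft> cd g) \<star> (dm f \<triangleright> g)"
  using interchange[of "ID (dm f)" f g "ID (cd g)"] by simp
lemma tn_split2: "ar f \<Longrightarrow> ar g \<Longrightarrow> f \<boxtimes> g = (cd f \<triangleright> g) \<star> (f \<triangleleft> dm g)"
  using interchange[of f "ID (cd f)" "ID (dm g)" g] by simp

lemma exch: "ar f \<Longrightarrow> ar g \<Longrightarrow> dm f = X \<Longrightarrow> cd f = X' \<Longrightarrow> dm g = Y \<Longrightarrow> cd g = Y' \<Longrightarrow>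
   (f \<triangleleft> Y') \<star> (X \<triangleright> g) = (X' \<triangleright> g) \<star> (f \<triangleleft> Y)"
  using tn_split1 tn_split2 by metis

definition AS where "AS X Y Z = mk ((X \<otimes>\<^sub>o Y) \<otimes>\<^sub>o Z) (X \<otimes>\<^sub>o (Y \<otimes>\<^sub>o Z)) (associator C X Y Z)"
definition AI where "AI X Y Z = mk (X \<otimes>\<^sub>o (Y \<otimes>\<^sub>o Z)) ((X \<otimes>\<^sub>o Y) \<otimes>\<^sub>o Z)
  (inverse_of C ((X \<otimes>\<^sub>o Y) \<otimes>\<^sub>o Z) (X \<otimes>\<^sub>o (Y \<otimes>\<^sub>o Z)) (associator C X Y Z))"
definition LU where "LU X = mk (\<I> \<otimes>\<^sub>o X) X (lunitor C X)"
definition LI where "LI X = mk X (\<I> \<otimes>\<^sub>o X) (inverse_of C (\<I> \<otimes>\<^sub>o X) X (lunitor C X))"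
definition RU where "RU X = mk (X \<otimes>\<^sub>o \<I>) X (runitor C X)"
definition RI where "RI X = mk X (X \<otimes>\<^sub>o \<I>) (inverse_of C (X \<otimes>\<^sub>o \<I>) X (runitor C X))"
definition BR where "BR X Y = mk (X \<otimes>\<^sub>o Y) (Y \<otimes>\<^sub>o X) (braiding C X Y)"

lemma inverse_of: assumes "is_iso C X Y f" shows "is_inverse C X Y f (inverse_of C X Y f)"
proof -
  obtain g where g: "is_inverse C X Y f g" using assms by (auto simp: is_iso_def)
  have "h = g" if "is_inverse C X Y f h" for h
    using g that unfolding is_inverse_def by (metis cmp_assoc cmp_idm idm_cmp)
  then show ?thesis unfolding inverse_of_def using g by (metis theI)
qed

lemma inverse_arrow:
  assumes "is_iso C X Y f"
  shows "f \<in> mor C X Y" "inverse_of C X Y f \<in> mor C Y X"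
    "mk X Y f \<star> mk Y X (inverse_of C X Y f) = ID Y" "mk Y X (inverse_of C X Y f) \<star> mk X Y f = ID X"
  using inverse_of[OF assms] by (auto simp: is_inverse_def ID_def)

lemma AS_simps [simp]: "ar (AS X Y Z)" "dm (AS X Y Z) = (X \<otimes>\<^sub>o Y) \<otimes>\<^sub>o Z" "cd (AS X Y Z) = X \<otimes>\<^sub>o (Y \<otimes>\<^sub>o Z)"
  and AI_simps [simp]: "ar (AI X Y Z)" "cd (AI X Y Z) = (X \<otimes>\<^sub>o Y) \<otimes>\<^sub>o Z" "dm (AI X Y Z) = X \<otimes>\<^sub>o (Y \<otimes>\<^sub>o Z)"
  and AS_AI [simp]: "AS X Y Z \<star> AI X Y Z = ID (X \<otimes>\<^sub>o (Y \<otimes>\<^sub>o Z))"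
  and AI_AS [simp]: "AI X Y Z \<star> AS X Y Z = ID ((X \<otimes>\<^sub>o Y) \<otimes>\<^sub>o Z)"
  using inverse_arrow[OF associator_iso] by (simp_all add: AS_def AI_def)

lemma LU_simps [simp]: "ar (LU X)" "dm (LU X) = \<I> \<otimes>\<^sub>o X" "cd (LU X) = X"
  and LI_simps [simp]: "ar (LI X)" "cd (LI X) = \<I> \<otimes>\<^sub>o X" "dm (LI X) = X"
  and LU_LI [simp]: "LU X \<star> LI X = ID X"
  and LI_LU [simp]: "LI X \<star> LU X = ID (\<I> \<otimes>\<^sub>o X)"
  using inverse_arrow[OF lunitor_iso] by (simp_all add: LU_def LI_def)

lemma RU_simps [simp]: "ar (RU X)" "dm (RU X) = X \<otimes>\<^sub>o \<I>" "cd (RU X) = X"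
  and RI_simps [simp]: "ar (RI X)" "cd (RI X) = X \<otimes>\<^sub>o \<I>" "dm (RI X) = X"
  and RU_RI [simp]: "RU X \<star> RI X = ID X"
  and RI_RU [simp]: "RI X \<star> RU X = ID (X \<otimes>\<^sub>o \<I>)"
  using inverse_arrow[OF runitor_iso] by (simp_all add: RU_def RI_def)

lemma BR_simps [simp]: "ar (BR X Y)" "dm (BR X Y) = X \<otimes>\<^sub>o Y" "cd (BR X Y) = Y \<otimes>\<^sub>o X"
  and BR_BR [simp]: "BR Y X \<star> BR X Y = ID (X \<otimes>\<^sub>o Y)"
  using braiding_in by (simp_all add: BR_def ID_def symmetry)

lemma AS_nat: "ar f \<Longrightarrow> ar g \<Longrightarrow> ar h \<Longrightarrow> cd f = X' \<Longrightarrow> cd g = Y' \<Longrightarrow> cd h = Z' \<Longrightarrow>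
   AS X' Y' Z' \<star> ((f \<boxtimes> g) \<boxtimes> h) = (f \<boxtimes> (g \<boxtimes> h)) \<star> AS (dm f) (dm g) (dm h)"
  using inverse_arrow(1)[OF associator_iso]
  by (elim arE) (simp add: AS_def tens_in associator_natural)

lemma AI_nat: assumes "ar f" "ar g" "ar h" "cd f = X'" "cd g = Y'" "cd h = Z'"
  shows "AI X' Y' Z' \<star> (f \<boxtimes> (g \<boxtimes> h)) = ((f \<boxtimes> g) \<boxtimes> h) \<star> AI (dm f) (dm g) (dm h)"
proof -
  have "AI X' Y' Z' \<star> (f \<boxtimes> (g \<boxtimes> h)) = AI X' Y' Z' \<star> ((f \<boxtimes> (g \<boxtimes> h)) \<star> AS (dm f) (dm g) (dm h)) \<star> AI (dm f) (dm g) (dm h)"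
    using assms by (simp add: cp_assoc)
  also have "\<dots> = AI X' Y' Z' \<star> (AS X' Y' Z' \<star> ((f \<boxtimes> g) \<boxtimes> h)) \<star> AI (dm f) (dm g) (dm h)"
    using assms by (simp add: AS_nat)
  also have "\<dots> = ((f \<boxtimes> g) \<boxtimes> h) \<star> AI (dm f) (dm g) (dm h)"
    using assms by (simp add: cp_assoc tail[OF AI_AS])
  finally show ?thesis .
qed

lemma LU_nat: "ar f \<Longrightarrow> cd f = Y \<Longrightarrow> LU Y \<star> (\<I> \<triangleright> f) = f \<star> LU (dm f)"
  using inverse_arrow(1)[OF lunitor_iso]
  by (elim arE) (simp add: LU_def ID_def idm_in tens_in lunitor_natural)

lemma RU_nat: "ar f \<Longrightarrow> cd f = Y \<Longrightarrow> RU Y \<star> (f \<triangleleft> \<I>) = f \<star> RU (dm f)"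
  using inverse_arrow(1)[OF runitor_iso]
  by (elim arE) (simp add: RU_def ID_def idm_in tens_in runitor_natural)

lemma BR_nat: "ar f \<Longrightarrow> ar g \<Longrightarrow> cd f = X' \<Longrightarrow> cd g = Y' \<Longrightarrow>
   BR X' Y' \<star> (f \<boxtimes> g) = (g \<boxtimes> f) \<star> BR (dm f) (dm g)"
  by (elim arE) (simp add: BR_def braiding_in tens_in braiding_natural)

lemma pentagon_arrow:
  "AS W X (Y \<otimes>\<^sub>o Z) \<star> AS (W \<otimes>\<^sub>o X) Y Z = (W \<triangleright> AS X Y Z) \<star> AS W (X \<otimes>\<^sub>o Y) Z \<star> (AS W X Y \<triangleleft> Z)"
  using inverse_arrow(1)[OF associator_iso]
  by (simp add: AS_def ID_def idm_in tens_in cmp_in pentagon)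
     (subst cp_mk, (blast intro: tens_in idm_in cmp_in)+)+

lemma triangle_arrow: "(X \<triangleright> LU Y) \<star> AS X \<I> Y = RU X \<triangleleft> Y"
  using inverse_arrow(1)[OF associator_iso] inverse_arrow(1)[OF lunitor_iso] inverse_arrow(1)[OF runitor_iso]
  by (simp add: AS_def LU_def RU_def ID_def idm_in tens_in cmp_in triangle)

lemma hexagon_arrow:
  "AS Y Z X \<star> BR X (Y \<otimes>\<^sub>o Z) \<star> AS X Y Z = (Y \<triangleright> BR X Z) \<star> AS Y X Z \<star> (BR X Y \<triangleleft> Z)"
proof -
  note [simp] = inverse_arrow(1)[OF associator_iso] braiding_in idm_in
  note [simp] = cmp_in[OF inverse_arrow(1)[OF associator_iso, of X Y Z] braiding_in]
    cmp_in[OF tens_in[OF braiding_in[of X Y] idm_in[of Z]] inverse_arrow(1)[OF associator_iso]]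
  show ?thesis
    by (simp add: AS_def BR_def ID_def tens_in hexagon)
qed


text \<open>Exchange of the two front factors of a right-bracketed product with rest W;
  \<open>swap_mor C X n 0\<close> is the case X = Y with W the remaining tensor power. It hides the
  associators, so that naturality, the hexagon and the braid relation can be used with hardly any of
  them.\<close>

definition SW where "SW X Y W = AS Y X W \<star> (BR X Y \<triangleleft> W) \<star> AI X Y W"

lemma SW_simps [simp]: "ar (SW X Y W)" "dm (SW X Y W) = X \<otimes>\<^sub>o (Y \<otimes>\<^sub>o W)" "cd (SW X Y W) = Y \<otimes>\<^sub>o (X \<otimes>\<^sub>o W)"
  by (simp_all add: SW_def)

lemma BR_nat_whr: "ar f \<Longrightarrow> ar g \<Longrightarrow> ar h \<Longrightarrow> cd f = X' \<Longrightarrow> cd g = Y' \<Longrightarrow> cd h = Z' \<Longrightarrow>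
   (BR X' Y' \<triangleleft> Z') \<star> ((f \<boxtimes> g) \<boxtimes> h) = ((g \<boxtimes> f) \<boxtimes> h) \<star> (BR (dm f) (dm g) \<triangleleft> dm h)"
  using interchange[of "f \<boxtimes> g" "BR X' Y'" h "ID Z'"] interchange[of "BR (dm f) (dm g)" "g \<boxtimes> f" "ID (dm h)" h]
  by (simp add: BR_nat)

lemma SW_nat: "ar f \<Longrightarrow> ar g \<Longrightarrow> ar h \<Longrightarrow> cd f = X' \<Longrightarrow> cd g = Y' \<Longrightarrow> cd h = Z' \<Longrightarrow>
   SW X' Y' Z' \<star> (f \<boxtimes> (g \<boxtimes> h)) = (g \<boxtimes> (f \<boxtimes> h)) \<star> SW (dm f) (dm g) (dm h)"
  by (simp add: SW_def cp_assoc AI_nat BR_nat_whr tail[OF BR_nat_whr] AS_nat tail[OF AS_nat])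

lemma BR_BR_whr: "(BR Y X \<triangleleft> W) \<star> (BR X Y \<triangleleft> W) = ID ((X \<otimes>\<^sub>o Y) \<otimes>\<^sub>o W)"
  using whr_cp[of "BR X Y" "BR Y X" W] by simp

lemma SW_SW [simp]: "SW Y X W \<star> SW X Y W = ID (X \<otimes>\<^sub>o (Y \<otimes>\<^sub>o W))"
  by (simp add: SW_def cp_assoc tail[OF AI_AS] tail[OF BR_BR_whr])

lemma AS_AI_whl: "(W \<triangleright> AS X Y Z) \<star> (W \<triangleright> AI X Y Z) = ID (W \<otimes>\<^sub>o (X \<otimes>\<^sub>o (Y \<otimes>\<^sub>o Z)))"
  and AI_AS_whl: "(W \<triangleright> AI X Y Z) \<star> (W \<triangleright> AS X Y Z) = ID (W \<otimes>\<^sub>o ((X \<otimes>\<^sub>o Y) \<otimes>\<^sub>o Z))"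
  and AS_AI_whr: "(AS X Y Z \<triangleleft> W) \<star> (AI X Y Z \<triangleleft> W) = ID ((X \<otimes>\<^sub>o (Y \<otimes>\<^sub>o Z)) \<otimes>\<^sub>o W)"
  and AI_AS_whr: "(AI X Y Z \<triangleleft> W) \<star> (AS X Y Z \<triangleleft> W) = ID (((X \<otimes>\<^sub>o Y) \<otimes>\<^sub>o Z) \<otimes>\<^sub>o W)"
  by (simp_all flip: whl_cp whr_cp)

text \<open>This and the next two are the pentagon, solved for the patterns of associators that
  occur in \<open>SW_hexagon\<close>.\<close>

lemma pentagon2: "AI X Y (Z \<otimes>\<^sub>o W) \<star> (X \<triangleright> AS Y Z W) = AS (X \<otimes>\<^sub>o Y) Z W \<star> (AI X Y Z \<triangleleft> W) \<star> AI X (Y \<otimes>\<^sub>o Z) W"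
proof -
  have "AI X Y (Z \<otimes>\<^sub>o W) \<star> (X \<triangleright> AS Y Z W) =
    AI X Y (Z \<otimes>\<^sub>o W) \<star> ((X \<triangleright> AS Y Z W) \<star> AS X (Y \<otimes>\<^sub>o Z) W \<star> (AS X Y Z \<triangleleft> W)) \<star> (AI X Y Z \<triangleleft> W) \<star> AI X (Y \<otimes>\<^sub>o Z) W"
    by (simp add: cp_assoc tail[OF AS_AI_whr])
  then show ?thesis by (simp flip: pentagon_arrow add: cp_assoc tail[OF AI_AS])
qed

lemma pentagon3: "(X \<triangleright> AI Y Z W) \<star> AS X Y (Z \<otimes>\<^sub>o W) \<star> AS (X \<otimes>\<^sub>o Y) Z W = AS X (Y \<otimes>\<^sub>o Z) W \<star> (AS X Y Z \<triangleleft> W)"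
  by (simp add: pentagon_arrow tail[OF AI_AS_whl])

lemma pentagon4: "(X \<triangleright> AS Y Z W) \<star> AS X (Y \<otimes>\<^sub>o Z) W = AS X Y (Z \<otimes>\<^sub>o W) \<star> AS (X \<otimes>\<^sub>o Y) Z W \<star> (AI X Y Z \<triangleleft> W)"
proof -
  have "(X \<triangleright> AS Y Z W) \<star> AS X (Y \<otimes>\<^sub>o Z) W = ((X \<triangleright> AS Y Z W) \<star> AS X (Y \<otimes>\<^sub>o Z) W \<star> (AS X Y Z \<triangleleft> W)) \<star> (AI X Y Z \<triangleleft> W)"
    by (simp add: cp_assoc AS_AI_whr)
  then show ?thesis by (simp flip: pentagon_arrow add: cp_assoc)
qed

lemma hexagon2: "AI Y Z X \<star> (Y \<triangleright> BR X Z) \<star> AS Y X Z \<star> (BR X Y \<triangleleft> Z) \<star> AI X Y Z = BR X (Y \<otimes>\<^sub>o Z)"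
proof -
  have "AI Y Z X \<star> (AS Y Z X \<star> BR X (Y \<otimes>\<^sub>o Z) \<star> AS X Y Z) \<star> AI X Y Z = BR X (Y \<otimes>\<^sub>o Z)"
    by (simp add: cp_assoc tail[OF AI_AS])
  then show ?thesis by (simp add: cp_assoc hexagon_arrow)
qed

lemma hexagon2_whr: "(AI Y Z X \<triangleleft> W) \<star> ((Y \<triangleright> BR X Z) \<triangleleft> W) \<star> (AS Y X Z \<triangleleft> W) \<star> ((BR X Y \<triangleleft> Z) \<triangleleft> W) \<star> (AI X Y Z \<triangleleft> W)
   = BR X (Y \<otimes>\<^sub>o Z) \<triangleleft> W"
  by (simp flip: hexagon2)

text \<open>Moving X past Y and then past Z is moving it past the block Y \<otimes> Z: the hexagon
  tensored with W. Pentagons and naturality push the associators aside until the braidings stand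
  together in the form of \<open>hexagon2_whr\<close>.\<close>

lemma SW_hexagon:
  "(Y \<triangleright> SW X Z W) \<star> SW X Y (Z \<otimes>\<^sub>o W) \<star> (X \<triangleright> AS Y Z W) = AS Y Z (X \<otimes>\<^sub>o W) \<star> SW X (Y \<otimes>\<^sub>o Z) W"
proof -
  have "(Y \<triangleright> SW X Z W) \<star> SW X Y (Z \<otimes>\<^sub>o W) \<star> (X \<triangleright> AS Y Z W) =
    (Y \<triangleright> AS Z X W) \<star> (Y \<triangleright> (BR X Z \<triangleleft> W)) \<star> (Y \<triangleright> AI X Z W) \<star> AS Y X (Z \<otimes>\<^sub>o W) \<star> (BR X Y \<triangleleft> (Z \<otimes>\<^sub>o W))
      \<star> AI X Y (Z \<otimes>\<^sub>o W) \<star> (X \<triangleright> AS Y Z W)"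
    by (simp add: SW_def cp_assoc)
  also have "\<dots> = (Y \<triangleright> AS Z X W) \<star> (Y \<triangleright> (BR X Z \<triangleleft> W)) \<star> (Y \<triangleright> AI X Z W) \<star> AS Y X (Z \<otimes>\<^sub>o W) 
      \<star> ((BR X Y \<triangleleft> (Z \<otimes>\<^sub>o W)) \<star> AS (X \<otimes>\<^sub>o Y) Z W) \<star> (AI X Y Z \<triangleleft> W) \<star> AI X (Y \<otimes>\<^sub>o Z) W"
    by (simp add: pentagon2 cp_assoc)
  also have "(BR X Y \<triangleleft> (Z \<otimes>\<^sub>o W)) \<star> AS (X \<otimes>\<^sub>o Y) Z W = AS (Y \<otimes>\<^sub>o X) Z W \<star> ((BR X Y \<triangleleft> Z) \<triangleleft> W)"
    using AS_nat[of "BR X Y" "ID Z" "ID W"] by simp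
  also have "(Y \<triangleright> AS Z X W) \<star> (Y \<triangleright> (BR X Z \<triangleleft> W)) \<star> (Y \<triangleright> AI X Z W) \<star> AS Y X (Z \<otimes>\<^sub>o W) 
      \<star> (AS (Y \<otimes>\<^sub>o X) Z W \<star> ((BR X Y \<triangleleft> Z) \<triangleleft> W)) \<star> (AI X Y Z \<triangleleft> W) \<star> AI X (Y \<otimes>\<^sub>o Z) W
    = (Y \<triangleright> AS Z X W) \<star> ((Y \<triangleright> (BR X Z \<triangleleft> W)) \<star> AS Y (X \<otimes>\<^sub>o Z) W) \<star> (AS Y X Z \<triangleleft> W)
      \<star> ((BR X Y \<triangleleft> Z) \<triangleleft> W) \<star> (AI X Y Z \<triangleleft> W) \<star> AI X (Y \<otimes>\<^sub>o Z) W"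
    by (simp add: cp_assoc tail3[OF pentagon3])
  also have "(Y \<triangleright> (BR X Z \<triangleleft> W)) \<star> AS Y (X \<otimes>\<^sub>o Z) W = AS Y (Z \<otimes>\<^sub>o X) W \<star> ((Y \<triangleright> BR X Z) \<triangleleft> W)"
    using AS_nat[of "ID Y" "BR X Z" "ID W"] by simp
  also have "(Y \<triangleright> AS Z X W) \<star> (AS Y (Z \<otimes>\<^sub>o X) W \<star> ((Y \<triangleright> BR X Z) \<triangleleft> W)) \<star> (AS Y X Z \<triangleleft> W)
      \<star> ((BR X Y \<triangleleft> Z) \<triangleleft> W) \<star> (AI X Y Z \<triangleleft> W) \<star> AI X (Y \<otimes>\<^sub>o Z) W
    = AS Y Z (X \<otimes>\<^sub>o W) \<star> AS (Y \<otimes>\<^sub>o Z) X W \<star> (BR X (Y \<otimes>\<^sub>o Z) \<triangleleft> W) \<star> AI X (Y \<otimes>\<^sub>o Z) W"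
    by (simp add: cp_assoc tail[OF pentagon4] flip: hexagon2_whr del: whr_cp whl_cp)
  finally show ?thesis by (simp add: SW_def)
qed

lemma SW_hexagon': 
  "(Y \<triangleright> SW X Z W) \<star> SW X Y (Z \<otimes>\<^sub>o W) = AS Y Z (X \<otimes>\<^sub>o W) \<star> SW X (Y \<otimes>\<^sub>o Z) W \<star> (X \<triangleright> AI Y Z W)"
  using arg_cong[OF SW_hexagon[of Y X Z W], of "\<lambda>u. u \<star> (X \<triangleright> AI Y Z W)"]
  by (simp add: cp_assoc AS_AI_whl)

lemma SW_BR: "(BR Y Z \<triangleleft> (X \<otimes>\<^sub>o W)) \<star> SW X (Y \<otimes>\<^sub>o Z) W = SW X (Z \<otimes>\<^sub>o Y) W \<star> (X \<triangleright> (BR Y Z \<triangleleft> W))"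
  using SW_nat[of "ID X" "BR Y Z" "ID W" X "Z \<otimes>\<^sub>o Y" W] by simp

text \<open>By the hexagon, X passes Y \<otimes> Z as one block, and exchanging Y and Z inside the
  block commutes with this by naturality (\<open>SW_BR\<close>). It becomes the braid relation
  between adjacent transpositions.\<close>

lemma SW_yang_baxter:
  "SW Y Z (X \<otimes>\<^sub>o W) \<star> (Y \<triangleright> SW X Z W) \<star> SW X Y (Z \<otimes>\<^sub>o W)
   = (Z \<triangleright> SW X Y W) \<star> SW X Z (Y \<otimes>\<^sub>o W) \<star> (X \<triangleright> SW Y Z W)"
proof -
  have "SW Y Z (X \<otimes>\<^sub>o W) \<star> (Y \<triangleright> SW X Z W) \<star> SW X Y (Z \<otimes>\<^sub>o W)
   = AS Z Y (X \<otimes>\<^sub>o W) \<star> ((BR Y Z \<triangleleft> (X \<otimes>\<^sub>o W)) \<star> SW X (Y \<otimes>\<^sub>o Z) W) \<star> (X \<triangleright> AI Y Z W)"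
    by (simp add: SW_hexagon' SW_def[of Y Z "X \<otimes>\<^sub>o W"] cp_assoc tail[OF AI_AS])
  also have "\<dots> = AS Z Y (X \<otimes>\<^sub>o W) \<star> SW X (Z \<otimes>\<^sub>o Y) W \<star> (X \<triangleright> AI Z Y W) \<star> (X \<triangleright> SW Y Z W)"
    by (simp only: SW_BR) (simp add: SW_def[of Y Z W] cp_assoc tail[OF AI_AS_whl])
  also have "\<dots> = (Z \<triangleright> SW X Y W) \<star> SW X Z (Y \<otimes>\<^sub>o W) \<star> (X \<triangleright> SW Y Z W)"
    using arg_cong[OF SW_hexagon'[of Z X Y W], of "\<lambda>u. u \<star> (X \<triangleright> SW Y Z W)"] by (simp add: cp_assoc)
  finally show ?thesis .
qed

text \<open>Tensoring with \<I> is faithful because the unit constraint is a natural isomorphism.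
  The unit coherence laws below are proved after such a tensoring.\<close>

lemma LU_cancel: assumes "ar f" "ar g" "dm f = dm g" "cd f = cd g" "\<I> \<triangleright> f = \<I> \<triangleright> g" shows "f = g"
proof -
  have "f = f \<star> (LU (dm f) \<star> LI (dm f))" using assms(1-4) by simp
  also have "\<dots> = (LU (cd f) \<star> (\<I> \<triangleright> f)) \<star> LI (dm f)" using assms(1-4) by (simp add: LU_nat cp_assoc del: LU_LI RU_RI)
  also have "\<dots> = (LU (cd g) \<star> (\<I> \<triangleright> g)) \<star> LI (dm g)" using assms by simp
  also have "\<dots> = g \<star> (LU (dm g) \<star> LI (dm g))" using assms(1-4) by (simp add: LU_nat cp_assoc del: LU_LI RU_RI)
  also have "\<dots> = g" using assms(1-4) by simp
  finally show ?thesis .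
qed

lemma RU_cancel: assumes "ar f" "ar g" "dm f = dm g" "cd f = cd g" "f \<triangleleft> \<I> = g \<triangleleft> \<I>" shows "f = g"
proof -
  have "f = f \<star> (RU (dm f) \<star> RI (dm f))" using assms(1-4) by simp
  also have "\<dots> = (RU (cd f) \<star> (f \<triangleleft> \<I>)) \<star> RI (dm f)" using assms(1-4) by (simp add: RU_nat cp_assoc del: LU_LI RU_RI)
  also have "\<dots> = (RU (cd g) \<star> (g \<triangleleft> \<I>)) \<star> RI (dm g)" using assms by simp
  also have "\<dots> = g \<star> (RU (dm g) \<star> RI (dm g))" using assms(1-4) by (simp add: RU_nat cp_assoc del: LU_LI RU_RI)
  also have "\<dots> = g" using assms(1-4) by simp
  finally show ?thesis .
qed

lemma right_cancel: assumes "f \<star> e = g \<star> e" "e \<star> e' = ID X" "ar f" "ar g" "dm f = X" "dm g = X" shows "f = g"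
  by (metis assms cp_assoc cp_ID)

text \<open>Compatibility of the braiding with the unit is a consequence of hexagon and triangle.
  Both sides agree after tensoring with \<I> and composing with an isomorphism, and these are
  removed by \<open>LU_cancel\<close> and \<open>right_cancel\<close>.\<close>

lemma LU_SW: "LU (A \<otimes>\<^sub>o W) \<star> SW A \<I> W = A \<triangleright> LU W"
proof -
  have tri: "(\<I> \<triangleright> LU V) \<star> AS \<I> \<I> V = RU \<I> \<triangleleft> V" for V by (rule triangle_arrow)
  have n: "(RU \<I> \<triangleleft> (A \<otimes>\<^sub>o W)) \<star> SW A (\<I> \<otimes>\<^sub>o \<I>) W = SW A \<I> W \<star> (A \<triangleright> (RU \<I> \<triangleleft> W))"
    using SW_nat[of "ID A" "RU \<I>" "ID W" A \<I> W] by simp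
  have n': "(\<I> \<triangleright> (A \<triangleright> LU W)) \<star> SW A \<I> (\<I> \<otimes>\<^sub>o W) = SW A \<I> W \<star> (A \<triangleright> (\<I> \<triangleright> LU W))"
    using SW_nat[of "ID A" "ID \<I>" "LU W" A \<I> W] by simp
  have "(\<I> \<triangleright> (LU (A \<otimes>\<^sub>o W) \<star> SW A \<I> W)) \<star> SW A \<I> (\<I> \<otimes>\<^sub>o W) \<star> (A \<triangleright> AS \<I> \<I> W)
    = (RU \<I> \<triangleleft> (A \<otimes>\<^sub>o W)) \<star> SW A (\<I> \<otimes>\<^sub>o \<I>) W"
    by (simp add: cp_assoc SW_hexagon tail[OF tri])
  also have "\<dots> = SW A \<I> W \<star> (A \<triangleright> (\<I> \<triangleright> LU W)) \<star> (A \<triangleright> AS \<I> \<I> W)"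
    by (simp only: n) (simp add: cp_assoc flip: tri)
  also have "\<dots> = (\<I> \<triangleright> (A \<triangleright> LU W)) \<star> SW A \<I> (\<I> \<otimes>\<^sub>o W) \<star> (A \<triangleright> AS \<I> \<I> W)"
    by (simp add: tail[OF n'] cp_assoc)
  finally have "\<I> \<triangleright> (LU (A \<otimes>\<^sub>o W) \<star> SW A \<I> W) = \<I> \<triangleright> (A \<triangleright> LU W)"
    by (rule right_cancel[where e' = "(A \<triangleright> AI \<I> \<I> W) \<star> SW \<I> A (\<I> \<otimes>\<^sub>o W)"])
       (simp_all add: cp_assoc tail[OF AS_AI_whl])
  then show ?thesis by (rule LU_cancel[rotated -1]) simp_all
qed

text \<open>Kelly's argument: after tensoring with \<I>, the triangle expresses both sides through
  \<open>RU \<I>\<close>, which naturality carries across the associator.\<close>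

lemma LU_kelly: "LU (X \<otimes>\<^sub>o W) \<star> AS \<I> X W = LU X \<triangleleft> W"
proof -
  have tri: "(\<I> \<triangleright> LU V) \<star> AS \<I> \<I> V = RU \<I> \<triangleleft> V" for V by (rule triangle_arrow)
  have "(\<I> \<triangleright> (LU (X \<otimes>\<^sub>o W) \<star> AS \<I> X W)) \<star> AS \<I> (\<I> \<otimes>\<^sub>o X) W \<star> (AS \<I> \<I> X \<triangleleft> W)
     = (RU \<I> \<triangleleft> (X \<otimes>\<^sub>o W)) \<star> AS (\<I> \<otimes>\<^sub>o \<I>) X W"
    by (simp add: cp_assoc flip: pentagon_arrow) (simp add: tail[OF tri])
  also have "\<dots> = AS \<I> X W \<star> ((RU \<I> \<triangleleft> X) \<triangleleft> W)"
    using AS_nat[of "RU \<I>" "ID X" "ID W"] by simp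
  also have "\<dots> = (\<I> \<triangleright> (LU X \<triangleleft> W)) \<star> AS \<I> (\<I> \<otimes>\<^sub>o X) W \<star> (AS \<I> \<I> X \<triangleleft> W)"
    using AS_nat[of "ID \<I>" "LU X" "ID W"] by (simp flip: tri add: tail)
  finally have "\<I> \<triangleright> (LU (X \<otimes>\<^sub>o W) \<star> AS \<I> X W) = \<I> \<triangleright> (LU X \<triangleleft> W)"
    by (rule right_cancel[where e' = "(AI \<I> \<I> X \<triangleleft> W) \<star> AI \<I> (\<I> \<otimes>\<^sub>o X) W"])
       (simp_all add: cp_assoc tail[OF AS_AI_whr])
  then show ?thesis by (rule LU_cancel[rotated -1]) simp_all
qed

lemma RU_kelly: "RU (X \<otimes>\<^sub>o Y) = (X \<triangleright> RU Y) \<star> AS X Y \<I>"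
proof (rule RU_cancel)
  have t: "(X \<triangleright> LU Y) \<star> AS X \<I> Y = RU X \<triangleleft> Y" for X Y by (rule triangle_arrow)
  have "AS X Y \<I> \<star> (RU (X \<otimes>\<^sub>o Y) \<triangleleft> \<I>) = (AS X Y \<I> \<star> ((X \<otimes>\<^sub>o Y) \<triangleright> LU \<I>)) \<star> AS (X \<otimes>\<^sub>o Y) \<I> \<I>"
    by (simp flip: t add: cp_assoc)
  also have "\<dots> = (X \<triangleright> (Y \<triangleright> LU \<I>)) \<star> AS X Y (\<I> \<otimes>\<^sub>o \<I>) \<star> AS (X \<otimes>\<^sub>o Y) \<I> \<I>"
    using AS_nat[of "ID X" "ID Y" "LU \<I>"] by (simp add: cp_assoc)
  also have "\<dots> = (X \<triangleright> (RU Y \<triangleleft> \<I>)) \<star> AS X (Y \<otimes>\<^sub>o \<I>) \<I> \<star> (AS X Y \<I> \<triangleleft> \<I>)"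
    by (simp add: pentagon_arrow cp_assoc flip: t)
  also have "\<dots> = AS X Y \<I> \<star> (((X \<triangleright> RU Y) \<star> AS X Y \<I>) \<triangleleft> \<I>)"
    using AS_nat[of "ID X" "RU Y" "ID \<I>"] by (simp add: tail[OF AS_nat] cp_assoc)
  finally have *: "AS X Y \<I> \<star> (RU (X \<otimes>\<^sub>o Y) \<triangleleft> \<I>) = AS X Y \<I> \<star> (((X \<triangleright> RU Y) \<star> AS X Y \<I>) \<triangleleft> \<I>)" .
  show "RU (X \<otimes>\<^sub>o Y) \<triangleleft> \<I> = ((X \<triangleright> RU Y) \<star> AS X Y \<I>) \<triangleleft> \<I>"
    using arg_cong[OF *, of "\<lambda>u. AI X Y \<I> \<star> u"] by (simp add: tail[OF AI_AS])
qed simp_all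

text \<open>Naturality of \<open>LU\<close> at \<open>LU \<I>\<close> itself gives \<open>LU (\<I>
  \<otimes>\<^sub>o \<I>) = \<I> \<triangleright> LU \<I>\<close>. With this,
  \<open>LU_kelly\<close> and the triangle have the same left side.\<close>

lemma LU_I: "LU \<I> = RU \<I>"
proof (rule RU_cancel)
  have "LU (\<I> \<otimes>\<^sub>o \<I>) = \<I> \<triangleright> LU \<I>"
  proof -
    have "LU \<I> \<star> (\<I> \<triangleright> LU \<I>) = LU \<I> \<star> LU (\<I> \<otimes>\<^sub>o \<I>)" by (simp add: LU_nat)
    then show ?thesis using arg_cong[of _ _ "\<lambda>u. LI \<I> \<star> u"] 
      by (metis (no_types, lifting) LI_LU cd_tn ID_simps LU_simps ID_cp ar_tn cp_assoc)
  qed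
  then show "LU \<I> \<triangleleft> \<I> = RU \<I> \<triangleleft> \<I>"
    by (simp flip: LU_kelly triangle_arrow)
qed simp_all


section \<open>Partial traces\<close>

text \<open>
  Coherence-free form of a dual \<open>D\<close> of \<open>X\<close>: \<open>ev W\<close> is the evaluation tensored with \<open>W\<close>, and \<open>et W\<close> is the
  coevaluation followed by the braiding, tensored with \<open>W\<close>. The last condition is the zigzag identity in the shape of
  a partial trace of the symmetry.
\<close>

definition trace_structure where
  "trace_structure X D ev et \<longleftrightarrow>
     (\<forall>W. ar (ev W) \<and> dm (ev W) = D \<otimes>\<^sub>o (X \<otimes>\<^sub>o W) \<and> cd (ev W) = W) \<and>
     (\<forall>W. ar (et W) \<and> dm (et W) = W \<and> cd (et W) = D \<otimes>\<^sub>o (X \<otimes>\<^sub>o W)) \<and>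
     (\<forall>h. ar h \<longrightarrow> ev (cd h) \<star> (D \<triangleright> (X \<triangleright> h)) = h \<star> ev (dm h)) \<and>
     (\<forall>h. ar h \<longrightarrow> (D \<triangleright> (X \<triangleright> h)) \<star> et (dm h) = et (cd h) \<star> h) \<and>
     (\<forall>A W. ev (A \<otimes>\<^sub>o W) \<star> (D \<triangleright> SW A X W) \<star> SW A D (X \<otimes>\<^sub>o W) = A \<triangleright> ev W) \<and>
     (\<forall>A W. (D \<triangleright> SW A X W) \<star> SW A D (X \<otimes>\<^sub>o W) \<star> (A \<triangleright> et W) = et (A \<otimes>\<^sub>o W)) \<and>
     (\<forall>W. ev (X \<otimes>\<^sub>o W) \<star> (D \<triangleright> SW X X W) \<star> et (X \<otimes>\<^sub>o W) = ID (X \<otimes>\<^sub>o W))"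

text \<open>The symmetry that a trace needs between coevaluation and evaluation is already part of
  \<open>et\<close>, hence no braiding occurs here.\<close>

definition partial_trace where "partial_trace D ev et W W' \<phi> = ev W' \<star> (D \<triangleright> \<phi>) \<star> et W"

lemma SW_SW_whl [simp]: "(D \<triangleright> SW Y X W) \<star> (D \<triangleright> SW X Y W) = ID (D \<otimes>\<^sub>o (X \<otimes>\<^sub>o (Y \<otimes>\<^sub>o W)))"
  by (simp flip: whl_cp)

text \<open>The second hexagon. It is the inverse of the first, because in a symmetric category the
  inverse of an exchange is again an exchange.\<close>

lemma SW_hexagon_left:
  "SW (Y \<otimes>\<^sub>o Z) X W \<star> AI Y Z (X \<otimes>\<^sub>o W) = (X \<triangleright> AI Y Z W) \<star> SW Y X (Z \<otimes>\<^sub>o W) \<star> (Y \<triangleright> SW Z X W)"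
proof -
  have "SW (Y \<otimes>\<^sub>o Z) X W \<star> AI Y Z (X \<otimes>\<^sub>o W) = SW (Y \<otimes>\<^sub>o Z) X W \<star> AI Y Z (X \<otimes>\<^sub>o W)
      \<star> ((Y \<triangleright> SW X Z W) \<star> SW X Y (Z \<otimes>\<^sub>o W)) \<star> SW Y X (Z \<otimes>\<^sub>o W) \<star> (Y \<triangleright> SW Z X W)"
    by (simp add: cp_assoc tail[OF SW_SW])
  also have "\<dots> = (X \<triangleright> AI Y Z W) \<star> SW Y X (Z \<otimes>\<^sub>o W) \<star> (Y \<triangleright> SW Z X W)"
    by (simp add: SW_hexagon' cp_assoc tail[OF AI_AS] tail[OF SW_SW])
  finally show ?thesis .
qed

lemma SW_nat3: "ar h \<Longrightarrow> dm h = V \<Longrightarrow> cd h = V' \<Longrightarrow> SW X Y V' \<star> (X \<triangleright> (Y \<triangleright> h)) = (Y \<triangleright> (X \<triangleright> h)) \<star> SW X Y V"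
  using SW_nat[of "ID X" "ID Y" h] by simp
lemma SW_nat2: "ar h \<Longrightarrow> dm h = V \<Longrightarrow> cd h = V' \<Longrightarrow> SW X V' W \<star> (X \<triangleright> (h \<triangleleft> W)) = (h \<triangleleft> (X \<otimes>\<^sub>o W)) \<star> SW X V W"
  using SW_nat[of "ID X" h "ID W"] by simp
lemma SW_nat1: "ar h \<Longrightarrow> dm h = V \<Longrightarrow> cd h = V' \<Longrightarrow> SW V' Y W \<star> (h \<triangleleft> (Y \<otimes>\<^sub>o W)) = (Y \<triangleright> (h \<triangleleft> W)) \<star> SW V Y W"
  using SW_nat[of h "ID Y" "ID W"] by simp

lemma AS_nat3: "ar h \<Longrightarrow> dm h = V \<Longrightarrow> cd h = V' \<Longrightarrow> AS X Y V' \<star> ((X \<otimes>\<^sub>o Y) \<triangleright> h) = (X \<triangleright> (Y \<triangleright> h)) \<star> AS X Y V"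
  using AS_nat[of "ID X" "ID Y" h] by simp
lemma AI_nat3: "ar h \<Longrightarrow> dm h = V \<Longrightarrow> cd h = V' \<Longrightarrow> AI X Y V' \<star> (X \<triangleright> (Y \<triangleright> h)) = ((X \<otimes>\<^sub>o Y) \<triangleright> h) \<star> AI X Y V"
  using AI_nat[of "ID X" "ID Y" h] by simp

context
  fixes X D ev et
  assumes T: "trace_structure X D ev et"
begin

lemma ev_simps: "ar (ev W)" "dm (ev W) = D \<otimes>\<^sub>o (X \<otimes>\<^sub>o W)" "cd (ev W) = W"
  and et_simps: "ar (et W)" "cd (et W) = D \<otimes>\<^sub>o (X \<otimes>\<^sub>o W)" "dm (et W) = W"
  and ev_nat: "ar h \<Longrightarrow> dm h = V \<Longrightarrow> cd h = V' \<Longrightarrow> ev V' \<star> (D \<triangleright> (X \<triangleright> h)) = h \<star> ev V"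
  and et_nat: "ar h \<Longrightarrow> dm h = V \<Longrightarrow> cd h = V' \<Longrightarrow> (D \<triangleright> (X \<triangleright> h)) \<star> et V = et V' \<star> h"
  and ev_slide: "ev (A \<otimes>\<^sub>o W) \<star> (D \<triangleright> SW A X W) \<star> SW A D (X \<otimes>\<^sub>o W) = A \<triangleright> ev W"
  and et_slide: "(D \<triangleright> SW A X W) \<star> SW A D (X \<otimes>\<^sub>o W) \<star> (A \<triangleright> et W) = et (A \<otimes>\<^sub>o W)"
  and yank: "ev (X \<otimes>\<^sub>o W) \<star> (D \<triangleright> SW X X W) \<star> et (X \<otimes>\<^sub>o W) = ID (X \<otimes>\<^sub>o W)"
  using T unfolding trace_structure_def by auto

lemmas evt = ev_simps et_simps

lemma partial_trace_simps: "ar \<phi> \<Longrightarrow> dm \<phi> = X \<otimes>\<^sub>o W \<Longrightarrow> cd \<phi> = X \<otimes>\<^sub>o W' \<Longrightarrow> ar (partial_trace D ev et W W' \<phi>)"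
  "ar \<phi> \<Longrightarrow> dm \<phi> = X \<otimes>\<^sub>o W \<Longrightarrow> cd \<phi> = X \<otimes>\<^sub>o W' \<Longrightarrow> dm (partial_trace D ev et W W' \<phi>) = W"
  "ar \<phi> \<Longrightarrow> dm \<phi> = X \<otimes>\<^sub>o W \<Longrightarrow> cd \<phi> = X \<otimes>\<^sub>o W' \<Longrightarrow> cd (partial_trace D ev et W W' \<phi>) = W'"
  by (simp_all add: evt partial_trace_def)

lemma partial_trace_pre: "ar \<phi> \<Longrightarrow> dm \<phi> = X \<otimes>\<^sub>o W \<Longrightarrow> cd \<phi> = X \<otimes>\<^sub>o W' \<Longrightarrow> ar h \<Longrightarrow> dm h = V \<Longrightarrow> cd h = W \<Longrightarrow>
   partial_trace D ev et V W' (\<phi> \<star> (X \<triangleright> h)) = partial_trace D ev et W W' \<phi> \<star> h"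
  by (simp add: evt partial_trace_def cp_assoc et_nat)

lemma partial_trace_post: "ar \<phi> \<Longrightarrow> dm \<phi> = X \<otimes>\<^sub>o W \<Longrightarrow> cd \<phi> = X \<otimes>\<^sub>o W' \<Longrightarrow> ar h \<Longrightarrow> dm h = W' \<Longrightarrow> cd h = V \<Longrightarrow>
   partial_trace D ev et W V ((X \<triangleright> h) \<star> \<phi>) = h \<star> partial_trace D ev et W W' \<phi>"
  by (simp add: evt partial_trace_def cp_assoc tail[OF ev_nat])

lemma partial_trace_yank: "partial_trace D ev et (X \<otimes>\<^sub>o W) (X \<otimes>\<^sub>o W) (SW X X W) = ID (X \<otimes>\<^sub>o W)"
  by (simp add: evt partial_trace_def yank)

lemma et_slide': "SW A D (X \<otimes>\<^sub>o W) \<star> (A \<triangleright> et W) = (D \<triangleright> SW X A W) \<star> et (A \<otimes>\<^sub>o W)"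
  by (simp add: evt flip: et_slide) (simp add: evt cp_assoc tail[OF SW_SW_whl])

lemma ev_slide': "(A \<triangleright> ev W) \<star> SW D A (X \<otimes>\<^sub>o W) = ev (A \<otimes>\<^sub>o W) \<star> (D \<triangleright> SW A X W)"
  by (simp flip: ev_slide add: evt cp_assoc)

text \<open>The superposing law of traced monoidal categories. The slide laws carry A through the
  dual D into the loop; the conjugation by \<open>SW\<close> keeps X in front, as right bracketing
  requires.\<close>

lemma partial_trace_superpose: assumes "ar \<phi>" "dm \<phi> = X \<otimes>\<^sub>o W" "cd \<phi> = X \<otimes>\<^sub>o W'"
  shows "A \<triangleright> partial_trace D ev et W W' \<phi> = partial_trace D ev et (A \<otimes>\<^sub>o W) (A \<otimes>\<^sub>o W') (SW A X W' \<star> (A \<triangleright> \<phi>) \<star> SW X A W)"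
proof -
  have "A \<triangleright> partial_trace D ev et W W' \<phi> = ev (A \<otimes>\<^sub>o W') \<star> (D \<triangleright> SW A X W') \<star> SW A D (X \<otimes>\<^sub>o W') \<star> (A \<triangleright> (D \<triangleright> \<phi>)) \<star> (A \<triangleright> et W)"
    using assms by (simp add: evt partial_trace_def cp_assoc flip: ev_slide)
  also have "\<dots> = ev (A \<otimes>\<^sub>o W') \<star> (D \<triangleright> SW A X W') \<star> (D \<triangleright> (A \<triangleright> \<phi>)) \<star> SW A D (X \<otimes>\<^sub>o W) \<star> (A \<triangleright> et W)"
    using assms by (simp add: evt tail[OF SW_nat3] cp_assoc)
  finally show ?thesis using assms by (simp add: evt et_slide' partial_trace_def cp_assoc)
qed

lemma loop_slide: assumes "ar f" "dm f = X" "cd f = X"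
  shows "A \<triangleright> partial_trace D ev et W W (f \<triangleleft> W) = partial_trace D ev et (A \<otimes>\<^sub>o W) (A \<otimes>\<^sub>o W) (f \<triangleleft> (A \<otimes>\<^sub>o W))"
  using assms by (simp add: evt partial_trace_superpose tail[OF SW_nat2] cp_assoc)

lemma loop_nat: assumes "ar f" "dm f = X" "cd f = X" "ar h" "dm h = V" "cd h = V'"
  shows "h \<star> partial_trace D ev et V V (f \<triangleleft> V) = partial_trace D ev et V' V' (f \<triangleleft> V') \<star> h"
  using assms by (simp flip: partial_trace_pre partial_trace_post add: evt exch[of f h])

text \<open>Naturality of the exchange moves g behind it. Then f before and g after the crossing act
  on the strand outside the loop, so they leave the trace, and the bare crossing is yanked
  straight.\<close>

lemma partial_trace_yank2: assumes "ar f" "dm f = Y" "cd f = X" "ar g" "dm g = X" "cd g = Y"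
  shows "partial_trace D ev et (Y \<otimes>\<^sub>o W) (Y \<otimes>\<^sub>o W) (SW Y X W \<star> (g \<boxtimes> (f \<triangleleft> W))) = (g \<star> f) \<triangleleft> W"
proof -
  have "SW Y X W \<star> (g \<boxtimes> (f \<triangleleft> W)) = (SW Y X W \<star> (g \<triangleleft> (X \<otimes>\<^sub>o W))) \<star> (X \<triangleright> (f \<triangleleft> W))"
    using assms tn_split1[of g "f \<triangleleft> W"] by (simp add: cp_assoc)
  also have "\<dots> = (X \<triangleright> (g \<triangleleft> W)) \<star> SW X X W \<star> (X \<triangleright> (f \<triangleleft> W))"
    using assms by (simp add: evt SW_nat1 cp_assoc)
  finally show ?thesis using assms by (simp add: evt partial_trace_post partial_trace_pre partial_trace_yank)
qed

text \<open>The same argument for an arbitrary endomorphism G of X \<otimes> W in place of a single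
  factor. It is the fusion step of the Newton recursion.\<close>

lemma partial_trace_swap: assumes "ar f" "dm f = X" "cd f = X" "ar G" "dm G = X \<otimes>\<^sub>o W" "cd G = X \<otimes>\<^sub>o W"
  shows "partial_trace D ev et (X \<otimes>\<^sub>o W) (X \<otimes>\<^sub>o W) (SW X X W \<star> (f \<boxtimes> G)) = (f \<triangleleft> W) \<star> G"
proof -
  have "SW X X W \<star> (f \<boxtimes> G) = (SW X X W \<star> (f \<triangleleft> (X \<otimes>\<^sub>o W))) \<star> (X \<triangleright> G)"
    using assms tn_split1[of f G] by (simp add: evt cp_assoc)
  also have "\<dots> = (X \<triangleright> (f \<triangleleft> W)) \<star> SW X X W \<star> (X \<triangleright> G)"
    using assms by (simp add: evt SW_nat1 cp_assoc)
  finally show ?thesis using assms by (simp add: evt partial_trace_post partial_trace_pre partial_trace_yank)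
qed

end

text \<open>Superposing pulls the inner loop through D' so that it encloses the outer one; the
  exchanges with D' that this creates are absorbed by the slide laws of \<open>ev'\<close> and
  \<open>et'\<close>.\<close>

lemma partial_trace_exchange: assumes T: "trace_structure X D ev et" and T': "trace_structure Y D' ev' et'"
  and "ar \<phi>" "dm \<phi> = X \<otimes>\<^sub>o (Y \<otimes>\<^sub>o W)" "cd \<phi> = X \<otimes>\<^sub>o (Y \<otimes>\<^sub>o W')"
  shows "partial_trace D' ev' et' W W' (partial_trace D ev et (Y \<otimes>\<^sub>o W) (Y \<otimes>\<^sub>o W') \<phi>)
    = partial_trace D ev et W W' (partial_trace D' ev' et' (X \<otimes>\<^sub>o W) (X \<otimes>\<^sub>o W') (SW X Y W' \<star> \<phi> \<star> SW Y X W))"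
proof -
  note [simp] = evt[OF T] evt[OF T'] partial_trace_simps[OF T] partial_trace_simps[OF T'] assms(3-5)
  have "partial_trace D' ev' et' W W' (partial_trace D ev et (Y \<otimes>\<^sub>o W) (Y \<otimes>\<^sub>o W') \<phi>) = ev' W' \<star> 
     partial_trace D ev et (D' \<otimes>\<^sub>o (Y \<otimes>\<^sub>o W)) (D' \<otimes>\<^sub>o (Y \<otimes>\<^sub>o W')) (SW D' X (Y \<otimes>\<^sub>o W') \<star> (D' \<triangleright> \<phi>) \<star> SW X D' (Y \<otimes>\<^sub>o W)) \<star> et' W"
    by (simp add: partial_trace_def[of D' ev' et'] partial_trace_superpose[OF T])
  also have "\<dots> = partial_trace D ev et W W' (((X \<triangleright> ev' W') \<star> SW D' X (Y \<otimes>\<^sub>o W')) \<star> (D' \<triangleright> \<phi>) \<star> SW X D' (Y \<otimes>\<^sub>o W) \<star> (X \<triangleright> et' W))"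
    by (simp add: partial_trace_pre[OF T, symmetric] partial_trace_post[OF T, symmetric] cp_assoc)
  also have "\<dots> = partial_trace D ev et W W' (partial_trace D' ev' et' (X \<otimes>\<^sub>o W) (X \<otimes>\<^sub>o W') (SW X Y W' \<star> \<phi> \<star> SW Y X W))"
    by (simp add: ev_slide'[OF T'] et_slide'[OF T'] partial_trace_def[of D' ev' et'] cp_assoc)
  finally show ?thesis .
qed

text \<open>Both loops are the double trace of one and the same crossing composed with g and f,
  taken in the two possible orders; \<open>partial_trace_yank2\<close> evaluates either order. For X
  = Y and g an identity it also says that the dual does not matter.\<close>

lemma loop_cyclic: assumes T: "trace_structure X D ev et" and T': "trace_structure Y D' ev' et'"
  and "ar f" "dm f = Y" "cd f = X" "ar g" "dm g = X" "cd g = Y"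
  shows "partial_trace D ev et W W ((f \<star> g) \<triangleleft> W) = partial_trace D' ev' et' W W ((g \<star> f) \<triangleleft> W)"
proof -
  have "SW X Y W \<star> (SW Y X W \<star> (g \<boxtimes> (f \<triangleleft> W))) \<star> SW Y X W = SW X Y W \<star> (f \<boxtimes> (g \<triangleleft> W))"
    using assms SW_nat[of f g "ID W"] by (simp add: cp_assoc tail[OF SW_SW])
  then show ?thesis
    using partial_trace_exchange[OF T T', of "SW Y X W \<star> (g \<boxtimes> (f \<triangleleft> W))" W W] assms
    by (simp add: partial_trace_yank2[OF T] partial_trace_yank2[OF T'])
qed

text \<open>The dual of a product is the product of the duals in reverse order: the evaluations are
  nested, X inside and Y outside, and likewise for \<open>prod_et\<close>.\<close>

definition prod_ev where "prod_ev X Y D ev D' ev' W =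
   ev' W \<star> (D' \<triangleright> ev (Y \<otimes>\<^sub>o W)) \<star> AS D' D (X \<otimes>\<^sub>o (Y \<otimes>\<^sub>o W)) \<star> ((D' \<otimes>\<^sub>o D) \<triangleright> AS X Y W)"
definition prod_et where "prod_et X Y D et D' et' W =
   ((D' \<otimes>\<^sub>o D) \<triangleright> AI X Y W) \<star> AI D' D (X \<otimes>\<^sub>o (Y \<otimes>\<^sub>o W)) \<star> (D' \<triangleright> et (Y \<otimes>\<^sub>o W)) \<star> et' W"

lemma partial_trace_prod: assumes T: "trace_structure X D ev et" and T': "trace_structure Y D' ev' et'"
  and "ar F" "dm F = (X \<otimes>\<^sub>o Y) \<otimes>\<^sub>o W" "cd F = (X \<otimes>\<^sub>o Y) \<otimes>\<^sub>o W'"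
  shows "partial_trace (D' \<otimes>\<^sub>o D) (prod_ev X Y D ev D' ev') (prod_et X Y D et D' et') W W' F =
     partial_trace D' ev' et' W W' (partial_trace D ev et (Y \<otimes>\<^sub>o W) (Y \<otimes>\<^sub>o W') (AS X Y W' \<star> F \<star> AI X Y W))"
proof -
  note [simp] = evt[OF T] evt[OF T'] partial_trace_simps[OF T] partial_trace_simps[OF T'] assms(3-5)
  have "AS D' D (X \<otimes>\<^sub>o (Y \<otimes>\<^sub>o W')) \<star> ((D' \<otimes>\<^sub>o D) \<triangleright> (AS X Y W' \<star> F \<star> AI X Y W)) \<star> AI D' D (X \<otimes>\<^sub>o (Y \<otimes>\<^sub>o W))
     = D' \<triangleright> (D \<triangleright> (AS X Y W' \<star> F \<star> AI X Y W))"
    by (subst tail[OF AS_nat3[of _ "X \<otimes>\<^sub>o (Y \<otimes>\<^sub>o W)" "X \<otimes>\<^sub>o (Y \<otimes>\<^sub>o W')"]]) (simp_all add: cp_assoc)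
  then have "AS D' D (X \<otimes>\<^sub>o (Y \<otimes>\<^sub>o W')) \<star> ((D' \<otimes>\<^sub>o D) \<triangleright> AS X Y W') \<star> ((D' \<otimes>\<^sub>o D) \<triangleright> F) \<star> ((D' \<otimes>\<^sub>o D) \<triangleright> AI X Y W) \<star> AI D' D (X \<otimes>\<^sub>o (Y \<otimes>\<^sub>o W)) \<star> r
     = (D' \<triangleright> (D \<triangleright> (AS X Y W' \<star> F \<star> AI X Y W))) \<star> r" for r
    by (simp add: cp_assoc del: ID_tn_ID) (metis cp_assoc)
  then show ?thesis by (simp add: partial_trace_def prod_ev_def prod_et_def cp_assoc)
qed

text \<open>Naturality and sliding hold for each of the nested loops separately. The condition with
  content is the yank, where two pairs of parallel strands cross and have to be separated before the
  loops can be straightened one by one.\<close>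

lemma trace_structure_prod: assumes T: "trace_structure X D ev et" and T': "trace_structure Y D' ev' et'"
  shows "trace_structure (X \<otimes>\<^sub>o Y) (D' \<otimes>\<^sub>o D) (prod_ev X Y D ev D' ev') (prod_et X Y D et D' et')"
  unfolding trace_structure_def
proof (intro conjI allI impI)
  note [simp] = evt[OF T] evt[OF T'] partial_trace_simps[OF T] partial_trace_simps[OF T']
  let ?ev = "prod_ev X Y D ev D' ev'" and ?et = "prod_et X Y D et D' et'" and ?Z = "X \<otimes>\<^sub>o Y" and ?E = "D' \<otimes>\<^sub>o D"
  fix W
  show "ar (?ev W)" "dm (?ev W) = ?E \<otimes>\<^sub>o ?Z \<otimes>\<^sub>o W" "cd (?ev W) = W"
    by (simp_all add: prod_ev_def)
  show "ar (?et W)" "cd (?et W) = ?E \<otimes>\<^sub>o ?Z \<otimes>\<^sub>o W" "dm (?et W) = W"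
    by (simp_all add: prod_et_def)
  show "?ev (cd h) \<star> (?E \<triangleright> (?Z \<triangleright> h)) = h \<star> ?ev (dm h)" if "ar h" for h
  proof -
    have 1: "(?E \<triangleright> AS X Y (cd h)) \<star> (?E \<triangleright> (?Z \<triangleright> h)) = (?E \<triangleright> (X \<triangleright> (Y \<triangleright> h))) \<star> (?E \<triangleright> AS X Y (dm h))"
      using that by (simp add: AS_nat3 flip: whl_cp del: ID_tn_ID)
    have 2: "AS D' D (X \<otimes>\<^sub>o (Y \<otimes>\<^sub>o cd h)) \<star> (?E \<triangleright> (X \<triangleright> (Y \<triangleright> h))) = (D' \<triangleright> (D \<triangleright> (X \<triangleright> (Y \<triangleright> h)))) \<star> AS D' D (X \<otimes>\<^sub>o (Y \<otimes>\<^sub>o dm h))"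
      using that by (simp add: AS_nat3 del: ID_tn_ID)
    have 3: "(D' \<triangleright> ev (Y \<otimes>\<^sub>o cd h)) \<star> (D' \<triangleright> (D \<triangleright> (X \<triangleright> (Y \<triangleright> h)))) = (D' \<triangleright> (Y \<triangleright> h)) \<star> (D' \<triangleright> ev (Y \<otimes>\<^sub>o dm h))"
      using that by (simp add: ev_nat[OF T] flip: whl_cp del: ID_tn_ID)
    show ?thesis using that
      by (simp add: prod_ev_def cp_assoc 1 tail[OF 2] tail[OF 3] tail[OF ev_nat[OF T']] del: ID_tn_ID)
  qed
  show "(?E \<triangleright> (?Z \<triangleright> h)) \<star> ?et (dm h) = ?et (cd h) \<star> h" if "ar h" for h
  proof -
    have 1: "(?E \<triangleright> (?Z \<triangleright> h)) \<star> (?E \<triangleright> AI X Y (dm h)) = (?E \<triangleright> AI X Y (cd h)) \<star> (?E \<triangleright> (X \<triangleright> (Y \<triangleright> h)))"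
      using that by (simp add: AI_nat3 flip: whl_cp del: ID_tn_ID)
    have 2: "(?E \<triangleright> (X \<triangleright> (Y \<triangleright> h))) \<star> AI D' D (X \<otimes>\<^sub>o (Y \<otimes>\<^sub>o dm h)) = AI D' D (X \<otimes>\<^sub>o (Y \<otimes>\<^sub>o cd h)) \<star> (D' \<triangleright> (D \<triangleright> (X \<triangleright> (Y \<triangleright> h))))"
      using that by (simp add: AI_nat3 del: ID_tn_ID)
    have 3: "(D' \<triangleright> (D \<triangleright> (X \<triangleright> (Y \<triangleright> h)))) \<star> (D' \<triangleright> et (Y \<otimes>\<^sub>o dm h)) = (D' \<triangleright> et (Y \<otimes>\<^sub>o cd h)) \<star> (D' \<triangleright> (Y \<triangleright> h))"
      using that by (simp add: et_nat[OF T] flip: whl_cp del: ID_tn_ID)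
    show ?thesis using that
      by (simp add: prod_et_def cp_assoc tail[OF 1] tail[OF 2] tail[OF 3] et_nat[OF T'] del: ID_tn_ID)
  qed
  fix A
  let ?V = "X \<otimes>\<^sub>o (Y \<otimes>\<^sub>o W)"
  have h1: "(?E \<triangleright> AS X Y (A \<otimes>\<^sub>o W)) \<star> (?E \<triangleright> SW A ?Z W) =
     (?E \<triangleright> (X \<triangleright> SW A Y W)) \<star> (?E \<triangleright> SW A X (Y \<otimes>\<^sub>o W)) \<star> (?E \<triangleright> (A \<triangleright> AS X Y W))"
    by (simp add: SW_hexagon flip: whl_cp del: ID_tn_ID)
  have h1': "(?E \<triangleright> SW A ?Z W) \<star> (?E \<triangleright> (A \<triangleright> AI X Y W)) = 
     (?E \<triangleright> AI X Y (A \<otimes>\<^sub>o W)) \<star> (?E \<triangleright> (X \<triangleright> SW A Y W)) \<star> (?E \<triangleright> SW A X (Y \<otimes>\<^sub>o W))"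
    by (simp add: SW_hexagon' tail[OF AI_AS] flip: whl_cp del: ID_tn_ID)
  have h2: "AS D' D (A \<otimes>\<^sub>o ?V) \<star> SW A ?E ?V = (D' \<triangleright> SW A D ?V) \<star> SW A D' (D \<otimes>\<^sub>o ?V) \<star> (A \<triangleright> AS D' D ?V)"
    by (simp add: SW_hexagon)
  have h2': "SW A ?E ?V \<star> (A \<triangleright> AI D' D ?V) = AI D' D (A \<otimes>\<^sub>o ?V) \<star> (D' \<triangleright> SW A D ?V) \<star> SW A D' (D \<otimes>\<^sub>o ?V)"
    by (simp add: SW_hexagon' tail[OF AI_AS])
  note n1 = AS_nat3[of "X \<triangleright> SW A Y W" _ _ D' D] AS_nat3[of "SW A X (Y \<otimes>\<^sub>o W)" _ _ D' D]
    AI_nat3[of "X \<triangleright> SW A Y W" _ _ D' D, symmetric] AI_nat3[of "SW A X (Y \<otimes>\<^sub>o W)" _ _ D' D, symmetric]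
  have s1: "(D' \<triangleright> ev (Y \<otimes>\<^sub>o (A \<otimes>\<^sub>o W))) \<star> (D' \<triangleright> (D \<triangleright> (X \<triangleright> SW A Y W))) \<star> (D' \<triangleright> (D \<triangleright> SW A X (Y \<otimes>\<^sub>o W))) \<star> (D' \<triangleright> SW A D ?V)
    = (D' \<triangleright> SW A Y W) \<star> (D' \<triangleright> (A \<triangleright> ev (Y \<otimes>\<^sub>o W)))"
    by (simp add: tail[OF ev_nat[OF T]] ev_slide[OF T] cp_assoc flip: whl_cp del: ID_tn_ID)
  have s1': "(D' \<triangleright> (D \<triangleright> (X \<triangleright> SW A Y W))) \<star> (D' \<triangleright> (D \<triangleright> SW A X (Y \<otimes>\<^sub>o W))) \<star> (D' \<triangleright> SW A D ?V) \<star> (D' \<triangleright> (A \<triangleright> et (Y \<otimes>\<^sub>o W)))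
    = (D' \<triangleright> et (Y \<otimes>\<^sub>o (A \<otimes>\<^sub>o W))) \<star> (D' \<triangleright> SW A Y W)"
    by (simp add: et_nat[OF T] et_slide[OF T] cp_assoc flip: whl_cp del: ID_tn_ID)
  show "?ev (A \<otimes>\<^sub>o W) \<star> (?E \<triangleright> SW A ?Z W) \<star> SW A ?E (?Z \<otimes>\<^sub>o W) = A \<triangleright> ?ev W"
  proof -
    have "?ev (A \<otimes>\<^sub>o W) \<star> (?E \<triangleright> SW A ?Z W) \<star> SW A ?E (?Z \<otimes>\<^sub>o W) = 
      ev' (A \<otimes>\<^sub>o W) \<star> (D' \<triangleright> ev (Y \<otimes>\<^sub>o (A \<otimes>\<^sub>o W))) \<star> (D' \<triangleright> (D \<triangleright> (X \<triangleright> SW A Y W))) \<star> (D' \<triangleright> (D \<triangleright> SW A X (Y \<otimes>\<^sub>o W)))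
        \<star> AS D' D (A \<otimes>\<^sub>o ?V) \<star> SW A ?E ?V \<star> (A \<triangleright> (?E \<triangleright> AS X Y W))"
      by (simp add: prod_ev_def cp_assoc tail[OF h1] tail[OF n1(1)] tail[OF n1(2)] SW_nat3[symmetric] del: ID_tn_ID)
    also have "\<dots> = ev' (A \<otimes>\<^sub>o W) \<star> ((D' \<triangleright> ev (Y \<otimes>\<^sub>o (A \<otimes>\<^sub>o W))) \<star> (D' \<triangleright> (D \<triangleright> (X \<triangleright> SW A Y W))) \<star> (D' \<triangleright> (D \<triangleright> SW A X (Y \<otimes>\<^sub>o W)))
        \<star> (D' \<triangleright> SW A D ?V)) \<star> SW A D' (D \<otimes>\<^sub>o ?V) \<star> (A \<triangleright> AS D' D ?V) \<star> (A \<triangleright> (?E \<triangleright> AS X Y W))"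
      by (simp add: tail[OF h2] cp_assoc del: ID_tn_ID)
    also have "\<dots> = (ev' (A \<otimes>\<^sub>o W) \<star> (D' \<triangleright> SW A Y W) \<star> SW A D' (Y \<otimes>\<^sub>o W)) \<star> (A \<triangleright> (D' \<triangleright> ev (Y \<otimes>\<^sub>o W))) \<star> (A \<triangleright> AS D' D ?V) \<star> (A \<triangleright> (?E \<triangleright> AS X Y W))"
      by (simp add: s1 cp_assoc tail[OF SW_nat3] del: ID_tn_ID)
    also have "\<dots> = A \<triangleright> ?ev W"
      by (simp add: ev_slide[OF T'] prod_ev_def cp_assoc)
    finally show ?thesis .
  qed
  show "(?E \<triangleright> SW A ?Z W) \<star> SW A ?E (?Z \<otimes>\<^sub>o W) \<star> (A \<triangleright> ?et W) = ?et (A \<otimes>\<^sub>o W)"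
  proof -
    have "(?E \<triangleright> SW A ?Z W) \<star> SW A ?E (?Z \<otimes>\<^sub>o W) \<star> (A \<triangleright> ?et W) =
      (?E \<triangleright> SW A ?Z W) \<star> (SW A ?E (?Z \<otimes>\<^sub>o W) \<star> (A \<triangleright> (?E \<triangleright> AI X Y W))) \<star> (A \<triangleright> AI D' D ?V) \<star> (A \<triangleright> (D' \<triangleright> et (Y \<otimes>\<^sub>o W))) \<star> (A \<triangleright> et' W)"
      by (simp add: prod_et_def cp_assoc del: ID_tn_ID)
    also have "\<dots> = ((?E \<triangleright> SW A ?Z W) \<star> (?E \<triangleright> (A \<triangleright> AI X Y W))) \<star> (SW A ?E ?V \<star> (A \<triangleright> AI D' D ?V)) \<star> (A \<triangleright> (D' \<triangleright> et (Y \<otimes>\<^sub>o W))) \<star> (A \<triangleright> et' W)"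
      by (simp add: SW_nat3 cp_assoc del: ID_tn_ID)
    also have "\<dots> = (?E \<triangleright> AI X Y (A \<otimes>\<^sub>o W)) \<star> ((?E \<triangleright> (X \<triangleright> SW A Y W)) \<star> (?E \<triangleright> SW A X (Y \<otimes>\<^sub>o W)) \<star> AI D' D (A \<otimes>\<^sub>o ?V)) \<star> (D' \<triangleright> SW A D ?V) \<star> (SW A D' (D \<otimes>\<^sub>o ?V)  \<star> (A \<triangleright> (D' \<triangleright> et (Y \<otimes>\<^sub>o W)))) \<star> (A \<triangleright> et' W)"
      by (simp only: h1' h2' cp_assoc)
    also have "\<dots> = (?E \<triangleright> AI X Y (A \<otimes>\<^sub>o W)) \<star> AI D' D (X \<otimes>\<^sub>o (Y \<otimes>\<^sub>o (A \<otimes>\<^sub>o W))) \<star> ((D' \<triangleright> (D \<triangleright> (X \<triangleright> SW A Y W))) \<star> (D' \<triangleright> (D \<triangleright> SW A X (Y \<otimes>\<^sub>o W))) \<star> (D' \<triangleright> SW A D ?V) \<star> (D' \<triangleright> (A \<triangleright> et (Y \<otimes>\<^sub>o W)))) \<star> (SW A D' (Y \<otimes>\<^sub>o W) \<star> (A \<triangleright> et' W))"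
      by (simp add: n1(3,4) tail[OF n1(3)] cp_assoc SW_nat3 del: ID_tn_ID)
    also have "\<dots> = (?E \<triangleright> AI X Y (A \<otimes>\<^sub>o W)) \<star> AI D' D (X \<otimes>\<^sub>o (Y \<otimes>\<^sub>o (A \<otimes>\<^sub>o W))) \<star> (D' \<triangleright> et (Y \<otimes>\<^sub>o (A \<otimes>\<^sub>o W))) \<star> ((D' \<triangleright> SW A Y W) \<star> SW A D' (Y \<otimes>\<^sub>o W) \<star> (A \<triangleright> et' W))"
      by (simp only: s1' cp_assoc)
    finally show ?thesis by (simp add: et_slide[OF T'] prod_et_def)
  qed
  have e: "SW ?Z Y W \<star> AI X Y (Y \<otimes>\<^sub>o W) = (Y \<triangleright> AI X Y W) \<star> SW X Y (Y \<otimes>\<^sub>o W) \<star> (X \<triangleright> SW Y Y W)"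
    by (rule SW_hexagon_left)
  \<comment> \<open>The hexagons cut the crossing of ?Z with itself into four crossings of single
    strands. That of X with itself ends up between arrows tensored with X, so the trace over X can
    be evaluated first.\<close>
  have "AS X Y (?Z \<otimes>\<^sub>o W) \<star> SW ?Z ?Z W \<star> AI X Y (?Z \<otimes>\<^sub>o W) =
     (X \<triangleright> SW ?Z Y W) \<star> SW ?Z X (Y \<otimes>\<^sub>o W) \<star> (?Z \<triangleright> AS X Y W) \<star> AI X Y (?Z \<otimes>\<^sub>o W)"
    by (simp add: tail[OF SW_hexagon[symmetric]] cp_assoc)
  also have "\<dots> = (X \<triangleright> SW ?Z Y W) \<star> (SW ?Z X (Y \<otimes>\<^sub>o W) \<star> AI X Y ?V) \<star> (X \<triangleright> (Y \<triangleright> AS X Y W))"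
    by (simp add: AI_nat3 cp_assoc del: ID_tn_ID)
  also have "\<dots> = (X \<triangleright> (SW ?Z Y W \<star> AI X Y (Y \<otimes>\<^sub>o W))) \<star> SW X X (Y \<otimes>\<^sub>o (Y \<otimes>\<^sub>o W)) \<star> (X \<triangleright> (SW Y X (Y \<otimes>\<^sub>o W) \<star> (Y \<triangleright> AS X Y W)))"
    by (simp add: SW_hexagon_left[of X Y X "Y \<otimes>\<^sub>o W"] cp_assoc)
  finally have "partial_trace ?E ?ev ?et (?Z \<otimes>\<^sub>o W) (?Z \<otimes>\<^sub>o W) (SW ?Z ?Z W) = partial_trace D' ev' et' (?Z \<otimes>\<^sub>o W) (?Z \<otimes>\<^sub>o W) 
     ((SW ?Z Y W \<star> AI X Y (Y \<otimes>\<^sub>o W)) \<star> (SW Y X (Y \<otimes>\<^sub>o W) \<star> (Y \<triangleright> AS X Y W)))"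
    by (simp add: partial_trace_prod[OF T T'] partial_trace_pre[OF T] partial_trace_post[OF T] partial_trace_yank[OF T] del: whl_cp)
  also have "(SW ?Z Y W \<star> AI X Y (Y \<otimes>\<^sub>o W)) \<star> (SW Y X (Y \<otimes>\<^sub>o W) \<star> (Y \<triangleright> AS X Y W)) =
    (Y \<triangleright> AI X Y W) \<star> (SW X Y (Y \<otimes>\<^sub>o W) \<star> (X \<triangleright> SW Y Y W) \<star> SW Y X (Y \<otimes>\<^sub>o W)) \<star> (Y \<triangleright> AS X Y W)"
    by (simp only: e cp_assoc)
  \<comment> \<open>Yang-Baxter frees the crossing of Y with itself, which was caught between two
    crossings with X. Its neighbours are now tensored with Y and leave the trace over Y.\<close>
  also have "\<dots> = (Y \<triangleright> (AI X Y W \<star> SW Y X W)) \<star> SW Y Y (X \<otimes>\<^sub>o W) \<star> (Y \<triangleright> (SW X Y W \<star> AS X Y W))"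
    by (simp add: SW_yang_baxter[of X Y Y W] cp_assoc)
  finally have "partial_trace ?E ?ev ?et (?Z \<otimes>\<^sub>o W) (?Z \<otimes>\<^sub>o W) (SW ?Z ?Z W) = ID (?Z \<otimes>\<^sub>o W)"
    by (simp add: partial_trace_pre[OF T'] partial_trace_post[OF T'] partial_trace_yank[OF T'] cp_assoc tail[OF SW_SW] del: whl_cp)
  then show "?ev (?Z \<otimes>\<^sub>o W) \<star> (?E \<triangleright> SW ?Z ?Z W) \<star> ?et (?Z \<otimes>\<^sub>o W) = ID (?Z \<otimes>\<^sub>o W)"
    by (simp add: partial_trace_def)
qed


section \<open>Trace structures of the unit object and of a given dual\<close>

lemma LI_nat: assumes "ar h" "dm h = V" "cd h = V'" shows "(\<I> \<triangleright> h) \<star> LI V = LI V' \<star> h"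
proof -
  have "(\<I> \<triangleright> h) \<star> LI V = LI V' \<star> (LU V' \<star> (\<I> \<triangleright> h)) \<star> LI V"
    using assms by (simp add: cp_assoc tail[OF LI_LU])
  also have "\<dots> = LI V' \<star> h" using assms by (simp add: LU_nat cp_assoc del: LI_LU)
  finally show ?thesis .
qed

lemma LU_I_whl: "LU (\<I> \<otimes>\<^sub>o W) = \<I> \<triangleright> LU W"
proof -
  have "LI W \<star> (LU W \<star> (\<I> \<triangleright> LU W)) = LI W \<star> (LU W \<star> LU (\<I> \<otimes>\<^sub>o W))" by (simp add: LU_nat)
  then show ?thesis by (simp add: tail[OF LI_LU])
qed

lemma SW_I_I: "SW \<I> \<I> W = ID (\<I> \<otimes>\<^sub>o (\<I> \<otimes>\<^sub>o W))"
proof -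
  have "LI (\<I> \<otimes>\<^sub>o W) \<star> (LU (\<I> \<otimes>\<^sub>o W) \<star> SW \<I> \<I> W) = LI (\<I> \<otimes>\<^sub>o W) \<star> LU (\<I> \<otimes>\<^sub>o W)" 
    by (simp only: LU_SW) (simp add: LU_I_whl[symmetric])
  then show ?thesis by (simp add: tail[OF LI_LU])
qed

lemma LI_SW: "SW A \<I> W \<star> (A \<triangleright> LI W) = LI (A \<otimes>\<^sub>o W)"
proof -
  have "SW A \<I> W \<star> (A \<triangleright> LI W) = LI (A \<otimes>\<^sub>o W) \<star> (LU (A \<otimes>\<^sub>o W) \<star> SW A \<I> W) \<star> (A \<triangleright> LI W)"
    by (simp add: cp_assoc tail[OF LI_LU])
  also have "\<dots> = LI (A \<otimes>\<^sub>o W) \<star> (A \<triangleright> (LU W \<star> LI W))" by (simp only: LU_SW) (simp flip: whl_cp)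
  finally show ?thesis by (simp del: whl_cp)
qed

text \<open>Provides the value of the trace on the identity of \<I>, the start of the Newton
  recursion.\<close>

lemma trace_structure_unit: "trace_structure \<I> \<I> (\<lambda>W. LU W \<star> LU (\<I> \<otimes>\<^sub>o W)) (\<lambda>W. LI (\<I> \<otimes>\<^sub>o W) \<star> LI W)"
  unfolding trace_structure_def
proof (intro conjI allI impI)
  show "(LU (cd h) \<star> LU (\<I> \<otimes>\<^sub>o cd h)) \<star> \<I> \<triangleright> (\<I> \<triangleright> h) = h \<star> LU (dm h) \<star> LU (\<I> \<otimes>\<^sub>o dm h)" if "ar h" for h
    using that by (simp add: cp_assoc LU_nat tail[OF LU_nat])
  show "\<I> \<triangleright> (\<I> \<triangleright> h) \<star> LI (\<I> \<otimes>\<^sub>o dm h) \<star> LI (dm h) = (LI (\<I> \<otimes>\<^sub>o cd h) \<star> LI (cd h)) \<star> h" if "ar h" for h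
    using that by (simp add: cp_assoc LI_nat tail[OF LI_nat])
  fix A W
  have "(LU (A \<otimes>\<^sub>o W) \<star> LU (\<I> \<otimes>\<^sub>o A \<otimes>\<^sub>o W)) \<star> (\<I> \<triangleright> SW A \<I> W) \<star> SW A \<I> (\<I> \<otimes>\<^sub>o W)
    = (LU (A \<otimes>\<^sub>o W) \<star> SW A \<I> W) \<star> (LU (A \<otimes>\<^sub>o (\<I> \<otimes>\<^sub>o W)) \<star> SW A \<I> (\<I> \<otimes>\<^sub>o W))"
    by (simp add: cp_assoc LU_nat tail[OF LU_nat])
  then show "(LU (A \<otimes>\<^sub>o W) \<star> LU (\<I> \<otimes>\<^sub>o A \<otimes>\<^sub>o W)) \<star> \<I> \<triangleright> SW A \<I> W \<star> SW A \<I> (\<I> \<otimes>\<^sub>o W) = A \<triangleright> (LU W \<star> LU (\<I> \<otimes>\<^sub>o W))"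
    by (simp only: LU_SW) simp
  have "(\<I> \<triangleright> SW A \<I> W) \<star> SW A \<I> (\<I> \<otimes>\<^sub>o W) \<star> (A \<triangleright> (LI (\<I> \<otimes>\<^sub>o W) \<star> LI W))
    = (\<I> \<triangleright> SW A \<I> W) \<star> (SW A \<I> (\<I> \<otimes>\<^sub>o W) \<star> (A \<triangleright> LI (\<I> \<otimes>\<^sub>o W))) \<star> (A \<triangleright> LI W)"
    by (simp add: cp_assoc)
  also have "\<dots> = LI (\<I> \<otimes>\<^sub>o (A \<otimes>\<^sub>o W)) \<star> SW A \<I> W \<star> (A \<triangleright> LI W)"
    by (simp add: LI_SW tail[OF LI_nat] cp_assoc)
  finally show "(\<I> \<triangleright> SW A \<I> W) \<star> SW A \<I> (\<I> \<otimes>\<^sub>o W) \<star> A \<triangleright> (LI (\<I> \<otimes>\<^sub>o W) \<star> LI W) = LI (\<I> \<otimes>\<^sub>o A \<otimes>\<^sub>o W) \<star> LI (A \<otimes>\<^sub>o W)"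
    by (simp add: LI_SW)
  show "(LU (\<I> \<otimes>\<^sub>o W) \<star> LU (\<I> \<otimes>\<^sub>o \<I> \<otimes>\<^sub>o W)) \<star> \<I> \<triangleright> SW \<I> \<I> W \<star> LI (\<I> \<otimes>\<^sub>o \<I> \<otimes>\<^sub>o W) \<star> LI (\<I> \<otimes>\<^sub>o W) = ID (\<I> \<otimes>\<^sub>o W)"
    by (simp add: SW_I_I cp_assoc tail[OF LU_LI])
qed simp_all

definition dual_ev where "dual_ev X D e W = LU W \<star> (e \<triangleleft> W) \<star> AI D X W"
definition dual_cv where "dual_cv X D c W = AS X D W \<star> (c \<triangleleft> W) \<star> LI W"

text \<open>The slide laws come from the hexagon and the unit law \<open>LU_SW\<close>. The yank is
  the zigzag identity in disguise: sliding X through the evaluation cancels the braiding inside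
  \<open>et\<close> and leaves \<open>snake\<close>.\<close>

lemma trace_structure_dual:
  assumes e: "ar e" "dm e = D \<otimes>\<^sub>o X" "cd e = \<I>" and c: "ar c" "dm c = \<I>" "cd c = X \<otimes>\<^sub>o D"
    and zigzag: "RU X \<star> (X \<triangleright> e) \<star> AS X D X \<star> (c \<triangleleft> X) = LU X"
  shows "trace_structure X D (dual_ev X D e) (\<lambda>W. SW X D W \<star> dual_cv X D c W)"
proof -
  note [simp] = e c
  have ev_simps [simp]: "ar (dual_ev X D e W)" "dm (dual_ev X D e W) = D \<otimes>\<^sub>o (X \<otimes>\<^sub>o W)" "cd (dual_ev X D e W) = W" for W
    by (simp_all add: dual_ev_def)
  have cv_simps [simp]: "ar (dual_cv X D c W)" "cd (dual_cv X D c W) = X \<otimes>\<^sub>o (D \<otimes>\<^sub>o W)" "dm (dual_cv X D c W) = W" for W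
    by (simp_all add: dual_cv_def)
  have slide: "dual_ev X D e (A \<otimes>\<^sub>o W) \<star> (D \<triangleright> SW A X W) \<star> SW A D (X \<otimes>\<^sub>o W) = A \<triangleright> dual_ev X D e W" for A W
  proof -
    have "dual_ev X D e (A \<otimes>\<^sub>o W) \<star> (D \<triangleright> SW A X W) \<star> SW A D (X \<otimes>\<^sub>o W)
      = LU (A \<otimes>\<^sub>o W) \<star> ((e \<triangleleft> (A \<otimes>\<^sub>o W)) \<star> SW A (D \<otimes>\<^sub>o X) W) \<star> (A \<triangleright> AI D X W)"
      by (simp add: dual_ev_def cp_assoc SW_hexagon' tail[OF AI_AS])
    also have "\<dots> = (LU (A \<otimes>\<^sub>o W) \<star> SW A \<I> W) \<star> (A \<triangleright> (e \<triangleleft> W)) \<star> (A \<triangleright> AI D X W)"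
      by (simp add: SW_nat2[symmetric] cp_assoc)
    finally show ?thesis by (simp only: LU_SW) (simp add: dual_ev_def)
  qed
  have cslide: "(X \<triangleright> SW A D W) \<star> SW A X (D \<otimes>\<^sub>o W) \<star> (A \<triangleright> dual_cv X D c W) = dual_cv X D c (A \<otimes>\<^sub>o W)" for A W
  proof -
    have "(X \<triangleright> SW A D W) \<star> SW A X (D \<otimes>\<^sub>o W) \<star> (A \<triangleright> dual_cv X D c W)
      = ((X \<triangleright> SW A D W) \<star> SW A X (D \<otimes>\<^sub>o W)  \<star> (A \<triangleright> AS X D W)) \<star> (A \<triangleright> (c \<triangleleft> W)) \<star> (A \<triangleright> LI W)"
      by (simp add: dual_cv_def cp_assoc)
    also have "\<dots> = AS X D (A \<otimes>\<^sub>o W) \<star> (c \<triangleleft> (A \<otimes>\<^sub>o W)) \<star> SW A \<I> W \<star> (A \<triangleright> LI W)"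
      by (simp add: SW_hexagon cp_assoc tail[OF SW_nat2])
    finally show ?thesis by (simp add: dual_cv_def LI_SW)
  qed
  have nat: "dual_ev X D e (cd h) \<star> D \<triangleright> (X \<triangleright> h) = h \<star> dual_ev X D e (dm h)" if "ar h" for h
  proof -
    have 0: "e \<triangleleft> (cd h) \<star> ((D \<otimes>\<^sub>o X) \<triangleright> h) = (\<I> \<triangleright> h) \<star> (e \<triangleleft> dm h)"
      using that by (simp add: exch)
    show ?thesis using that by (simp add: dual_ev_def cp_assoc AI_nat3 tail[OF 0] tail[OF LU_nat] del: ID_tn_ID)
  qed
  have cnat: "X \<triangleright> (D \<triangleright> h) \<star> dual_cv X D c (dm h) = dual_cv X D c (cd h) \<star> h" if "ar h" for h
  proof -
    have 1: "((X \<otimes>\<^sub>o D) \<triangleright> h) \<star> (c \<triangleleft> dm h) = (c \<triangleleft> cd h) \<star> (\<I> \<triangleright> h)"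
      using that by (simp add: exch)
    have 2: "X \<triangleright> (D \<triangleright> h) \<star> AS X D (dm h) = AS X D (cd h) \<star> ((X \<otimes>\<^sub>o D) \<triangleright> h)"
      using that by (simp add: AS_nat3 del: ID_tn_ID)
    show ?thesis using that by (simp add: dual_cv_def cp_assoc tail[OF 1] tail[OF 2] LI_nat del: ID_tn_ID)
  qed
  \<comment> \<open>The zigzag tensored with W. Pentagon and triangle move the associators until the
    hypothesis appears as a factor, and \<open>LU_kelly\<close> disposes of what is left.\<close>
  have snake: "(X \<triangleright> dual_ev X D e W) \<star> dual_cv X D c (X \<otimes>\<^sub>o W) = ID (X \<otimes>\<^sub>o W)" for W
  proof -
    have p: "(X \<triangleright> AI D X W) \<star> AS X D (X \<otimes>\<^sub>o W) = AS X (D \<otimes>\<^sub>o X) W \<star> (AS X D X \<triangleleft> W) \<star> AI (X \<otimes>\<^sub>o D) X W"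
      using arg_cong[OF pentagon3[of X D X W], of "\<lambda>u. u \<star> AI (X \<otimes>\<^sub>o D) X W"] by (simp add: cp_assoc)
    have "(X \<triangleright> dual_ev X D e W) \<star> dual_cv X D c (X \<otimes>\<^sub>o W) =
      (X \<triangleright> LU W) \<star> (X \<triangleright> (e \<triangleleft> W)) \<star> ((X \<triangleright> AI D X W) \<star> AS X D (X \<otimes>\<^sub>o W)) \<star> (c \<triangleleft> (X \<otimes>\<^sub>o W)) \<star> LI (X \<otimes>\<^sub>o W)"
      by (simp add: dual_ev_def dual_cv_def cp_assoc)
    also have "\<dots> = (X \<triangleright> LU W) \<star> ((X \<triangleright> (e \<triangleleft> W)) \<star> AS X (D \<otimes>\<^sub>o X) W) \<star> (AS X D X \<triangleleft> W) \<star> (AI (X \<otimes>\<^sub>o D) X W \<star> (c \<triangleleft> (X \<otimes>\<^sub>o W))) \<star> LI (X \<otimes>\<^sub>o W)"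
      by (simp only: p cp_assoc)
    also have "AI (X \<otimes>\<^sub>o D) X W \<star> (c \<triangleleft> (X \<otimes>\<^sub>o W)) = ((c \<triangleleft> X) \<triangleleft> W) \<star> AI \<I> X W"
      using AI_nat[of c "ID X" "ID W"] by simp
    also have "(X \<triangleright> (e \<triangleleft> W)) \<star> AS X (D \<otimes>\<^sub>o X) W = AS X \<I> W \<star> ((X \<triangleright> e) \<triangleleft> W)"
      using AS_nat[of "ID X" e "ID W"] by simp
    also have "(X \<triangleright> LU W) \<star> (AS X \<I> W \<star> ((X \<triangleright> e) \<triangleleft> W)) \<star> (AS X D X \<triangleleft> W) \<star> (((c \<triangleleft> X) \<triangleleft> W) \<star> AI \<I> X W) \<star> LI (X \<otimes>\<^sub>o W)
      = ((RU X \<star> (X \<triangleright> e) \<star> AS X D X \<star> (c \<triangleleft> X)) \<triangleleft> W) \<star> AI \<I> X W \<star> LI (X \<otimes>\<^sub>o W)"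
      by (simp add: tail[OF triangle_arrow] cp_assoc)
    also have "\<dots> = LU (X \<otimes>\<^sub>o W) \<star> AS \<I> X W \<star> AI \<I> X W \<star> LI (X \<otimes>\<^sub>o W)"
      by (simp only: zigzag LU_kelly[symmetric] cp_assoc)
    finally show ?thesis by (simp add: tail[OF AS_AI])
  qed
  show ?thesis unfolding trace_structure_def
  proof (intro conjI allI impI)
    show "D \<triangleright> (X \<triangleright> h) \<star> SW X D (dm h) \<star> dual_cv X D c (dm h) = (SW X D (cd h) \<star> dual_cv X D c (cd h)) \<star> h" if "ar h" for h
      using that cnat[OF that] by (simp add: cp_assoc tail[OF SW_nat3[symmetric]])
    fix A W
    have "(D \<triangleright> SW A X W) \<star> SW A D (X \<otimes>\<^sub>o W) \<star> (A \<triangleright> SW X D W) \<star> (A \<triangleright> dual_cv X D c W)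
        = SW X D (A \<otimes>\<^sub>o W) \<star> (X \<triangleright> SW A D W) \<star> SW A X (D \<otimes>\<^sub>o W) \<star> (A \<triangleright> dual_cv X D c W)"
      using arg_cong[OF SW_yang_baxter[of X D A W], of "\<lambda>u. u \<star> (A \<triangleright> dual_cv X D c W)"] by (simp add: cp_assoc)
    then show "D \<triangleright> SW A X W \<star> SW A D (X \<otimes>\<^sub>o W) \<star> A \<triangleright> (SW X D W \<star> dual_cv X D c W) = SW X D (A \<otimes>\<^sub>o W) \<star> dual_cv X D c (A \<otimes>\<^sub>o W)"
      by (simp add: cslide)
    show "dual_ev X D e (X \<otimes>\<^sub>o W) \<star> D \<triangleright> SW X X W \<star> SW X D (X \<otimes>\<^sub>o W) \<star> dual_cv X D c (X \<otimes>\<^sub>o W) = ID (X \<otimes>\<^sub>o W)"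
      using arg_cong[OF slide[of X W], of "\<lambda>u. u \<star> dual_cv X D c (X \<otimes>\<^sub>o W)"] by (simp add: cp_assoc snake)
  qed (simp_all add: slide nat)
qed

text \<open>Ties the loop with W = \<I> to the formula in \<open>trace\<close>. Naturality moves f
  to the other side of the braiding, and the remaining unit constraints cancel because left and
  right constraint agree on \<I>.\<close>

lemma loop_dual:
  assumes e: "ar e" "dm e = D \<otimes>\<^sub>o X" "cd e = \<I>" and c: "ar c" "dm c = \<I>" "cd c = X \<otimes>\<^sub>o D"
    and f: "ar f" "dm f = X" "cd f = X"
  shows "partial_trace D (dual_ev X D e) (\<lambda>W. SW X D W \<star> dual_cv X D c W) \<I> \<I> (f \<triangleleft> \<I>) = e \<star> BR X D \<star> (f \<triangleleft> D) \<star> c"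
proof -
  note [simp] = e c f
  have "partial_trace D (dual_ev X D e) (\<lambda>W. SW X D W \<star> dual_cv X D c W) \<I> \<I> (f \<triangleleft> \<I>)
    = LU \<I> \<star> (e \<triangleleft> \<I>) \<star> (AI D X \<I> \<star> (D \<triangleright> (f \<triangleleft> \<I>))) \<star> AS D X \<I> \<star> (BR X D \<triangleleft> \<I>) \<star> (c \<triangleleft> \<I>) \<star> LI \<I>"
    by (simp add: partial_trace_def dual_ev_def dual_cv_def SW_def cp_assoc tail[OF AI_AS])
  also have "AI D X \<I> \<star> (D \<triangleright> (f \<triangleleft> \<I>)) = ((D \<triangleright> f) \<triangleleft> \<I>) \<star> AI D X \<I>"
    using AI_nat[of "ID D" f "ID \<I>"] by simp
  also have "LU \<I> \<star> (e \<triangleleft> \<I>) \<star> (((D \<triangleright> f) \<triangleleft> \<I>) \<star> AI D X \<I>) \<star> AS D X \<I> \<star> (BR X D \<triangleleft> \<I>) \<star> (c \<triangleleft> \<I>) \<star> LI \<I>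
    = RU \<I> \<star> ((e \<star> ((D \<triangleright> f) \<star> BR X D) \<star> c) \<triangleleft> \<I>) \<star> LI \<I>"
    by (simp add: cp_assoc tail[OF AI_AS] LU_I)
  also have "(D \<triangleright> f) \<star> BR X D = BR X D \<star> (f \<triangleleft> D)"
    using BR_nat[of f "ID D" X D] by simp
  also have "RU \<I> \<star> ((e \<star> (BR X D \<star> (f \<triangleleft> D)) \<star> c) \<triangleleft> \<I>) \<star> LI \<I> = (e \<star> (BR X D \<star> (f \<triangleleft> D)) \<star> c) \<star> LU \<I> \<star> LI \<I>"
    by (subst tail[OF RU_nat]) (simp_all add: cp_assoc LU_I[symmetric])
  finally show ?thesis by (simp add: cp_assoc)
qed

end

section \<open>The categorical trace: cyclicity, products, fusion\<close>

context rigid_karoubian_tensor_category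
begin

definition TR where "TR F = mk \<I> \<I> (trace C (dm F) (mp F))"

text \<open>The structure is built on the very dual that the choice operator in \<open>trace\<close>
  selects, so that \<open>TR\<close> unfolds to its loop. Independence of that choice follows in
  \<open>TR_eq\<close>.\<close>

lemma TR_exists:
  "\<exists>D ev et. trace_structure X D ev et \<and> (\<forall>F. ar F \<longrightarrow> dm F = X \<longrightarrow> cd F = X \<longrightarrow> TR F = partial_trace D ev et \<I> \<I> (F \<triangleleft> \<I>))"
proof -
  define t where "t = (SOME (D, ev, coev). is_dual C X D ev coev)"
  obtain D e c where t: "t = (D, e, c)" by (cases t) auto
  have "case t of (D, ev, coev) \<Rightarrow> is_dual C X D ev coev"
    unfolding t_def using duals[of X] by (intro someI_ex[of "\<lambda>(D, ev, coev). is_dual C X D ev coev"]) auto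
  then have d: "is_dual C X D e c" by (simp add: t)
  define e' where "e' = mk (D \<otimes>\<^sub>o X) \<I> e"
  define c' where "c' = mk \<I> (X \<otimes>\<^sub>o D) c"
  have em: "e \<in> mor C (D \<otimes>\<^sub>o X) \<I>" and cm: "c \<in> mor C \<I> (X \<otimes>\<^sub>o D)"
    and z: "runitor C X \<bullet> (idm C X \<otimes>\<^sub>m e) \<bullet> associator C X D X \<bullet> (c \<otimes>\<^sub>m idm C X) = lunitor C X"
    using d by (auto simp: is_dual_def)
  have e': "ar e'" "dm e' = D \<otimes>\<^sub>o X" "cd e' = \<I>" and c': "ar c'" "dm c' = \<I>" "cd c' = X \<otimes>\<^sub>o D"
    using em cm by (simp_all add: e'_def c'_def)
  have m1: "c \<otimes>\<^sub>m idm C X \<in> mor C (\<I> \<otimes>\<^sub>o X) ((X \<otimes>\<^sub>o D) \<otimes>\<^sub>o X)" using cm by (simp add: tens_in idm_in)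
  have m2: "associator C X D X \<bullet> (c \<otimes>\<^sub>m idm C X) \<in> mor C (\<I> \<otimes>\<^sub>o X) (X \<otimes>\<^sub>o (D \<otimes>\<^sub>o X))"
    using cmp_in[OF m1 inverse_arrow(1)[OF associator_iso]] .
  have m3: "(idm C X \<otimes>\<^sub>m e) \<bullet> associator C X D X \<bullet> (c \<otimes>\<^sub>m idm C X) \<in> mor C (\<I> \<otimes>\<^sub>o X) (X \<otimes>\<^sub>o \<I>)"
    using cmp_in[OF m2 tens_in[OF idm_in em]] .
  have "RU X \<star> (X \<triangleright> e') \<star> AS X D X \<star> (c' \<triangleleft> X) = LU X"
    using em cm m1 m2 m3 inverse_arrow(1)[OF associator_iso] inverse_arrow(1)[OF runitor_iso]
    by (simp add: RU_def LU_def AS_def e'_def c'_def ID_def idm_in tens_in z)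
  note T = trace_structure_dual[OF e' c' this]
  have "TR F = e' \<star> BR X D \<star> (F \<triangleleft> D) \<star> c'" if "ar F" "dm F = X" "cd F = X" for F
  proof -
    have fm: "mp F \<in> mor C X X" using that ar_mp by metis
    have n1: "(mp F \<otimes>\<^sub>m idm C D) \<bullet> c \<in> mor C \<I> (X \<otimes>\<^sub>o D)"
      using cmp_in[OF cm tens_in[OF fm idm_in]] .
    have n2: "braiding C X D \<bullet> (mp F \<otimes>\<^sub>m idm C D) \<bullet> c \<in> mor C \<I> (D \<otimes>\<^sub>o X)"
      using cmp_in[OF n1 braiding_in] .
    have "F = mk X X (mp F)" using mk_mp[OF that(1)] that by simp
    then have "e' \<star> BR X D \<star> (F \<triangleleft> D) \<star> c' = mk \<I> \<I> (e \<bullet> braiding C X D \<bullet> (mp F \<otimes>\<^sub>m idm C D) \<bullet> c)"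
      using em cm fm n1 n2 braiding_in idm_in
      by (metis (no_types, lifting) BR_def ID_def c'_def cp_mk e'_def tens_in tn_mk)
    then show ?thesis using that by (simp add: TR_def trace_def t_def[symmetric] t)
  qed
  then have "\<forall>F. ar F \<longrightarrow> dm F = X \<longrightarrow> cd F = X \<longrightarrow> TR F = partial_trace D (dual_ev X D e') (\<lambda>W. SW X D W \<star> dual_cv X D c' W) \<I> \<I> (F \<triangleleft> \<I>)"
    using loop_dual[OF e' c'] by simp
  with T show ?thesis by blast
qed

text \<open>Cyclicity of loops for F and the identity of X, with two different trace structures on
  X, shows that every dual gives the same value.\<close>

lemma TR_eq: assumes "trace_structure X D ev et" "ar F" "dm F = X" "cd F = X"
  shows "TR F = partial_trace D ev et \<I> \<I> (F \<triangleleft> \<I>)"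
proof -
  obtain D' ev' et' where T': "trace_structure X D' ev' et'" "TR F = partial_trace D' ev' et' \<I> \<I> (F \<triangleleft> \<I>)"
    using TR_exists[of X] assms by metis
  show ?thesis using loop_cyclic[OF T'(1) assms(1), of F "ID X" \<I>] assms T'(2) by simp
qed

lemma TR_simps [simp]: assumes "ar F" "dm F = cd F" shows "ar (TR F)" "dm (TR F) = \<I>" "cd (TR F) = \<I>"
proof -
  obtain D ev et where T: "trace_structure (cd F) D ev et" "TR F = partial_trace D ev et \<I> \<I> (F \<triangleleft> \<I>)" using TR_exists assms by metis
  then show "ar (TR F)" "dm (TR F) = \<I>" "cd (TR F) = \<I>" using partial_trace_simps[OF T(1), of "F \<triangleleft> \<I>" \<I> \<I>] assms by auto
qed

lemma TR_cyclic: assumes "ar f" "ar g" "dm f = cd g" "dm g = cd f" shows "TR (f \<star> g) = TR (g \<star> f)"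
proof -
  obtain D ev et where T: "trace_structure (cd f) D ev et" using TR_exists by metis
  obtain D' ev' et' where T': "trace_structure (cd g) D' ev' et'" using TR_exists by metis
  show ?thesis using loop_cyclic[OF T T', of f g \<I>] TR_eq[OF T] TR_eq[OF T'] assms by simp
qed

text \<open>With the product dual, the loop over X \<otimes> Y is an iterated loop. The additional
  factor \<I> at the right end is shed by \<open>RU_kelly\<close> and naturality of
  \<open>RU\<close>.\<close>

lemma TR_pt: assumes T: "trace_structure X D ev et" and F: "ar F" "dm F = X \<otimes>\<^sub>o Y" "cd F = X \<otimes>\<^sub>o Y"
  shows "TR F = TR (partial_trace D ev et Y Y F)"
proof -
  obtain D' ev' et' where T': "trace_structure Y D' ev' et'" using TR_exists by metis
  note [simp] = evt[OF T] evt[OF T'] partial_trace_simps[OF T] partial_trace_simps[OF T'] F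
  have AS: "AS X Y \<I> = (X \<triangleright> RI Y) \<star> RU (X \<otimes>\<^sub>o Y)"
    by (simp add: RU_kelly flip: cp_assoc whl_cp)
  have AI: "RU (X \<otimes>\<^sub>o Y) \<star> AI X Y \<I> = X \<triangleright> RU Y"
    by (simp add: RU_kelly cp_assoc)
  have RU: "RI Y \<star> h \<star> RU Y = h \<triangleleft> \<I>" if "ar h" "dm h = Y" "cd h = Y" for h
    using that RU_nat[of h Y] by (metis RI_RU ID_cp ar_tn cd_tn ID_simps(1,3) cp_assoc)
  have "AS X Y \<I> \<star> (F \<triangleleft> \<I>) \<star> AI X Y \<I> = (X \<triangleright> RI Y) \<star> (RU (X \<otimes>\<^sub>o Y) \<star> (F \<triangleleft> \<I>)) \<star> AI X Y \<I>"
    by (simp add: AS cp_assoc)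
  also have "\<dots> = (X \<triangleright> RI Y) \<star> F \<star> RU (X \<otimes>\<^sub>o Y) \<star> AI X Y \<I>"
    by (simp add: RU_nat cp_assoc)
  finally have "AS X Y \<I> \<star> (F \<triangleleft> \<I>) \<star> AI X Y \<I> = (X \<triangleright> RI Y) \<star> F \<star> (X \<triangleright> RU Y)" by (simp only: AI)
  then show ?thesis
    using TR_eq[OF trace_structure_prod[OF T T'], of F] TR_eq[OF T', of "partial_trace D ev et Y Y F"]
    by (simp add: partial_trace_prod[OF T T'] partial_trace_pre[OF T] partial_trace_post[OF T] RU)
qed

text \<open>Tracing over X leaves g composed with a closed loop of f. The loop is natural in the
  spectator object, so it slides past Y until it sits on \<I> and has become a scalar.\<close>

lemma TR_tn: assumes "ar f" "dm f = X" "cd f = X" "ar g" "dm g = Y" "cd g = Y"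
  shows "TR (f \<boxtimes> g) = TR g \<star> TR f"
proof -
  obtain D ev et where T: "trace_structure X D ev et" using TR_exists by metis
  obtain D' ev' et' where T': "trace_structure Y D' ev' et'" using TR_exists by metis
  note [simp] = evt[OF T] evt[OF T'] partial_trace_simps[OF T] partial_trace_simps[OF T'] assms
  let ?l = "\<lambda>W. partial_trace D ev et W W (f \<triangleleft> W)"
  have "TR (f \<boxtimes> g) = TR (g \<star> ?l Y)"
    using TR_pt[OF T, of "f \<boxtimes> g" Y] tn_split2[of f g] by (simp add: partial_trace_post[OF T])
  also have "\<dots> = partial_trace D' ev' et' \<I> \<I> ((g \<triangleleft> \<I>) \<star> (?l Y \<triangleleft> \<I>))"
    by (subst TR_eq[OF T']) simp_all
  also have "?l Y \<triangleleft> \<I> = ?l (Y \<otimes>\<^sub>o \<I>)"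
  proof -
    have "RU Y \<star> (?l Y \<triangleleft> \<I>) = RU Y \<star> ?l (Y \<otimes>\<^sub>o \<I>)"
      using RU_nat[of "?l Y" Y] loop_nat[OF T, of f "RU Y"] by simp
    then have "RI Y \<star> RU Y \<star> (?l Y \<triangleleft> \<I>) = RI Y \<star> RU Y \<star> ?l (Y \<otimes>\<^sub>o \<I>)" by simp
    then show ?thesis by (simp add: tail[OF RI_RU])
  qed
  also have "?l (Y \<otimes>\<^sub>o \<I>) = Y \<triangleright> ?l \<I>" by (simp add: loop_slide[OF T])
  also have "partial_trace D' ev' et' \<I> \<I> ((g \<triangleleft> \<I>) \<star> (Y \<triangleright> ?l \<I>)) = partial_trace D' ev' et' \<I> \<I> (g \<triangleleft> \<I>) \<star> ?l \<I>"
    by (simp add: partial_trace_pre[OF T'])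
  finally show ?thesis by (simp add: TR_eq[OF T] TR_eq[OF T'])
qed

lemma TR_swap: assumes "ar f" "dm f = X" "cd f = X" "ar G" "dm G = X \<otimes>\<^sub>o W" "cd G = X \<otimes>\<^sub>o W"
  shows "TR (SW X X W \<star> (f \<boxtimes> G)) = TR ((f \<triangleleft> W) \<star> G)"
proof -
  obtain D ev et where T: "trace_structure X D ev et" using TR_exists by metis
  show ?thesis using TR_pt[OF T, of "SW X X W \<star> (f \<boxtimes> G)" "X \<otimes>\<^sub>o W"] assms by (simp add: partial_trace_swap[OF T])
qed

lemma TR_unit: "TR (ID \<I>) = ID \<I>"
  by (subst TR_eq[OF trace_structure_unit]) (simp_all add: partial_trace_def cp_assoc tail[OF LU_LI])

end

lemma obtain_Suc_Suc: "Suc j < n \<Longrightarrow> (\<And>m. n = Suc (Suc m) \<Longrightarrow> thesis) \<Longrightarrow> thesis"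
  using less_imp_Suc_add[of "Suc j" n] by auto

context Q_linear_tensor_category
begin

section \<open>The action of the symmetric group\<close>

text \<open>Indexed by the number n of all factors, while \<open>swap_mor\<close> counts the factors
  beyond two; meaningful for \<open>Suc j < n\<close>.\<close>

definition swp where "swp X n j = mk (tpow C X n) (tpow C X n) (swap_mor C X (n - 2) j)"

lemma swap_mor_0: "swap_mor C X n 0 = mp (SW X X (tpow C X n))"
proof -
  note a = inverse_arrow(1,2)[OF associator_iso, of X X "tpow C X n"]
  have b: "braiding C X X \<otimes>\<^sub>m idm C (tpow C X n) \<in> mor C ((X \<otimes>\<^sub>o X) \<otimes>\<^sub>o tpow C X n) ((X \<otimes>\<^sub>o X) \<otimes>\<^sub>o tpow C X n)"
    by (intro tens_in braiding_in idm_in)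
  show ?thesis using a b cmp_in[OF a(2) b] cmp_in[OF cmp_in[OF a(2) b] a(1)]
    by (simp add: SW_def AS_def AI_def BR_def ID_def braiding_in idm_in)
qed

lemma swap_mor_in: "j \<le> n \<Longrightarrow> swap_mor C X n j \<in> mor C (tpow C X (Suc (Suc n))) (tpow C X (Suc (Suc n)))"
proof (induction j arbitrary: n)
  case 0
  then show ?case using ar_mp[of "SW X X (tpow C X n)"] by (simp add: swap_mor_0 del: swap_mor.simps)
next
  case (Suc j)
  then obtain m where "n = Suc m" by (cases n) auto
  with Suc show ?case by (auto intro: tens_in idm_in)
qed

lemma swp_simps [simp]: "Suc j < n \<Longrightarrow> ar (swp X n j)" "Suc j < n \<Longrightarrow> dm (swp X n j) = tpow C X n" "Suc j < n \<Longrightarrow> cd (swp X n j) = tpow C X n"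
proof -
  have "swap_mor C X (n - 2) j \<in> mor C (tpow C X n) (tpow C X n)" if j: "Suc j < n"
  proof -
    obtain m where "n = Suc (Suc m)" using j by (rule obtain_Suc_Suc)
    then show ?thesis using swap_mor_in[of j m] j by simp
  qed
  then show "Suc j < n \<Longrightarrow> ar (swp X n j)" "Suc j < n \<Longrightarrow> dm (swp X n j) = tpow C X n" "Suc j < n \<Longrightarrow> cd (swp X n j) = tpow C X n"
    by (simp_all add: swp_def)
qed

lemma swp_0: "swp X (Suc (Suc n)) 0 = SW X X (tpow C X n)"
  using mk_mp[of "SW X X (tpow C X n)"] by (simp add: swp_def swap_mor_0 del: swap_mor.simps)

lemma swp_Suc: assumes "Suc j < n" shows "swp X (Suc n) (Suc j) = X \<triangleright> swp X n j"
proof -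
  obtain m where n: "n = Suc (Suc m)" using assms by (rule obtain_Suc_Suc)
  then show ?thesis using swap_mor_in[of j m X] assms by (simp add: swp_def ID_def idm_in)
qed

text \<open>This and the next two are the Coxeter relations. Induction on j strips common factors X,
  and at the front they are the symmetry, naturality and the Yang-Baxter equation of
  \<open>SW\<close>.\<close>

lemma swp_inv: "Suc j < n \<Longrightarrow> swp X n j \<star> swp X n j = ID (tpow C X n)"
proof (induction j arbitrary: n)
  case 0
  then obtain m where "n = Suc (Suc m)" by (rule obtain_Suc_Suc)
  then show ?case by (simp add: swp_0)
next
  case (Suc j)
  then obtain m where "n = Suc m" by (cases n) auto
  with Suc show ?case by (simp add: swp_Suc flip: whl_cp)
qed

lemma swp_comm: "Suc j < k \<Longrightarrow> Suc k < n \<Longrightarrow> swp X n j \<star> swp X n k = swp X n k \<star> swp X n j"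
proof (induction j arbitrary: n k)
  case 0
  obtain l where k: "k = Suc (Suc l)" using 0(1) by (rule obtain_Suc_Suc)
  obtain m where n: "n = Suc (Suc m)" using 0(2) by (rule obtain_Suc_Suc)
  note n = n k
  have "swp X n k = X \<triangleright> (X \<triangleright> swp X m l)" using n 0 by (simp add: swp_Suc)
  with n 0 show ?case by (simp add: swp_0 SW_nat3)
next
  case (Suc j)
  then obtain m l where "n = Suc m" "k = Suc l" by (cases n; cases k) auto
  with Suc show ?case by (simp add: swp_Suc flip: whl_cp)
qed

lemma swp_braid: "Suc (Suc j) < n \<Longrightarrow> swp X n j \<star> swp X n (Suc j) \<star> swp X n j = swp X n (Suc j) \<star> swp X n j \<star> swp X n (Suc j)"
proof (induction j arbitrary: n)
  case 0
  then obtain m where n: "n = Suc (Suc (Suc m))" using less_imp_Suc_add[of "Suc (Suc 0)" n] by auto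
  then show ?case using SW_yang_baxter[of X X X "tpow C X m"] swp_0[of X "Suc m"] by (simp add: swp_0 swp_Suc)
next
  case (Suc j)
  then obtain m where "n = Suc m" by (cases n) auto
  with Suc show ?case by (simp add: swp_Suc flip: whl_cp)
qed

text \<open>
  \<open>cycle_arrow X n p\<close> moves the tensor factor \<open>0\<close> to place \<open>p\<close>. \<open>perm_arrow\<close> gives an explicit normal form of the action,
  which shows that \<open>perm_graph\<close> is single-valued.
\<close>

primrec cycle_arrow where
  "cycle_arrow X n 0 = ID (tpow C X n)"
| "cycle_arrow X n (Suc p) = swp X n p \<star> cycle_arrow X n p"

lemma cycle_arrow_simps [simp]: "p < n \<Longrightarrow> ar (cycle_arrow X n p)" "p < n \<Longrightarrow> dm (cycle_arrow X n p) = tpow C X n" "p < n \<Longrightarrow> cd (cycle_arrow X n p) = tpow C X n"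
  by (induction p) auto

lemma swp_cyc_same: "Suc k < n \<Longrightarrow> swp X n k \<star> cycle_arrow X n (Suc k) = cycle_arrow X n k"
  by (simp add: tail[OF swp_inv])

lemma swp_cyc_gt: "p < k \<Longrightarrow> Suc k < n \<Longrightarrow> swp X n k \<star> cycle_arrow X n p = cycle_arrow X n p \<star> swp X n k"
proof (induction p)
  case (Suc p)
  then show ?case by (simp add: tail[OF swp_comm[symmetric]] cp_assoc)
qed auto

text \<open>The cycle moves the factors 1, ..., p one place forward, so a generator within this
  range is shifted by one when it passes. At p = k + 1 the step is the braid relation, afterwards
  the generators commute.\<close>

lemma swp_cyc_lt: "Suc k < p \<Longrightarrow> p < n \<Longrightarrow> swp X n k \<star> cycle_arrow X n p = cycle_arrow X n p \<star> swp X n (Suc k)"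
proof (induction p)
  case (Suc p)
  show ?case
  proof (cases "p = Suc k")
    case True
    with Suc.prems have "swp X n k \<star> cycle_arrow X n (Suc p) = (swp X n k \<star> swp X n (Suc k) \<star> swp X n k) \<star> cycle_arrow X n k"
      by (simp add: cp_assoc)
    also have "\<dots> = swp X n (Suc k) \<star> swp X n k \<star> swp X n (Suc k) \<star> cycle_arrow X n k"
      using Suc.prems True by (simp add: swp_braid cp_assoc)
    finally show ?thesis using Suc.prems True by (simp add: swp_cyc_gt cp_assoc)
  next
    case False
    with Suc have "Suc k < p" by simp
    with Suc show ?thesis by (simp add: tail[OF swp_comm] cp_assoc)
  qed
qed auto

primrec perm_arrow where
  "perm_arrow X 0 s = ID \<I>"
| "perm_arrow X (Suc n) s = cycle_arrow X (Suc n) (s 0) \<star> (X \<triangleright> perm_arrow X n (red_perm s))"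

lemma perm_arrow_simps: "s permutes {..<n} \<Longrightarrow> ar (perm_arrow X n s) \<and> dm (perm_arrow X n s) = tpow C X n \<and> cd (perm_arrow X n s) = tpow C X n"
proof (induction n arbitrary: s)
  case (Suc n)
  have "s 0 < Suc n" using permutes_in_image[OF Suc.prems, of 0] by simp
  then show ?case using Suc.IH[OF red_perm_permutes[OF Suc.prems]] by simp
qed simp

lemma perm_arrow_ident: "perm_arrow X n (\<lambda>i. i) = ID (tpow C X n)"
proof (induction n)
  case (Suc n)
  have "red_perm (\<lambda>i. i) = (\<lambda>i. i)" by (auto simp: red_perm_def)
  with Suc show ?case by simp
qed simp

lemma perm_arrow_id: "perm_arrow X n id = ID (tpow C X n)"
  unfolding id_def by (rule perm_arrow_ident)

text \<open>Follows the cases of \<open>red_transpose\<close>: for k = s 0 the generator lengthens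
  the cycle, for k + 1 = s 0 it cancels the last generator of the cycle, and otherwise it passes
  through and acts on the reduced permutation.\<close>

lemma perm_arrow_step: "s permutes {..<n} \<Longrightarrow> Suc k < n \<Longrightarrow> perm_arrow X n (transpose k (Suc k) \<circ> s) = swp X n k \<star> perm_arrow X n s"
proof (induction n arbitrary: s k)
  case (Suc n)
  have s0: "s 0 < Suc n" using permutes_in_image[OF Suc.prems(1), of 0] by simp
  note r = red_perm_permutes[OF Suc.prems(1)]
  note [simp] = perm_arrow_simps[OF r]
  note t = red_transpose[OF Suc.prems(1), of k]
  consider "k = s 0" | "Suc k = s 0" | "s 0 < k" | "Suc k < s 0" by linarith
  then show ?case
  proof cases
    case 1
    then show ?thesis using t[unfolded comp_def] Suc.prems by (simp add: cp_assoc)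
  next
    case 2
    then have "swp X (Suc n) k \<star> cycle_arrow X (Suc n) (s 0) = cycle_arrow X (Suc n) k" using swp_cyc_same[of k "Suc n" X] s0 by simp
    with 2 show ?thesis using t(1) s0 by (simp add: comp_def flip: cp_assoc)
  next
    case 3
    then obtain l where l: "k = Suc l" by (cases k) auto
    have "perm_arrow X n (red_perm (transpose k (Suc k) \<circ> s)) = swp X n l \<star> perm_arrow X n (red_perm s)"
      using Suc.IH[OF r, of l] t(2)[OF 3] l Suc.prems(2) by (simp add: comp_def)
    with 3 l s0 Suc.prems(2) show ?thesis
      using tail[OF swp_cyc_gt[of "s 0" k "Suc n" X]] by (simp add: swp_Suc cp_assoc transpose_def comp_def)
  next
    case 4
    have "perm_arrow X n (red_perm (transpose k (Suc k) \<circ> s)) = swp X n k \<star> perm_arrow X n (red_perm s)"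
      using Suc.IH[OF r, of k] t(3)[OF 4] 4 s0 by (simp add: comp_def)
    with 4 s0 Suc.prems(2) show ?thesis
      using tail[OF swp_cyc_lt[of k "s 0" "Suc n" X]] by (simp add: swp_Suc cp_assoc transpose_def comp_def)
  qed
qed simp

lemma perm_graph_perm_arrow: "perm_graph C X n s f \<Longrightarrow> s permutes {..<n} \<and> f \<in> mor C (tpow C X n) (tpow C X n) \<and>
   mk (tpow C X n) (tpow C X n) f = perm_arrow X n s"
proof (induction rule: perm_graph.induct)
  case perm_graph_id
  then show ?case using permutes_id[of "{..<n}"] by (simp add: perm_arrow_ident ID_def idm_in id_def)
next
  case (perm_graph_step s f j)
  have m: "swap_mor C X (n - 2) j \<in> mor C (tpow C X n) (tpow C X n)"
    using perm_graph_step.hyps(2) swp_simps(1)[of j n X] by (simp add: swp_def)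
  have "swp X n j \<star> mk (tpow C X n) (tpow C X n) f = mk (tpow C X n) (tpow C X n) (swap_mor C X (n - 2) j \<bullet> f)"
    unfolding swp_def using perm_graph_step.IH by (intro cp_mk m) simp
  then show ?case using perm_graph_step m cmp_in[OF _ m] permutes_compose[OF _ transpose_permutes[OF perm_graph_step.hyps(2)], of s] perm_arrow_step[of s n j X] by (auto simp: comp_def)
qed

lemma adj_gen_perm_graph: "adj_gen n s \<Longrightarrow> \<exists>f. perm_graph C X n s f"
  by (induction rule: adj_gen.induct) (blast intro: perm_graph.intros)+

text \<open>The description in \<open>perm_mor_def\<close> denotes: \<open>adj_gen\<close> supplies
  a value, and any value is the normal form \<open>perm_arrow\<close>, hence unique.\<close>

lemma perm_mor: assumes "s permutes {..<n}"
  shows "perm_mor C X n s \<in> mor C (tpow C X n) (tpow C X n)" "mk (tpow C X n) (tpow C X n) (perm_mor C X n s) = perm_arrow X n s"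
proof -
  obtain f where f: "perm_graph C X n s f" using adj_gen_perm_graph[OF permutes_adj_gen[OF assms]] by blast
  have "g = f" if "perm_graph C X n s g" for g
    using perm_graph_perm_arrow[OF that] perm_graph_perm_arrow[OF f] mk_eqD by metis
  with f have "perm_mor C X n s = f" unfolding perm_mor_def by blast
  then show "perm_mor C X n s \<in> mor C (tpow C X n) (tpow C X n)" "mk (tpow C X n) (tpow C X n) (perm_mor C X n s) = perm_arrow X n s"
    using perm_graph_perm_arrow[OF f] by auto
qed

lemma perm_arrow_comp: assumes "s permutes {..<n}" "s' permutes {..<n}" shows "perm_arrow X n (s \<circ> s') = perm_arrow X n s \<star> perm_arrow X n s'"
  using permutes_adj_gen[OF assms(1)] assms(2)
proof (induction rule: adj_gen.induct)
  case adj_id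
  then show ?case using perm_arrow_simps[OF adj_id] by (simp add: perm_arrow_ident)
next
  case (adj_step s j)
  have "perm_arrow X n (transpose j (Suc j) \<circ> s \<circ> s') = swp X n j \<star> perm_arrow X n (s \<circ> s')"
    using adj_step perm_arrow_step[of "s \<circ> s'" n j] permutes_compose[OF adj_step.prems adj_gen_permutes[OF adj_step.hyps(1)]]
    by (simp add: comp_def)
  then show ?case using adj_step perm_arrow_step[of s n j] adj_gen_permutes[OF adj_step.hyps(1)] by (simp add: cp_assoc comp_def)
qed

lemma perm_arrow_swp: "Suc j < n \<Longrightarrow> perm_arrow X n (transpose j (Suc j)) = swp X n j"
  using perm_arrow_step[OF permutes_id, of j n X] by (simp add: perm_arrow_id)

lemma perm_arrow_lift: "perm_arrow X (Suc n) (lift_perm p s) = cycle_arrow X (Suc n) p \<star> (X \<triangleright> perm_arrow X n s)"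
  by simp

end

section \<open>Sums over permutations\<close>

abbreviation "perms n \<equiv> {\<sigma>. \<sigma> permutes {..<n::nat}}"

lemma perms_Suc: "perms (Suc n) = (\<Union>p\<in>{..n}. lift_perm p ` perms n)"
proof (intro equalityI subsetI)
  fix s assume s: "s \<in> perms (Suc n)"
  have "s 0 \<le> n" using permutes_in_image[of s "{..<Suc n}" 0] s by simp
  then show "s \<in> (\<Union>p\<in>{..n}. lift_perm p ` perms n)"
    using s red_perm_permutes[of s n] lift_red[of s "Suc n"] by (auto intro!: bexI[of _ "s 0"] image_eqI[of _ _ "red_perm s"])
qed (auto intro: lift_perm_permutes)

text \<open>The counterpart of expanding a determinant along its first column: the sets
  \<open>lift_perm p\<close> applied to \<open>perms n\<close> partition the permutations by the
  image p of 0.\<close>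

lemma finsum_perms_Suc:
  assumes "abelian_monoid R" "\<And>s. s \<in> perms (Suc n) \<Longrightarrow> h s \<in> carrier R"
  shows "(\<Oplus>\<^bsub>R\<^esub>s\<in>perms (Suc n). h s) = (\<Oplus>\<^bsub>R\<^esub>p\<in>{..n}. \<Oplus>\<^bsub>R\<^esub>s\<in>perms n. h (lift_perm p s))"
proof -
  interpret abelian_monoid R by fact
  have inj: "inj_on (lift_perm p) (perms n)" for p by (rule inj_on_inverseI[of _ red_perm]) simp
  have d: "pairwise (\<lambda>i j. disjnt (lift_perm i ` perms n) (lift_perm j ` perms n)) {..n}"
    by (auto simp: pairwise_def disjnt_def) (metis lift_perm_simps(1))
  have "(\<Oplus>\<^bsub>R\<^esub>s\<in>perms (Suc n). h s) = (\<Oplus>\<^bsub>R\<^esub>p\<in>{..n}. \<Oplus>\<^bsub>R\<^esub>s\<in>lift_perm p ` perms n. h s)"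
    unfolding perms_Suc
    by (rule add.finprod_UN_disjoint) (use d assms(2) in \<open>auto simp: finite_permutations lift_perm_permutes\<close>)
  also have "\<dots> = (\<Oplus>\<^bsub>R\<^esub>p\<in>{..n}. \<Oplus>\<^bsub>R\<^esub>s\<in>perms n. h (lift_perm p s))"
    by (intro finsum_cong' refl finsum_reindex inj) 
       (use assms(2) in \<open>auto intro!: finsum_closed simp: lift_perm_permutes Pi_def\<close>)
  finally show ?thesis .
qed

lemma finsum_perms_right:
  assumes "abelian_monoid R" "\<And>s. s \<in> perms n \<Longrightarrow> h s \<in> carrier R" "t permutes {..<n}"
  shows "(\<Oplus>\<^bsub>R\<^esub>s\<in>perms n. h (s \<circ> t)) = (\<Oplus>\<^bsub>R\<^esub>s\<in>perms n. h s)"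
proof -
  interpret abelian_monoid R by fact
  have "(\<lambda>s. s \<circ> t) ` perms n = perms n"
  proof (intro equalityI subsetI)
    fix s assume "s \<in> perms n"
    then have "s = (s \<circ> inv_into UNIV t) \<circ> t" "s \<circ> inv_into UNIV t \<in> perms n"
      using permutes_compose[OF permutes_inv[OF assms(3)], of s] permutes_inv_o(2)[OF assms(3)] by (auto simp: comp_assoc)
    then show "s \<in> (\<lambda>s. s \<circ> t) ` perms n" by blast
  qed (auto intro: permutes_compose assms(3))
  moreover have "inj_on (\<lambda>s. s \<circ> t) (perms n)"
    by (rule inj_on_inverseI[of _ "\<lambda>s. s \<circ> inv_into UNIV t"]) (simp add: comp_assoc permutes_inv_o(1)[OF assms(3)])
  ultimately show ?thesis using finsum_reindex[of h "\<lambda>s. s \<circ> t" "perms n"] assms(2) by (auto simp: Pi_def)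
qed

section \<open>Rational multiples of morphisms and endomorphism rings\<close>

context Q_linear_category
begin

lemma smult_in [simp]: "x \<in> mor C X Y \<Longrightarrow> q \<odot>\<^bsub>hom_mod C X Y\<^esub> x \<in> mor C X Y"
  and smult_l_distr: "x \<in> mor C X Y \<Longrightarrow> (p + q) \<odot>\<^bsub>hom_mod C X Y\<^esub> x = (p \<odot>\<^bsub>hom_mod C X Y\<^esub> x) \<oplus>\<^bsub>hom_mod C X Y\<^esub> (q \<odot>\<^bsub>hom_mod C X Y\<^esub> x)"
  and smult_r_distr: "x \<in> mor C X Y \<Longrightarrow> y \<in> mor C X Y \<Longrightarrow> q \<odot>\<^bsub>hom_mod C X Y\<^esub> (x \<oplus>\<^bsub>hom_mod C X Y\<^esub> y) = (q \<odot>\<^bsub>hom_mod C X Y\<^esub> x) \<oplus>\<^bsub>hom_mod C X Y\<^esub> (q \<odot>\<^bsub>hom_mod C X Y\<^esub> y)"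
  and smult_assoc: "x \<in> mor C X Y \<Longrightarrow> (p * q) \<odot>\<^bsub>hom_mod C X Y\<^esub> x = p \<odot>\<^bsub>hom_mod C X Y\<^esub> (q \<odot>\<^bsub>hom_mod C X Y\<^esub> x)"
  and smult_1 [simp]: "x \<in> mor C X Y \<Longrightarrow> 1 \<odot>\<^bsub>hom_mod C X Y\<^esub> x = x"
  and smult_0: "x \<in> mor C X Y \<Longrightarrow> 0 \<odot>\<^bsub>hom_mod C X Y\<^esub> x = \<zero>\<^bsub>hom_mod C X Y\<^esub>"
  and smult_zero: "q \<odot>\<^bsub>hom_mod C X Y\<^esub> \<zero>\<^bsub>hom_mod C X Y\<^esub> = \<zero>\<^bsub>hom_mod C X Y\<^esub>"
  and hom_group: "abelian_group (hom_mod C X Y)"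
proof -
  interpret M: Module.module "type_ring :: rat ring" "hom_mod C X Y" by (rule hom_module)
  show "x \<in> mor C X Y \<Longrightarrow> q \<odot>\<^bsub>hom_mod C X Y\<^esub> x \<in> mor C X Y"
    "x \<in> mor C X Y \<Longrightarrow> (p + q) \<odot>\<^bsub>hom_mod C X Y\<^esub> x = (p \<odot>\<^bsub>hom_mod C X Y\<^esub> x) \<oplus>\<^bsub>hom_mod C X Y\<^esub> (q \<odot>\<^bsub>hom_mod C X Y\<^esub> x)"
    "x \<in> mor C X Y \<Longrightarrow> y \<in> mor C X Y \<Longrightarrow> q \<odot>\<^bsub>hom_mod C X Y\<^esub> (x \<oplus>\<^bsub>hom_mod C X Y\<^esub> y) = (q \<odot>\<^bsub>hom_mod C X Y\<^esub> x) \<oplus>\<^bsub>hom_mod C X Y\<^esub> (q \<odot>\<^bsub>hom_mod C X Y\<^esub> y)"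
    "x \<in> mor C X Y \<Longrightarrow> (p * q) \<odot>\<^bsub>hom_mod C X Y\<^esub> x = p \<odot>\<^bsub>hom_mod C X Y\<^esub> (q \<odot>\<^bsub>hom_mod C X Y\<^esub> x)"
    "x \<in> mor C X Y \<Longrightarrow> 1 \<odot>\<^bsub>hom_mod C X Y\<^esub> x = x"
    "x \<in> mor C X Y \<Longrightarrow> 0 \<odot>\<^bsub>hom_mod C X Y\<^esub> x = \<zero>\<^bsub>hom_mod C X Y\<^esub>"
    "q \<odot>\<^bsub>hom_mod C X Y\<^esub> \<zero>\<^bsub>hom_mod C X Y\<^esub> = \<zero>\<^bsub>hom_mod C X Y\<^esub>"
    using M.smult_closed[of q x] M.smult_l_distr[of p q x] M.smult_r_distr[of q x y] M.smult_assoc1[of p q x]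
      M.smult_one[of x] M.smult_l_null[of x] M.smult_r_null[of q] by simp_all
  show "abelian_group (hom_mod C X Y)" by (rule M.abelian_group_axioms)
qed

lemma smult_of_nat: assumes "x \<in> mor C X Y" shows "of_nat n \<odot>\<^bsub>hom_mod C X Y\<^esub> x = [n] \<cdot>\<^bsub>hom_mod C X Y\<^esub> x"
proof -
  interpret M: abelian_group "hom_mod C X Y" by (rule hom_group)
  show ?thesis using assms by (induction n) (simp_all add: smult_0 smult_l_distr M.a_comm M.add.nat_pow_Suc2)
qed

lemma smult_minus_1: assumes "x \<in> mor C X Y" shows "(-1) \<odot>\<^bsub>hom_mod C X Y\<^esub> x = \<ominus>\<^bsub>hom_mod C X Y\<^esub> x"
proof -
  interpret M: abelian_group "hom_mod C X Y" by (rule hom_group)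
  have "((-1) \<odot>\<^bsub>hom_mod C X Y\<^esub> x) \<oplus>\<^bsub>hom_mod C X Y\<^esub> x = \<zero>\<^bsub>hom_mod C X Y\<^esub>"
    using smult_l_distr[of x X Y "-1" 1] smult_0[OF assms] assms by simp
  then show ?thesis using assms by (simp add: M.minus_equality)
qed

lemma smult_of_int: assumes "x \<in> mor C X Y" shows "of_int k \<odot>\<^bsub>hom_mod C X Y\<^esub> x = [k] \<cdot>\<^bsub>hom_mod C X Y\<^esub> x"
proof (cases "k \<ge> 0")
  case True
  then have "of_int k = (of_nat (nat k) :: rat)" by simp
  with True show ?thesis by (simp only: smult_of_nat[OF assms] add_pow_int_ge)
next
  case False
  then have "of_int k = (-1) * (of_nat (nat (- k)) :: rat)" by simp
  then have "of_int k \<odot>\<^bsub>hom_mod C X Y\<^esub> x = \<ominus>\<^bsub>hom_mod C X Y\<^esub> ([nat (- k)] \<cdot>\<^bsub>hom_mod C X Y\<^esub> x)"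
    using assms by (simp only: smult_assoc smult_minus_1 smult_in smult_of_nat[symmetric])
  then show ?thesis using False by (simp only: add_pow_int_lt)
qed

lemma End_ring_simps [simp]: "carrier (End_ring C X) = mor C X X" "x \<otimes>\<^bsub>End_ring C X\<^esub> y = x \<bullet> y"
  "\<one>\<^bsub>End_ring C X\<^esub> = idm C X" "\<zero>\<^bsub>End_ring C X\<^esub> = \<zero>\<^bsub>hom_mod C X X\<^esub>" "x \<oplus>\<^bsub>End_ring C X\<^esub> y = x \<oplus>\<^bsub>hom_mod C X X\<^esub> y"
  by (simp_all add: End_ring_def)

lemma End_ring: "ring (End_ring C X)"
proof (rule ringI)
  interpret M: abelian_group "hom_mod C X X" by (rule hom_group)
  show "abelian_group (End_ring C X)"
    by (rule abelian_groupI) (auto simp: M.a_ac intro: M.l_neg M.a_inv_closed)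
  show "Group.monoid (End_ring C X)"
    by (rule monoidI) (auto simp: idm_in cmp_in idm_cmp cmp_idm cmp_assoc)
qed (auto simp: cmp_add_left cmp_add_right)

text \<open>\<open>hom_mod C X X\<close> and \<open>End_ring C X\<close> agree in carrier, zero and
  addition but are different records, so sums, multiples and negatives have to be translated between
  them.\<close>

lemma End_finsum: assumes "\<And>x. x \<in> A \<Longrightarrow> f x \<in> mor C X X"
  shows "finsum (hom_mod C X X) f A = finsum (End_ring C X) f A"
proof -
  interpret M: abelian_group "hom_mod C X X" by (rule hom_group)
  interpret R: ring "End_ring C X" by (rule End_ring)
  show ?thesis using assms
    by (induction A rule: infinite_finite_induct) (auto simp: M.finsum_infinite R.finsum_infinite Pi_def)
qed

lemma End_add_pow_nat: fixes n :: nat assumes "x \<in> mor C X X"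
  shows "[n] \<cdot>\<^bsub>hom_mod C X X\<^esub> x = [n] \<cdot>\<^bsub>End_ring C X\<^esub> x"
proof -
  interpret M: abelian_group "hom_mod C X X" by (rule hom_group)
  interpret R: ring "End_ring C X" by (rule End_ring)
  show ?thesis by (induction n) (simp_all add: assms)
qed

lemma End_a_inv: assumes "x \<in> mor C X X"
  shows "\<ominus>\<^bsub>hom_mod C X X\<^esub> x = \<ominus>\<^bsub>End_ring C X\<^esub> x"
proof -
  interpret M: abelian_group "hom_mod C X X" by (rule hom_group)
  interpret R: ring "End_ring C X" by (rule End_ring)
  show ?thesis using R.l_neg[of x] R.a_inv_closed[of x] assms by (intro M.minus_equality) auto
qed

lemma smult_nat_End: assumes "x \<in> mor C X X" shows "of_nat n \<odot>\<^bsub>hom_mod C X X\<^esub> x = [n] \<cdot>\<^bsub>End_ring C X\<^esub> x"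
  using assms by (simp add: smult_of_nat End_add_pow_nat)

lemma smult_int_End: assumes "x \<in> mor C X X" shows "of_int k \<odot>\<^bsub>hom_mod C X X\<^esub> x = [k] \<cdot>\<^bsub>End_ring C X\<^esub> x"
proof -
  interpret R: ring "End_ring C X" by (rule End_ring)
  have "[nat (- k)] \<cdot>\<^bsub>hom_mod C X X\<^esub> x \<in> mor C X X"
    using R.add.nat_pow_closed[of x "nat (- k)"] assms by (simp add: End_add_pow_nat)
  then show ?thesis using assms
    by (cases "k \<ge> 0") (auto simp: smult_of_int add_pow_int_ge add_pow_int_lt End_add_pow_nat End_a_inv)
qed

end

section \<open>The ring of scalars; powers and tensor powers of arrows\<close>

context Q_linear_tensor_category
begin

text \<open>The Eckmann-Hilton argument: since \<open>LU \<I> = RU \<I>\<close>, a may be viewed as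
  acting on the left and b on the right factor of \<I> \<otimes> \<I>, where they commute.\<close>

lemma unit_comm: assumes "ar a" "dm a = \<I>" "cd a = \<I>" "ar b" "dm b = \<I>" "cd b = \<I>" shows "a \<star> b = b \<star> a"
proof -
  have a: "a \<star> LU \<I> = LU \<I> \<star> (a \<triangleleft> \<I>)" using RU_nat[of a \<I>] assms by (simp add: LU_I)
  have b: "b \<star> LU \<I> = LU \<I> \<star> (\<I> \<triangleright> b)" using LU_nat[of b \<I>] assms by simp
  have "(a \<star> b) \<star> LU \<I> = LU \<I> \<star> (a \<triangleleft> \<I>) \<star> (\<I> \<triangleright> b)" by (simp add: cp_assoc b tail[OF a])
  also have "\<dots> = LU \<I> \<star> (\<I> \<triangleright> b) \<star> (a \<triangleleft> \<I>)" using assms by (simp add: exch)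
  also have "\<dots> = (b \<star> a) \<star> LU \<I>" by (simp add: cp_assoc a tail[OF b])
  finally show ?thesis by (rule right_cancel[OF _ LU_LI]) (use assms in simp_all)
qed

lemma scalars_cring: "cring (scalars C)"
proof -
  interpret ring "scalars C" by (rule End_ring)
  show ?thesis
  proof
    fix x y assume "x \<in> carrier (scalars C)" "y \<in> carrier (scalars C)"
    then show "x \<otimes>\<^bsub>scalars C\<^esub> y = y \<otimes>\<^bsub>scalars C\<^esub> x"
      using unit_comm[of "mk \<I> \<I> x" "mk \<I> \<I> y"] by (auto intro: mk_eqD[of _ \<I> \<I>] simp: cmp_in)
  qed
qed

lemma scalars_torsion_free: fixes n :: nat assumes "x \<in> carrier (scalars C)" "[n] \<cdot>\<^bsub>scalars C\<^esub> x = \<zero>\<^bsub>scalars C\<^esub>" "n > 0" shows "x = \<zero>\<^bsub>scalars C\<^esub>"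
proof -
  have "(1 / of_nat n) \<odot>\<^bsub>hom_mod C \<I> \<I>\<^esub> (of_nat n \<odot>\<^bsub>hom_mod C \<I> \<I>\<^esub> x) = x"
    using assms(1,3) by (simp flip: smult_assoc)
  moreover have "of_nat n \<odot>\<^bsub>hom_mod C \<I> \<I>\<^esub> x = \<zero>\<^bsub>hom_mod C \<I> \<I>\<^esub>"
    using assms by (simp add: smult_nat_End)
  ultimately show ?thesis by (simp add: smult_zero)
qed

primrec pwr where "pwr X f 0 = ID X" | "pwr X f (Suc m) = f \<star> pwr X f m"

lemma pwr_simps [simp]: assumes "ar f" "dm f = X" "cd f = X"
  shows "ar (pwr X f m)" "dm (pwr X f m) = X" "cd (pwr X f m) = X"
  by (induction m) (use assms in auto)

lemma pwr_add: assumes "ar f" "dm f = X" "cd f = X" shows "pwr X f (m + n) = pwr X f m \<star> pwr X f n"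
  by (induction m) (use assms in \<open>auto simp: cp_assoc\<close>)

lemma pwr_mult: assumes "ar f" "dm f = X" "cd f = X" shows "pwr X (pwr X f n) m = pwr X f (m * n)"
  by (induction m) (use assms in \<open>auto simp: pwr_add\<close>)

primrec tp where "tp f 0 = ID \<I>" | "tp f (Suc n) = f \<boxtimes> tp f n"

lemma tp_simps [simp]: assumes "ar f" "dm f = X" "cd f = X"
  shows "ar (tp f n)" "dm (tp f n) = tpow C X n" "cd (tp f n) = tpow C X n"
  by (induction n) (use assms in auto)

lemma tp_mk: assumes "f \<in> mor C X X"
  shows "tpow_mor C f n \<in> mor C (tpow C X n) (tpow C X n) \<and> tp (mk X X f) n = mk (tpow C X n) (tpow C X n) (tpow_mor C f n)"
  by (induction n) (use assms in \<open>auto simp: ID_def idm_in tens_in\<close>)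

lemma tp_swp: assumes "ar f" "dm f = X" "cd f = X" "Suc j < n"
  shows "swp X n j \<star> tp f n = tp f n \<star> swp X n j"
  using assms(4)
proof (induction j arbitrary: n)
  case 0
  then obtain m where n: "n = Suc (Suc m)" by (rule obtain_Suc_Suc)
  then show ?case using SW_nat[of f f "tp f m" X X] assms by (simp add: swp_0)
next
  case (Suc j)
  then obtain m where n: "n = Suc m" by (cases n) auto
  have "(X \<triangleright> swp X m j) \<star> (f \<boxtimes> tp f m) = (f \<boxtimes> tp f m) \<star> (X \<triangleright> swp X m j)"
    using assms(1-3) Suc n by (simp flip: interchange)
  then show ?case using Suc n by (simp add: swp_Suc)
qed

end

context rigid_karoubian_tensor_category
begin

declare End_ring_simps [simp del]

abbreviation "KR \<equiv> scalars C"

section \<open>Newton identities for exterior powers\<close>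

definition val where "val F = mp (TR F)"

lemma val_in [simp]: "ar F \<Longrightarrow> dm F = cd F \<Longrightarrow> val F \<in> carrier KR"
  using ar_mp[of "TR F"] by (simp add: val_def End_ring_simps)

lemma val_cyclic: "ar f \<Longrightarrow> ar g \<Longrightarrow> dm f = cd g \<Longrightarrow> dm g = cd f \<Longrightarrow> val (f \<star> g) = val (g \<star> f)"
  by (simp add: val_def TR_cyclic)

lemma val_tn: "ar f \<Longrightarrow> dm f = X \<Longrightarrow> cd f = X \<Longrightarrow> ar g \<Longrightarrow> dm g = Y \<Longrightarrow> cd g = Y \<Longrightarrow>
    val (f \<boxtimes> g) = val g \<otimes>\<^bsub>KR\<^esub> val f"
  using mp_cp[of "TR f" "TR g"] by (simp add: val_def TR_tn End_ring_simps)

lemma val_swap: "ar f \<Longrightarrow> dm f = X \<Longrightarrow> cd f = X \<Longrightarrow> ar G \<Longrightarrow> dm G = X \<otimes>\<^sub>o W \<Longrightarrow> cd G = X \<otimes>\<^sub>o W \<Longrightarrow>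
    val (SW X X W \<star> (f \<boxtimes> G)) = val (G \<star> (f \<triangleleft> W))"
  by (simp add: val_def TR_swap TR_cyclic[of "f \<triangleleft> W" G])

lemma val_unit: "val (ID \<I>) = \<one>\<^bsub>KR\<^esub>"
  by (simp add: val_def TR_unit End_ring_simps)

lemma trace_val: assumes "f \<in> mor C X X" shows "trace C X f = val (mk X X f)"
proof -
  have "ar (TR (mk X X f))" using assms by simp
  then show ?thesis using assms by (simp add: TR_def val_def)
qed

text \<open>
  The idea of the recursion: expand the alternating trace of \<open>f\<^sub>0 \<otimes> G\<close> over the image of the tensor factor \<open>0\<close>. If the
  factor is fixed, its trace splits off. Otherwise it is fused with another factor by taking the partial trace of a
  symmetry; all \<open>n\<close> places contribute equally, up to a sign that the antisymmetrization absorbs.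
\<close>

definition altsum where
  "altsum X n F = (\<Oplus>\<^bsub>KR\<^esub>s\<in>perms n. ring_of_int KR (sign s) \<otimes>\<^bsub>KR\<^esub> val (perm_arrow X n s \<star> F))"

lemma perm_arrow_ar [simp]: "s permutes {..<n} \<Longrightarrow> ar (perm_arrow X n s)" "s permutes {..<n} \<Longrightarrow> dm (perm_arrow X n s) = tpow C X n"
  "s permutes {..<n} \<Longrightarrow> cd (perm_arrow X n s) = tpow C X n"
  using perm_arrow_simps[of s n X] by auto

lemma altsum_in: assumes "ar G" "dm G = tpow C X n" "cd G = tpow C X n" shows "altsum X n G \<in> carrier KR"
proof -
  interpret R: cring KR by (rule scalars_cring)
  show ?thesis unfolding altsum_def by (rule R.finsum_closed) (use assms in \<open>auto simp: Pi_def\<close>)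
qed

context
  fixes X f0 G n
  assumes f0 [simp]: "ar f0" "dm f0 = X" "cd f0 = X" 
    and G [simp]: "ar G" "dm G = tpow C X n" "cd G = tpow C X n"
    and comm: "\<And>j. Suc j < n \<Longrightarrow> swp X n j \<star> G = G \<star> swp X n j"
begin

text \<open>The permutations that send 0 to p, weighted with the sign of the reduced permutation
  instead of their own; \<open>altsum_cycsum\<close> restores the missing (-1)^p.\<close>

definition cycsum where
  "cycsum p = (\<Oplus>\<^bsub>KR\<^esub>s\<in>perms n. ring_of_int KR (sign s) \<otimes>\<^bsub>KR\<^esub> val (cycle_arrow X (Suc n) p \<star> (X \<triangleright> perm_arrow X n s) \<star> (f0 \<boxtimes> G)))"

lemma cycsum_in: "p \<le> n \<Longrightarrow> cycsum p \<in> carrier KR"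
proof -
  interpret R: cring KR by (rule scalars_cring)
  show "p \<le> n \<Longrightarrow> cycsum p \<in> carrier KR"
    unfolding cycsum_def by (rule R.finsum_closed) (auto simp: Pi_def)
qed

lemma altsum_cycsum: "altsum X (Suc n) (f0 \<boxtimes> G) = (\<Oplus>\<^bsub>KR\<^esub>p\<in>{..n}. ring_of_int KR ((- 1) ^ p) \<otimes>\<^bsub>KR\<^esub> cycsum p)"
proof -
  interpret R: cring KR by (rule scalars_cring)
  have c [simp]: "s permutes {..<Suc n} \<Longrightarrow> val (perm_arrow X (Suc n) s \<star> (f0 \<boxtimes> G)) \<in> carrier KR" for s
    by (rule val_in) (simp_all del: perm_arrow.simps)
  have "altsum X (Suc n) (f0 \<boxtimes> G) = (\<Oplus>\<^bsub>KR\<^esub>p\<in>{..n}. \<Oplus>\<^bsub>KR\<^esub>s\<in>perms n.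
      R.em (sign (lift_perm p s)) \<otimes>\<^bsub>KR\<^esub> val (perm_arrow X (Suc n) (lift_perm p s) \<star> (f0 \<boxtimes> G)))"
    unfolding altsum_def by (rule finsum_perms_Suc[OF R.abelian_monoid_axioms]) (simp del: perm_arrow.simps)
  also have "\<dots> = (\<Oplus>\<^bsub>KR\<^esub>p\<in>{..n}. R.em ((- 1) ^ p) \<otimes>\<^bsub>KR\<^esub> cycsum p)"
  proof (rule R.finsum_cong')
    fix p assume p: "p \<in> {..n}"
    have v: "val (cycle_arrow X (Suc n) p \<star> (X \<triangleright> perm_arrow X n s) \<star> (f0 \<boxtimes> G)) \<in> carrier KR" if "s permutes {..<n}" for s
      using p that by simp
    have "R.em ((- 1) ^ p) \<otimes>\<^bsub>KR\<^esub> cycsum p = (\<Oplus>\<^bsub>KR\<^esub>s\<in>perms n. R.em ((- 1) ^ p) \<otimes>\<^bsub>KR\<^esub>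
        (R.em (sign s) \<otimes>\<^bsub>KR\<^esub> val (cycle_arrow X (Suc n) p \<star> (X \<triangleright> perm_arrow X n s) \<star> (f0 \<boxtimes> G))))"
      unfolding cycsum_def using v by (intro R.finsum_rdistr) (auto simp: finite_permutations)
    also have "\<dots> = (\<Oplus>\<^bsub>KR\<^esub>s\<in>perms n. R.em (sign (lift_perm p s)) \<otimes>\<^bsub>KR\<^esub> val (perm_arrow X (Suc n) (lift_perm p s) \<star> (f0 \<boxtimes> G)))"
      using p v lift_perm_permutes[of _ n p] 
      by (intro R.finsum_cong') (auto simp: sign_lift R.em_mult perm_arrow_lift R.m_assoc cp_assoc simp del: perm_arrow.simps)
    finally show "(\<Oplus>\<^bsub>KR\<^esub>s\<in>perms n. R.em (sign (lift_perm p s)) \<otimes>\<^bsub>KR\<^esub> val (perm_arrow X (Suc n) (lift_perm p s) \<star> (f0 \<boxtimes> G)))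
      = R.em ((- 1) ^ p) \<otimes>\<^bsub>KR\<^esub> cycsum p" by simp
  qed (auto simp: cycsum_in)
  finally show ?thesis .
qed

text \<open>The last generator of the cycle acts on the factors behind the first. Cyclicity of the
  trace brings it to the right end, it commutes with \<open>f0 \<boxtimes> G\<close>, and it is
  absorbed into s, which changes the sign and merely permutes the summation.\<close>

lemma cycsum_Suc: assumes "Suc (Suc l) \<le> n" shows "cycsum (Suc (Suc l)) = ring_of_int KR (- 1) \<otimes>\<^bsub>KR\<^esub> cycsum (Suc l)"
proof -
  interpret R: cring KR by (rule scalars_cring)
  let ?t = "transpose l (Suc l)"
  have l: "Suc l < n" using assms by simp
  have t: "?t permutes {..<n}" using transpose_permutes[OF l] .
  define h where "h s = R.em (- 1) \<otimes>\<^bsub>KR\<^esub> (R.em (sign s) \<otimes>\<^bsub>KR\<^esub> val (cycle_arrow X (Suc n) (Suc l) \<star> (X \<triangleright> perm_arrow X n s) \<star> (f0 \<boxtimes> G)))" for s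
  have v [simp]: "val (cycle_arrow X (Suc n) (Suc l) \<star> (X \<triangleright> perm_arrow X n s) \<star> (f0 \<boxtimes> G)) \<in> carrier KR" if "s permutes {..<n}" for s
    using that l by (simp del: cycle_arrow.simps)
  have step: "R.em (sign s) \<otimes>\<^bsub>KR\<^esub> val (cycle_arrow X (Suc n) (Suc (Suc l)) \<star> (X \<triangleright> perm_arrow X n s) \<star> (f0 \<boxtimes> G)) = h (s \<circ> ?t)"
    if s: "s permutes {..<n}" for s
  proof -
    have st: "s \<circ> ?t permutes {..<n}" using permutes_compose[OF t s] .
    have G': "(f0 \<boxtimes> G) \<star> (X \<triangleright> swp X n l) = (X \<triangleright> swp X n l) \<star> (f0 \<boxtimes> G)"
      using l by (simp add: comm flip: interchange)
    have P: "perm_arrow X n (s \<circ> ?t) = perm_arrow X n s \<star> swp X n l"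
      using perm_arrow_comp[OF s t] perm_arrow_swp[OF l] by simp
    have "val (cycle_arrow X (Suc n) (Suc (Suc l)) \<star> (X \<triangleright> perm_arrow X n s) \<star> (f0 \<boxtimes> G))
       = val ((X \<triangleright> swp X n l) \<star> (cycle_arrow X (Suc n) (Suc l) \<star> (X \<triangleright> perm_arrow X n s) \<star> (f0 \<boxtimes> G)))"
      using l by (simp add: swp_Suc cp_assoc)
    also have "\<dots> = val ((cycle_arrow X (Suc n) (Suc l) \<star> (X \<triangleright> perm_arrow X n s) \<star> (f0 \<boxtimes> G)) \<star> (X \<triangleright> swp X n l))"
      using l s by (intro val_cyclic) (simp_all del: cycle_arrow.simps)
    also have "\<dots> = val (cycle_arrow X (Suc n) (Suc l) \<star> (X \<triangleright> perm_arrow X n (s \<circ> ?t)) \<star> (f0 \<boxtimes> G))"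
      using l s by (simp add: cp_assoc G' P del: cycle_arrow.simps)
    finally have "val (cycle_arrow X (Suc n) (Suc (Suc l)) \<star> (X \<triangleright> perm_arrow X n s) \<star> (f0 \<boxtimes> G)) = \<dots>" .
    moreover have "R.em (sign s) = R.em (- 1) \<otimes>\<^bsub>KR\<^esub> R.em (sign (s \<circ> ?t))"
      using sign_adj_right[OF s, of l] by (simp flip: R.em_mult)
    ultimately show ?thesis using v[OF st] by (simp add: h_def R.m_assoc del: cycle_arrow.simps)
  qed
  have "cycsum (Suc (Suc l)) = (\<Oplus>\<^bsub>KR\<^esub>s\<in>perms n. h (s \<circ> ?t))"
    unfolding cycsum_def using step permutes_compose[OF t] v by (intro R.finsum_cong') (auto simp: h_def simp del: cycle_arrow.simps)
  also have "\<dots> = (\<Oplus>\<^bsub>KR\<^esub>s\<in>perms n. h s)"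
    by (rule finsum_perms_right[OF R.abelian_monoid_axioms _ t]) (simp add: h_def del: cycle_arrow.simps)
  also have "\<dots> = R.em (- 1) \<otimes>\<^bsub>KR\<^esub> cycsum (Suc l)"
    unfolding h_def cycsum_def by (rule R.finsum_rdistr[symmetric]) (auto simp: finite_permutations simp del: cycle_arrow.simps)
  finally show ?thesis .
qed

lemma cycsum_power: "Suc p \<le> n \<Longrightarrow> cycsum (Suc p) = ring_of_int KR ((- 1) ^ p) \<otimes>\<^bsub>KR\<^esub> cycsum (Suc 0)"
proof (induction p)
  case 0
  interpret R: cring KR by (rule scalars_cring)
  show ?case using cycsum_in[of "Suc 0"] 0 by simp
next
  case (Suc p)
  interpret R: cring KR by (rule scalars_cring)
  show ?case using Suc cycsum_Suc[of p] cycsum_in[of "Suc 0"] by (simp add: R.em_mult[symmetric] flip: R.m_assoc)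
qed

lemma cycsum_0: "cycsum 0 = altsum X n G \<otimes>\<^bsub>KR\<^esub> val f0"
proof -
  interpret R: cring KR by (rule scalars_cring)
  have "cycsum 0 = (\<Oplus>\<^bsub>KR\<^esub>s\<in>perms n. (R.em (sign s) \<otimes>\<^bsub>KR\<^esub> val (perm_arrow X n s \<star> G)) \<otimes>\<^bsub>KR\<^esub> val f0)"
    unfolding cycsum_def
  proof (rule R.finsum_cong')
    fix s assume s: "s \<in> perms n"
    have "(X \<triangleright> perm_arrow X n s) \<star> (f0 \<boxtimes> G) = f0 \<boxtimes> (perm_arrow X n s \<star> G)"
      using s interchange[of f0 "ID X" G "perm_arrow X n s"] by simp
    then show "R.em (sign s) \<otimes>\<^bsub>KR\<^esub> val (cycle_arrow X (Suc n) 0 \<star> (X \<triangleright> perm_arrow X n s) \<star> (f0 \<boxtimes> G)) =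
        (R.em (sign s) \<otimes>\<^bsub>KR\<^esub> val (perm_arrow X n s \<star> G)) \<otimes>\<^bsub>KR\<^esub> val f0"
      using s val_tn[of f0 X "perm_arrow X n s \<star> G" "tpow C X n"] by (simp add: R.m_assoc)
  qed (auto simp: Pi_def)
  then show ?thesis unfolding altsum_def by (subst R.finsum_ldistr) (auto simp: finite_permutations)
qed

text \<open>For p = 1 the cycle is one crossing at the front, and the partial trace over the first
  factor fuses f0 into the first factor of G.\<close>

lemma cycsum_1: assumes n: "n = Suc m" shows "cycsum (Suc 0) = altsum X n (G \<star> (f0 \<triangleleft> tpow C X m))"
proof -
  interpret R: cring KR by (rule scalars_cring)
  have G' : "dm G = X \<otimes>\<^sub>o tpow C X m" "cd G = X \<otimes>\<^sub>o tpow C X m" using n by simp_all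
  have P' : "dm (perm_arrow X n s) = X \<otimes>\<^sub>o tpow C X m" "cd (perm_arrow X n s) = X \<otimes>\<^sub>o tpow C X m" if "s \<in> perms n" for s using n that by (simp_all del: perm_arrow.simps)
  show ?thesis unfolding cycsum_def altsum_def
  proof (rule R.finsum_cong')
    fix s assume s: "s \<in> perms n"
    note [simp] = P'[OF s]
    have "cycle_arrow X (Suc n) (Suc 0) = SW X X (tpow C X m)"
      using n by (simp add: swp_0)
    moreover have "(X \<triangleright> perm_arrow X n s) \<star> (f0 \<boxtimes> G) = f0 \<boxtimes> (perm_arrow X n s \<star> G)"
      using s G' interchange[of f0 "ID X" G "perm_arrow X n s"] by simp
    ultimately have "val (cycle_arrow X (Suc n) (Suc 0) \<star> (X \<triangleright> perm_arrow X n s) \<star> (f0 \<boxtimes> G)) = val ((perm_arrow X n s \<star> G) \<star> (f0 \<triangleleft> tpow C X m))"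
      using s G' by (simp add: val_swap del: cycle_arrow.simps)
    then show "R.em (sign s) \<otimes>\<^bsub>KR\<^esub> val (cycle_arrow X (Suc n) (Suc 0) \<star> (X \<triangleright> perm_arrow X n s) \<star> (f0 \<boxtimes> G)) =
        R.em (sign s) \<otimes>\<^bsub>KR\<^esub> val (perm_arrow X n s \<star> G \<star> (f0 \<triangleleft> tpow C X m))"
      by (simp add: cp_assoc del: cycle_arrow.simps)
  qed (use G' P' in \<open>auto simp: Pi_def simp del: perm_arrow.simps\<close>)
qed

lemma altsum_rec_Suc: assumes n: "n = Suc m"
  shows "altsum X (Suc n) (f0 \<boxtimes> G) = (altsum X n G \<otimes>\<^bsub>KR\<^esub> val f0) \<ominus>\<^bsub>KR\<^esub>
    (ring_of_int KR (int n) \<otimes>\<^bsub>KR\<^esub> altsum X n (G \<star> (f0 \<triangleleft> tpow C X m)))"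
proof -
  interpret R: cring KR by (rule scalars_cring)
  have c1: "cycsum (Suc 0) \<in> carrier KR" using cycsum_in[of "Suc 0"] n by simp
  have "altsum X (Suc n) (f0 \<boxtimes> G) = (\<Oplus>\<^bsub>KR\<^esub>p\<in>{..Suc m}. R.em ((- 1) ^ p) \<otimes>\<^bsub>KR\<^esub> cycsum p)"
    by (simp only: altsum_cycsum n[symmetric])
  also have "\<dots> = (\<Oplus>\<^bsub>KR\<^esub>p\<in>{..m}. R.em ((- 1) ^ Suc p) \<otimes>\<^bsub>KR\<^esub> cycsum (Suc p)) \<oplus>\<^bsub>KR\<^esub> (R.em ((- 1) ^ 0) \<otimes>\<^bsub>KR\<^esub> cycsum 0)"
    using cycsum_in n[symmetric] by (intro R.finsum_Suc2) (auto simp: Pi_def)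
  also have "(\<Oplus>\<^bsub>KR\<^esub>p\<in>{..m}. R.em ((- 1) ^ Suc p) \<otimes>\<^bsub>KR\<^esub> cycsum (Suc p)) = (\<Oplus>\<^bsub>KR\<^esub>p\<in>{..m}. \<ominus>\<^bsub>KR\<^esub> cycsum (Suc 0))"
  proof (rule R.finsum_cong')
    fix i assume "i \<in> {..m}"
    then have p: "cycsum (Suc i) = R.em ((- 1) ^ i) \<otimes>\<^bsub>KR\<^esub> cycsum (Suc 0)" by (intro cycsum_power) (simp add: n)
    \<comment> \<open>The sign of place i + 1 and the sign gained by moving that place to the front
      multiply to -1 for every i. Hence the n = m + 1 terms are equal.\<close>
    have q: "(- 1) ^ Suc i * (- 1) ^ i = (- 1 :: int)" by (simp flip: power_add)
    show "R.em ((- 1) ^ Suc i) \<otimes>\<^bsub>KR\<^esub> cycsum (Suc i) = \<ominus>\<^bsub>KR\<^esub> cycsum (Suc 0)"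
      unfolding p using c1 by (simp only: R.m_assoc[symmetric] R.em_closed R.em_mult[symmetric] q R.em_minus_1)
  qed (use c1 in auto)
  also have "\<dots> = R.em (int n) \<otimes>\<^bsub>KR\<^esub> (\<ominus>\<^bsub>KR\<^esub> cycsum (Suc 0))"
    using c1 n by (simp add: R.add.finprod_const R.add_pow_nat_em R.em_add R.l_distr R.a_comm)
  finally show ?thesis
    using c1 cycsum_0[symmetric] cycsum_1[OF n, symmetric] cycsum_in[of 0] by (simp add: R.r_minus R.minus_eq R.a_comm)
qed

lemma altsum_rec_0: assumes n: "n = 0"
  shows "altsum X (Suc n) (f0 \<boxtimes> G) = altsum X n G \<otimes>\<^bsub>KR\<^esub> val f0"
proof -
  interpret R: cring KR by (rule scalars_cring)
  show ?thesis unfolding altsum_cycsum using n cycsum_in[of 0] cycsum_0 by simp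
qed

end


text \<open>
  \<open>n!\<close> times the trace of \<open>f\<^sup>m \<otimes> f \<otimes> \<dots> \<otimes> f\<close> on the \<open>n\<close>-th exterior power, where \<open>f\<^sup>m\<close> occupies one of the
  \<open>n\<close> factors. Eliminating these hook terms from their recursion leaves the Newton identities.
\<close>

definition hook_trace where
  "hook_trace X f n m = (case n of 0 \<Rightarrow> \<one>\<^bsub>KR\<^esub> | Suc l \<Rightarrow> altsum X n (pwr X f m \<boxtimes> tp f l))"

lemma perms_0: "perms 0 = {id}"
  by auto

lemma altsum_0: "altsum X 0 (ID \<I>) = \<one>\<^bsub>KR\<^esub>"
proof -
  interpret R: cring KR by (rule scalars_cring)
  show ?thesis unfolding altsum_def perms_0 by (simp add: val_unit)
qed

lemma hook_trace_1: assumes "ar f" "dm f = X" "cd f = X" shows "altsum X n (tp f n) = hook_trace X f n 1"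
  by (cases n) (use assms in \<open>auto simp: hook_trace_def altsum_0\<close>)

lemma hook_trace_in: assumes "ar f" "dm f = X" "cd f = X" shows "hook_trace X f n m \<in> carrier KR"
proof -
  interpret R: cring KR by (rule scalars_cring)
  show ?thesis by (cases n) (use assms in \<open>auto simp: hook_trace_def intro!: altsum_in simp del: perm_arrow.simps\<close>)
qed

text \<open>The expansion with f^m as distinguished factor and G a tensor power of f. The fixed
  factor splits off as the trace of f^m, and fusion with one of the n others turns f^m into
  f^(m+1).\<close>

lemma hook_trace_rec: assumes f: "ar f" "dm f = X" "cd f = X"
  shows "hook_trace X f (Suc n) m = (hook_trace X f n 1 \<otimes>\<^bsub>KR\<^esub> val (pwr X f m)) \<ominus>\<^bsub>KR\<^esub> (ring_of_int KR (int n) \<otimes>\<^bsub>KR\<^esub> hook_trace X f n (Suc m))"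
proof (cases n)
  case 0
  interpret R: cring KR by (rule scalars_cring)
  have "altsum X (Suc 0) (pwr X f m \<boxtimes> ID \<I>) = altsum X 0 (ID \<I>) \<otimes>\<^bsub>KR\<^esub> val (pwr X f m)"
    by (rule altsum_rec_0) (use f in simp_all)
  then show ?thesis using 0 hook_trace_in[OF f, of 0 "Suc m"] f by (simp add: hook_trace_def altsum_0 R.minus_eq)
next
  case (Suc l)
  have "tp f (Suc l) \<star> (pwr X f m \<triangleleft> tpow C X l) = pwr X f (Suc m) \<boxtimes> tp f l"
    using interchange[of "pwr X f m" f "ID (tpow C X l)" "tp f l"] f by simp
  moreover have "altsum X (Suc (Suc l)) (pwr X f m \<boxtimes> tp f (Suc l)) = (altsum X (Suc l) (tp f (Suc l)) \<otimes>\<^bsub>KR\<^esub> val (pwr X f m)) \<ominus>\<^bsub>KR\<^esub>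
    (ring_of_int KR (int (Suc l)) \<otimes>\<^bsub>KR\<^esub> altsum X (Suc l) (tp f (Suc l) \<star> (pwr X f m \<triangleleft> tpow C X l)))"
    by (rule altsum_rec_Suc) (use f tp_swp[OF f, of _ "Suc l"] in \<open>simp_all del: tp.simps tpow.simps\<close>)
  ultimately show ?thesis using Suc hook_trace_1[OF f, of "Suc l"] by (simp add: hook_trace_def del: tp.simps pwr.simps)
qed

section \<open>The antisymmetrizer as a projector and the trace on its image\<close>

lemma perm_mor_comp: assumes "s permutes {..<n}" "t permutes {..<n}"
  shows "perm_mor C X n s \<bullet> perm_mor C X n t = perm_mor C X n (s \<circ> t)"
proof -
  note [simp] = perm_mor(1)[of _ n X] perm_mor(2)[of _ n X]
  have "mk (tpow C X n) (tpow C X n) (perm_mor C X n s \<bullet> perm_mor C X n t) = perm_arrow X n s \<star> perm_arrow X n t"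
    using cp_mk[of "perm_mor C X n t" "tpow C X n" "tpow C X n" "perm_mor C X n s" "tpow C X n"] assms by simp
  also have "\<dots> = mk (tpow C X n) (tpow C X n) (perm_mor C X n (s \<circ> t))"
    using perm_arrow_comp[OF assms] perm_mor(2)[OF permutes_compose[OF assms(2,1)]] by simp
  finally show ?thesis
    using assms permutes_compose[OF assms(2,1)] by (intro mk_eqD) (auto intro: cmp_in perm_mor(1))
qed

definition sgn_mor where "sgn_mor X n s = of_int (sign s) \<odot>\<^bsub>hom_mod C (tpow C X n) (tpow C X n)\<^esub> perm_mor C X n s"

lemma sgn_mor_in: "s permutes {..<n} \<Longrightarrow> sgn_mor X n s \<in> mor C (tpow C X n) (tpow C X n)"
  by (simp add: sgn_mor_def perm_mor)

lemma permutes_permutation: "s permutes {..<n::nat} \<Longrightarrow> permutation s"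
  using permutation_permutes by blast

lemma sgn_mor_comp: assumes "s permutes {..<n}" "t permutes {..<n}"
  shows "sgn_mor X n s \<bullet> sgn_mor X n t = sgn_mor X n (s \<circ> t)"
proof -
  note p = perm_mor(1)[OF assms(1), of X] and q = perm_mor(1)[OF assms(2), of X]
  have "sgn_mor X n s \<bullet> sgn_mor X n t = (of_int (sign s) * of_int (sign t)) \<odot>\<^bsub>hom_mod C (tpow C X n) (tpow C X n)\<^esub> (perm_mor C X n s \<bullet> perm_mor C X n t)"
    using cmp_in[OF q p] by (simp add: sgn_mor_def cmp_smult_left[OF smult_in[OF q] p] cmp_smult_right[OF q p] smult_assoc)
  then show ?thesis using assms
    by (simp add: sgn_mor_def perm_mor_comp sign_compose permutes_permutation)
qed

definition symm_sum where "symm_sum X n = (\<Oplus>\<^bsub>End_ring C (tpow C X n)\<^esub>s\<in>perms n. sgn_mor X n s)"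

lemma antisymmetrizer_eq:
  "antisymmetrizer C X n = (1 / fact n) \<odot>\<^bsub>hom_mod C (tpow C X n) (tpow C X n)\<^esub> symm_sum X n"
proof -
  have "(\<lambda>s. of_int (sign s) \<odot>\<^bsub>hom_mod C (tpow C X n) (tpow C X n)\<^esub> perm_mor C X n s) = sgn_mor X n"
    by (simp add: sgn_mor_def fun_eq_iff)
  then show ?thesis using End_finsum[of "perms n" "sgn_mor X n" "tpow C X n"] sgn_mor_in
    by (simp add: antisymmetrizer_def symm_sum_def Let_def)
qed

lemma symm_sum_in: "symm_sum X n \<in> mor C (tpow C X n) (tpow C X n)"
proof -
  interpret E: ring "End_ring C (tpow C X n)" by (rule End_ring)
  show ?thesis using sgn_mor_in E.finsum_closed[of "sgn_mor X n" "perms n"] by (auto simp: symm_sum_def End_ring_simps)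
qed

text \<open>A signed permutation multiplied from the right is absorbed, as translation permutes the
  summands. Expanding the second factor therefore gives n! copies of the first.\<close>

lemma symm_sum_square: "symm_sum X n \<bullet> symm_sum X n = of_nat (fact n) \<odot>\<^bsub>hom_mod C (tpow C X n) (tpow C X n)\<^esub> symm_sum X n"
proof -
  let ?E = "End_ring C (tpow C X n)"
  interpret E: ring ?E by (rule End_ring)
  have c: "s \<in> perms n \<Longrightarrow> sgn_mor X n s \<in> carrier ?E" for s using sgn_mor_in by (simp add: End_ring_simps)
  have M: "symm_sum X n \<in> carrier ?E" using symm_sum_in by (simp add: End_ring_simps)
  have "symm_sum X n \<otimes>\<^bsub>?E\<^esub> sgn_mor X n t = symm_sum X n" if t: "t \<in> perms n" for t
  proof -
    have "symm_sum X n \<otimes>\<^bsub>?E\<^esub> sgn_mor X n t = (\<Oplus>\<^bsub>?E\<^esub>s\<in>perms n. sgn_mor X n s \<otimes>\<^bsub>?E\<^esub> sgn_mor X n t)"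
      unfolding symm_sum_def using c t by (intro E.finsum_ldistr) (auto simp: finite_permutations)
    also have "\<dots> = (\<Oplus>\<^bsub>?E\<^esub>s\<in>perms n. sgn_mor X n (s \<circ> t))"
      using t sgn_mor_in permutes_compose[of t "{..<n}"] by (intro E.finsum_cong') (auto simp: End_ring_simps sgn_mor_comp)
    also have "\<dots> = symm_sum X n"
      unfolding symm_sum_def using c t by (intro finsum_perms_right E.abelian_monoid_axioms) auto
    finally show ?thesis .
  qed
  then have "(\<Oplus>\<^bsub>?E\<^esub>t\<in>perms n. symm_sum X n \<otimes>\<^bsub>?E\<^esub> sgn_mor X n t) = (\<Oplus>\<^bsub>?E\<^esub>t\<in>perms n. symm_sum X n)"
    using M by (intro E.finsum_cong') auto
  also have "\<dots> = [(fact n :: nat)] \<cdot>\<^bsub>?E\<^esub> symm_sum X n"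
    using M by (simp add: E.add.finprod_const card_permutations)
  finally have "symm_sum X n \<otimes>\<^bsub>?E\<^esub> symm_sum X n = [(fact n :: nat)] \<cdot>\<^bsub>?E\<^esub> symm_sum X n"
    using E.finsum_rdistr[of "perms n" "symm_sum X n" "sgn_mor X n"] M c by (auto simp: symm_sum_def finite_permutations)
  then show ?thesis using symm_sum_in by (simp only: End_ring_simps smult_nat_End)
qed

lemma antisymmetrizer_in: "antisymmetrizer C X n \<in> mor C (tpow C X n) (tpow C X n)"
  by (simp add: antisymmetrizer_eq symm_sum_in)

lemma antisymmetrizer_idem: "antisymmetrizer C X n \<bullet> antisymmetrizer C X n = antisymmetrizer C X n"
proof -
  note m = symm_sum_in[of X n]
  show ?thesis using m cmp_in[OF m m]
    by (simp add: antisymmetrizer_eq cmp_smult_left[OF smult_in[OF m] m] cmp_smult_right[OF m m] symm_sum_square flip: smult_assoc)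
qed

text \<open>Projectors are only assumed to have kernels, so the image of p is obtained as the kernel
  of the complementary projector q = 1 - p. Since q h = 0 means p h = h, p itself factors through
  that kernel, and uniqueness of factorizations makes r a retraction of i.\<close>

lemma image_exists: assumes p: "p \<in> mor C T T" "p \<bullet> p = p" shows "\<exists>Y i r. is_image C T p Y i r"
proof -
  let ?H = "\<lambda>W. hom_mod C W T"
  define q where "q = idm C T \<oplus>\<^bsub>?H T\<^esub> ((-1) \<odot>\<^bsub>?H T\<^esub> p)"
  have qm: "q \<in> mor C T T"
  proof -
    interpret M: abelian_group "?H T" by (rule hom_group)
    show ?thesis using p idm_in by (simp add: q_def)
  qed
  have qh: "q \<bullet> h = h \<oplus>\<^bsub>?H W\<^esub> (\<ominus>\<^bsub>?H W\<^esub> (p \<bullet> h))" if "h \<in> mor C W T" for h W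
    unfolding q_def cmp_add_left[OF that idm_in smult_in[OF p(1)]] cmp_smult_left[OF that p(1)] idm_cmp[OF that]
    by (simp only: smult_minus_1[OF cmp_in[OF that p(1)]])
  have q0: "q \<bullet> h = \<zero>\<^bsub>?H W\<^esub> \<longleftrightarrow> p \<bullet> h = h" if h: "h \<in> mor C W T" for h W
  proof -
    interpret M: abelian_group "?H W" by (rule hom_group)
    show ?thesis using h cmp_in[OF h p(1)] by (metis qh M.r_neg M.a_inv_closed M.minus_equality M.minus_minus M.a_comm)
  qed
  have qp: "q \<bullet> p = \<zero>\<^bsub>?H T\<^esub>" using q0[OF p(1)] p(2) by simp
  have "q \<bullet> q = q"
  proof -
    interpret M: abelian_group "?H T" by (rule hom_group)
    have "p \<bullet> q = p \<oplus>\<^bsub>?H T\<^esub> ((-1) \<odot>\<^bsub>?H T\<^esub> (p \<bullet> p))"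
      by (simp only: q_def cmp_add_right[OF idm_in smult_in[OF p(1)] p(1)] cmp_smult_right[OF p(1) p(1)] cmp_idm[OF p(1)])
    then have "p \<bullet> q = \<zero>\<^bsub>?H T\<^esub>" using p by (simp add: smult_minus_1 M.r_neg)
    then show ?thesis using qh[OF qm] qm by simp
  qed
  then obtain K i where K: "is_kernel C T T q K i" using karoubian[OF qm] by blast
  then have i: "i \<in> mor C K T" "q \<bullet> i = \<zero>\<^bsub>?H K\<^esub>"
    and univ: "\<And>W h. h \<in> mor C W T \<Longrightarrow> q \<bullet> h = \<zero>\<^bsub>?H W\<^esub> \<Longrightarrow> \<exists>!u. u \<in> mor C W K \<and> i \<bullet> u = h"
    by (auto simp: is_kernel_def)
  obtain r where r: "r \<in> mor C T K" "i \<bullet> r = p" using univ[OF p(1) qp] by blast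
  have "p \<bullet> i = i" using q0[OF i(1)] i(2) by simp
  then have "i \<bullet> (r \<bullet> i) = i" using r i cmp_assoc[OF i(1) r(1) i(1)] by simp
  then have "r \<bullet> i = idm C K" using univ[OF i] cmp_in[OF i(1) r(1)] idm_in[of K] cmp_idm[OF i(1)] by metis
  then show ?thesis using i r unfolding is_image_def by blast
qed

lemma trace_linear:
  assumes "f \<in> mor C X X" "g \<in> mor C X X"
  shows "trace C X (f \<oplus>\<^bsub>hom_mod C X X\<^esub> g) = trace C X f \<oplus>\<^bsub>hom_mod C \<I> \<I>\<^esub> trace C X g"
    and "trace C X (q \<odot>\<^bsub>hom_mod C X X\<^esub> f) = q \<odot>\<^bsub>hom_mod C \<I> \<I>\<^esub> trace C X f"
proof -
  define t where "t = (SOME (D, ev, coev). is_dual C X D ev coev)"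
  obtain D e c where t: "t = (D, e, c)" by (cases t) auto
  have "case t of (D, ev, coev) \<Rightarrow> is_dual C X D ev coev"
    unfolding t_def using duals[of X] by (intro someI_ex[of "\<lambda>(D, ev, coev). is_dual C X D ev coev"]) auto
  then have em: "e \<in> mor C (D \<otimes>\<^sub>o X) \<I>" and cm: "c \<in> mor C \<I> (X \<otimes>\<^sub>o D)" by (auto simp: t is_dual_def)
  have tr: "trace C X f = e \<bullet> braiding C X D \<bullet> (f \<otimes>\<^sub>m idm C D) \<bullet> c" for f
    by (simp add: trace_def t_def[symmetric] t)
  note b = braiding_in[of X D]
  have fm: "h \<in> mor C X X \<Longrightarrow> h \<otimes>\<^sub>m idm C D \<in> mor C (X \<otimes>\<^sub>o D) (X \<otimes>\<^sub>o D)" for h by (rule tens_in[OF _ idm_in])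
  note f = fm[OF assms(1)] cmp_in[OF cm fm[OF assms(1)]] cmp_in[OF cmp_in[OF cm fm[OF assms(1)]] b]
  note g = fm[OF assms(2)] cmp_in[OF cm fm[OF assms(2)]] cmp_in[OF cmp_in[OF cm fm[OF assms(2)]] b]
  show "trace C X (f \<oplus>\<^bsub>hom_mod C X X\<^esub> g) = trace C X f \<oplus>\<^bsub>hom_mod C \<I> \<I>\<^esub> trace C X g"
    using assms f g em cm b by (simp add: tr tens_add_left[OF assms idm_in] cmp_add_left[OF cm f(1) g(1)]
       cmp_add_right[OF f(2) g(2) b] cmp_add_right[OF f(3) g(3) em])
  show "trace C X (q \<odot>\<^bsub>hom_mod C X X\<^esub> f) = q \<odot>\<^bsub>hom_mod C \<I> \<I>\<^esub> trace C X f"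
    by (simp add: tr tens_smult_left[OF assms(1) idm_in] cmp_smult_left[OF cm f(1)] cmp_smult_right[OF f(2) b] cmp_smult_right[OF f(3) em])
qed

lemma trace_in: "f \<in> mor C X X \<Longrightarrow> trace C X f \<in> mor C \<I> \<I>"
  using val_in[of "mk X X f"] by (simp add: trace_val End_ring_simps)

lemma trace_finsum: assumes "finite A" "\<And>s. s \<in> A \<Longrightarrow> h s \<in> mor C X X"
  shows "trace C X (\<Oplus>\<^bsub>End_ring C X\<^esub>s\<in>A. h s) = (\<Oplus>\<^bsub>KR\<^esub>s\<in>A. trace C X (h s))"
  using assms
proof (induction A)
  case empty
  interpret E: ring "End_ring C X" by (rule End_ring)
  interpret R: cring KR by (rule scalars_cring)
  have "trace C X (0 \<odot>\<^bsub>hom_mod C X X\<^esub> idm C X) = \<zero>\<^bsub>hom_mod C \<I> \<I>\<^esub>"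
    using trace_linear(2)[OF idm_in idm_in] trace_in[OF idm_in] by (simp add: smult_0)
  then show ?case by (simp add: smult_0[OF idm_in] End_ring_simps)
next
  case (insert s A)
  interpret E: ring "End_ring C X" by (rule End_ring)
  interpret R: cring KR by (rule scalars_cring)
  have "(\<Oplus>\<^bsub>End_ring C X\<^esub>s\<in>A. h s) \<in> mor C X X"
    using E.finsum_closed[of h A] insert by (auto simp: End_ring_simps)
  then show ?case using insert trace_linear(1)[of "h s" X "\<Oplus>\<^bsub>End_ring C X\<^esub>s\<in>A. h s"] trace_in
    by (simp add: End_ring_simps Pi_def)
qed

definition chi where "chi X f n = trace C (Alt C X n) (Alt_mor C X f n)"

text \<open>Cyclicity turns the trace of r F i into that of i r F, and i r is the antisymmetrizer.
  The trace on Alt thus becomes one on the whole tensor power, which linearity expands over the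
  permutations.\<close>

lemma chi_altsum: assumes f: "f \<in> mor C X X"
  shows "chi X f n = (1 / fact n) \<odot>\<^bsub>hom_mod C \<I> \<I>\<^esub> altsum X n (tp (mk X X f) n)"
proof -
  let ?T = "tpow C X n"
  let ?E = "End_ring C ?T"
  interpret E: ring ?E by (rule End_ring)
  interpret R: cring KR by (rule scalars_cring)
  define F where "F = tpow_mor C f n"
  have F: "F \<in> mor C ?T ?T" "tp (mk X X f) n = mk ?T ?T F" using tp_mk[OF f, of n] by (auto simp: F_def)
  obtain Y i r where t: "alt_image C X n = (Y, i, r)" by (cases "alt_image C X n") auto
  have "case alt_image C X n of (Y, i, r) \<Rightarrow> is_image C ?T (antisymmetrizer C X n) Y i r"
    unfolding alt_image_def using image_exists[OF antisymmetrizer_in antisymmetrizer_idem]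
    by (intro someI_ex[of "\<lambda>(Y, i, r). is_image C (tpow C X n) (antisymmetrizer C X n) Y i r"]) auto
  then have im: "i \<in> mor C Y ?T" "r \<in> mor C ?T Y" "i \<bullet> r = antisymmetrizer C X n" by (auto simp: t is_image_def)
  have "chi X f n = trace C Y (r \<bullet> F \<bullet> i)" by (simp add: chi_def Alt_def Alt_mor_def t F_def)
  also have "\<dots> = val (mk ?T Y r \<star> (mk ?T ?T F \<star> mk Y ?T i))"
    using im F(1) cmp_in[OF im(1) F(1)] cmp_in[OF cmp_in[OF im(1) F(1)] im(2)] by (simp add: trace_val)
  also have "\<dots> = val ((mk ?T ?T F \<star> mk Y ?T i) \<star> mk ?T Y r)"
    using im F(1) cmp_in[OF im(1) F(1)] by (intro val_cyclic) simp_all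
  also have "\<dots> = val (mk ?T ?T F \<star> mk ?T ?T (antisymmetrizer C X n))"
    using im by (simp only: cp_assoc) simp
  also have "\<dots> = val (mk ?T ?T (antisymmetrizer C X n) \<star> mk ?T ?T F)"
    using F(1) antisymmetrizer_in[of X n] by (intro val_cyclic) simp_all
  also have "\<dots> = trace C ?T (antisymmetrizer C X n \<bullet> F)"
    using F(1) antisymmetrizer_in[of X n] cmp_in[OF F(1) antisymmetrizer_in] by (simp add: trace_val)
  also have "\<dots> = (1 / fact n) \<odot>\<^bsub>hom_mod C \<I> \<I>\<^esub> trace C ?T (symm_sum X n \<bullet> F)"
    using F(1) symm_sum_in[of X n] cmp_in[OF F(1) symm_sum_in]
    by (simp add: antisymmetrizer_eq cmp_smult_left trace_linear(2))
  also have "symm_sum X n \<bullet> F = (\<Oplus>\<^bsub>?E\<^esub>s\<in>perms n. sgn_mor X n s \<bullet> F)"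
    using E.finsum_ldistr[of "perms n" F "sgn_mor X n"] F(1) sgn_mor_in
    by (auto simp: symm_sum_def finite_permutations End_ring_simps)
  also have "trace C ?T \<dots> = (\<Oplus>\<^bsub>KR\<^esub>s\<in>perms n. trace C ?T (sgn_mor X n s \<bullet> F))"
    using cmp_in[OF F(1) sgn_mor_in] by (intro trace_finsum) (auto simp: finite_permutations)
  also have "\<dots> = altsum X n (mk ?T ?T F)"
    unfolding altsum_def
  proof (rule R.finsum_cong')
    fix s assume s: "s \<in> perms n"
    then have p: "perm_mor C X n s \<in> mor C ?T ?T" by (simp add: perm_mor)
    note pF = cmp_in[OF F(1) p]
    have "trace C ?T (sgn_mor X n s \<bullet> F) = of_int (sign s) \<odot>\<^bsub>hom_mod C \<I> \<I>\<^esub> trace C ?T (perm_mor C X n s \<bullet> F)"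
      using F(1) p pF by (simp add: sgn_mor_def cmp_smult_left trace_linear(2))
    also have "\<dots> = [sign s] \<cdot>\<^bsub>KR\<^esub> trace C ?T (perm_mor C X n s \<bullet> F)"
      using trace_in[OF pF] by (simp add: smult_int_End)
    also have "\<dots> = R.em (sign s) \<otimes>\<^bsub>KR\<^esub> trace C ?T (perm_mor C X n s \<bullet> F)"
      using trace_in[OF pF] by (intro R.add_pow_int_em) (simp add: End_ring_simps)
    also have "trace C ?T (perm_mor C X n s \<bullet> F) = val (perm_arrow X n s \<star> mk ?T ?T F)"
      using s p F(1) pF perm_mor(2)[of s n X, symmetric] by (simp add: trace_val)
    finally show "trace C ?T (sgn_mor X n s \<bullet> F) = R.em (sign s) \<otimes>\<^bsub>KR\<^esub> val (perm_arrow X n s \<star> mk ?T ?T F)" .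
  qed (use F(1) in auto)
  finally show ?thesis by (simp add: F(2))
qed

text \<open>Division by n! brings \<open>hook_trace_rec\<close> into the shape required by
  \<open>newton_chain\<close>: the factor n + 1 there is (n + 1)! / n!.\<close>

definition hook_coeff where "hook_coeff X f n m = (1 / fact n) \<odot>\<^bsub>hom_mod C \<I> \<I>\<^esub> hook_trace X f n m"

lemma chi_newton: assumes f: "f \<in> mor C X X"
  shows "chi X f n \<in> carrier KR" "chi X f 0 = \<one>\<^bsub>KR\<^esub>"
    "ring_of_int KR (int (Suc n)) \<otimes>\<^bsub>KR\<^esub> chi X f (Suc n) =
      (\<Oplus>\<^bsub>KR\<^esub>i\<in>{..n}. ring_of_int KR ((- 1) ^ i) \<otimes>\<^bsub>KR\<^esub> (val (pwr X (mk X X f) (Suc i)) \<otimes>\<^bsub>KR\<^esub> chi X f (n - i)))"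
proof -
  interpret R: cring KR by (rule scalars_cring)
  let ?f = "mk X X f"
  have F: "ar ?f" "dm ?f = X" "cd ?f = X" using f by simp_all
  have chi: "chi X f n = hook_coeff X ?f n 1" for n
    by (simp only: chi_altsum[OF f] hook_trace_1[OF F] hook_coeff_def)
  have c: "hook_coeff X ?f n m \<in> carrier KR" for n m
    using hook_trace_in[OF F, of n m] by (simp add: hook_coeff_def End_ring_simps)
  have a: "hook_trace X ?f n m \<in> carrier KR" for n m by (rule hook_trace_in[OF F])
  have T: "val (pwr X ?f m) \<in> carrier KR" for m using F by simp
  have fc: "R.em (int (fact n)) \<otimes>\<^bsub>KR\<^esub> hook_coeff X ?f n m = hook_trace X ?f n m" for n m
  proof -
    have "R.em (int (fact n)) \<otimes>\<^bsub>KR\<^esub> hook_coeff X ?f n m = [(fact n :: nat)] \<cdot>\<^bsub>KR\<^esub> hook_coeff X ?f n m" using c by (simp add: R.add_pow_nat_em)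
    also have "\<dots> = of_nat (fact n) \<odot>\<^bsub>hom_mod C \<I> \<I>\<^esub> hook_coeff X ?f n m" using c[of n m] by (subst smult_nat_End) (auto simp: End_ring_simps)
    also have "\<dots> = hook_trace X ?f n m" using a[of n m] by (simp add: hook_coeff_def End_ring_simps flip: smult_assoc)
    finally show ?thesis .
  qed
  have cancel: "x = y" if "R.em (int (fact n)) \<otimes>\<^bsub>KR\<^esub> x = R.em (int (fact n)) \<otimes>\<^bsub>KR\<^esub> y" "x \<in> carrier KR" "y \<in> carrier KR" for n x y
  proof -
    have "[(fact n :: nat)] \<cdot>\<^bsub>KR\<^esub> (x \<ominus>\<^bsub>KR\<^esub> y) = \<zero>\<^bsub>KR\<^esub>"
      using that by (simp add: R.add_pow_nat_em R.minus_eq R.r_distr R.r_minus R.r_neg)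
    then have "x \<ominus>\<^bsub>KR\<^esub> y = \<zero>\<^bsub>KR\<^esub>" by (rule scalars_torsion_free[rotated]) (use that in auto)
    then have "(x \<ominus>\<^bsub>KR\<^esub> y) \<oplus>\<^bsub>KR\<^esub> y = y" using that by simp
    then show ?thesis using that by (simp add: R.minus_eq R.a_assoc R.l_neg)
  qed
  have "R.em (int (Suc n)) \<otimes>\<^bsub>KR\<^esub> hook_coeff X ?f (Suc n) m = (hook_coeff X ?f n 1 \<otimes>\<^bsub>KR\<^esub> val (pwr X ?f m)) \<ominus>\<^bsub>KR\<^esub> (R.em (int n) \<otimes>\<^bsub>KR\<^esub> hook_coeff X ?f n (Suc m))" for n m
  proof (rule cancel[of n])
    have "R.em (int (fact n)) \<otimes>\<^bsub>KR\<^esub> (R.em (int (Suc n)) \<otimes>\<^bsub>KR\<^esub> hook_coeff X ?f (Suc n) m) = R.em (int (fact (Suc n))) \<otimes>\<^bsub>KR\<^esub> hook_coeff X ?f (Suc n) m"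
    proof -
      have "int (fact n) * int (Suc n) = int (fact (Suc n))" by (simp add: algebra_simps)
      then show ?thesis using c by (simp only: R.em_mult[symmetric] R.m_assoc[symmetric] R.em_closed)
    qed
    also have "\<dots> = hook_trace X ?f (Suc n) m" by (rule fc)
    also have "\<dots> = (hook_trace X ?f n 1 \<otimes>\<^bsub>KR\<^esub> val (pwr X ?f m)) \<ominus>\<^bsub>KR\<^esub> (R.em (int n) \<otimes>\<^bsub>KR\<^esub> hook_trace X ?f n (Suc m))"
      by (rule hook_trace_rec[OF F])
    also have "\<dots> = R.em (int (fact n)) \<otimes>\<^bsub>KR\<^esub> ((hook_coeff X ?f n 1 \<otimes>\<^bsub>KR\<^esub> val (pwr X ?f m)) \<ominus>\<^bsub>KR\<^esub> (R.em (int n) \<otimes>\<^bsub>KR\<^esub> hook_coeff X ?f n (Suc m)))"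
      using c T by (simp flip: fc add: R.minus_eq R.r_distr R.r_minus R.m_assoc R.m_lcomm)
    finally show "R.em (int (fact n)) \<otimes>\<^bsub>KR\<^esub> (R.em (int (Suc n)) \<otimes>\<^bsub>KR\<^esub> hook_coeff X ?f (Suc n) m) = \<dots>" .
  qed (use c T in auto)
  \<comment> \<open>With m = 1 the hook is the plain exterior trace, and \<open>T\<close> runs
    through the traces of f, f^2, and so on.\<close>
  note R.newton_chain[of "hook_coeff X ?f" "\<lambda>m. val (pwr X ?f m)", OF c T this, of n 1]
  then show "R.em (int (Suc n)) \<otimes>\<^bsub>KR\<^esub> chi X f (Suc n) =
      (\<Oplus>\<^bsub>KR\<^esub>i\<in>{..n}. R.em ((- 1) ^ i) \<otimes>\<^bsub>KR\<^esub> (val (pwr X ?f (Suc i)) \<otimes>\<^bsub>KR\<^esub> chi X f (n - i)))"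
    by (simp only: chi plus_1_eq_Suc)
  show "chi X f n \<in> carrier KR" using c by (simp only: chi)
  show "chi X f 0 = \<one>\<^bsub>KR\<^esub>" using fc[of 0 1] c[of 0 1] by (simp add: chi hook_trace_def)
qed

end

section \<open>Symmetric polynomials\<close>

definition rhom :: "('r::comm_ring_1 \<Rightarrow> 'a::comm_ring_1) \<Rightarrow> bool" where
  "rhom \<phi> \<longleftrightarrow> (\<forall>x y. \<phi> (x + y) = \<phi> x + \<phi> y) \<and> (\<forall>x y. \<phi> (x * y) = \<phi> x * \<phi> y) \<and> \<phi> 1 = 1"

context
  fixes \<phi> :: "'r::comm_ring_1 \<Rightarrow> 'a::comm_ring_1"
  assumes \<phi>: "rhom \<phi>"
begin

lemma rhom_add: "\<phi> (x + y) = \<phi> x + \<phi> y" and rhom_mult: "\<phi> (x * y) = \<phi> x * \<phi> y" and rhom_1: "\<phi> 1 = 1"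
  using \<phi> by (auto simp: rhom_def)

lemma rhom_0: "\<phi> 0 = 0" using rhom_add[of 0 0] by simp

lemma rhom_uminus: "\<phi> (- x) = - \<phi> x" using rhom_add[of x "- x"] rhom_0 by (simp add: minus_unique)

lemma rhom_diff: "\<phi> (x - y) = \<phi> x - \<phi> y" using rhom_add[of x "- y"] by (simp add: rhom_uminus)

lemma rhom_sum: "\<phi> (sum f A) = (\<Sum>x\<in>A. \<phi> (f x))"
  by (induction A rule: infinite_finite_induct) (simp_all add: rhom_0 rhom_add)

lemma rhom_prod: "\<phi> (prod f A) = (\<Prod>x\<in>A. \<phi> (f x))"
  by (induction A rule: infinite_finite_induct) (simp_all add: rhom_1 rhom_mult)

lemma rhom_of_nat: "\<phi> (of_nat n) = of_nat n"
  by (induction n) (simp_all add: rhom_0 rhom_1 rhom_add)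

lemma rhom_power: "\<phi> (x ^ n) = \<phi> x ^ n"
  by (induction n) (simp_all add: rhom_1 rhom_mult)

end

lemma zeval_rhom: "rhom (zeval (type_ring :: 'a::comm_ring_1 ring) a)"
proof -
  interpret T: cring "type_ring :: 'a ring" by (rule type_ring_cring)
  show ?thesis using T.zeval_add[of a] T.zeval_mult[of a] T.zeval_1[of a] by (simp add: rhom_def)
qed

lemma zeval_type_zvar [simp]: "zeval (type_ring :: 'a::comm_ring_1 ring) a (zvar v) = a v"
proof -
  interpret T: cring "type_ring :: 'a ring" by (rule type_ring_cring)
  show ?thesis by (rule T.zeval_zvar) simp
qed

lemma rhom_zeval: assumes "rhom \<phi>" shows "\<phi> (zeval type_ring b P) = zeval type_ring (\<phi> \<circ> b) P"
proof -
  interpret T: cring "type_ring :: 'b ring" by (rule type_ring_cring)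
  have "\<phi> \<in> ring_hom type_ring type_ring" using assms by (auto simp: ring_hom_def rhom_def)
  then show ?thesis by (rule T.zeval_hom_comp)
qed

text \<open>The index set is arbitrary because the factors of the universal products are indexed by
  subsets and by pairs.\<close>

definition esym :: "('i \<Rightarrow> 'a::comm_ring_1) \<Rightarrow> 'i set \<Rightarrow> nat \<Rightarrow> 'a" where
  "esym y I l = (\<Sum>S | S \<subseteq> I \<and> card S = l. \<Prod>i\<in>S. y i)"

lemma coeff_prod_linear: assumes "finite I"
  shows "Polynomial.coeff (\<Prod>k\<in>I. [:1, z k:]) n = esym z I n"
proof -
  have "(\<Prod>k\<in>I. [:1, z k:]) = (\<Prod>k\<in>I. monom (z k) 1 + 1)"
    by (intro prod.cong refl) (simp add: monom_altdef one_pCons)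
  also have "\<dots> = (\<Sum>S\<in>Pow I. \<Prod>k\<in>S. monom (z k) 1)"
    using assms by (subst prod_add) simp_all
  also have "\<dots> = (\<Sum>S\<in>Pow I. monom (\<Prod>k\<in>S. z k) (card S))"
  proof (rule sum.cong)
    fix S assume "S \<in> Pow I"
    then have "finite S" using assms finite_subset by auto
    then show "(\<Prod>k\<in>S. monom (z k) 1) = monom (\<Prod>k\<in>S. z k) (card S)"
      by (induction S) (simp_all add: mult_monom)
  qed simp
  finally have "Polynomial.coeff (\<Prod>k\<in>I. [:1, z k:]) n = (\<Sum>S\<in>Pow I. if card S = n then \<Prod>k\<in>S. z k else 0)"
    by (simp add: coeff_sum)
  also have "\<dots> = esym z I n"
    unfolding esym_def using assms by (subst sum.inter_filter[symmetric]) (auto intro!: sum.cong)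
  finally show ?thesis .
qed

lemma esym_0: "finite I \<Longrightarrow> esym z I 0 = 1"
proof -
  assume "finite I"
  then have "{S. S \<subseteq> I \<and> card S = 0} = {{}}" using finite_subset by fastforce
  then show ?thesis by (simp add: esym_def)
qed

lemma rhom_esym: "rhom \<phi> \<Longrightarrow> \<phi> (esym z I n) = esym (\<lambda>i. \<phi> (z i)) I n"
  by (simp add: esym_def rhom_sum rhom_prod)

abbreviation msets :: "nat \<Rightarrow> nat \<Rightarrow> nat multiset set" where "msets N d \<equiv> multisets_of_size {..<N} d"

lemma finite_msets: "finite (msets N d)"
proof -
  have "msets N d \<subseteq> mset ` {xs. set xs \<subseteq> {..<N} \<and> length xs = d}"
  proof
    fix X assume X: "X \<in> msets N d"
    obtain xs where "mset xs = X" using ex_mset by blast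
    with X show "X \<in> mset ` {xs. set xs \<subseteq> {..<N} \<and> length xs = d}"
      by (auto simp: multisets_of_size_def intro!: image_eqI[of _ _ xs])
  qed
  then show ?thesis by (rule finite_subset) (simp add: finite_lists_length_eq)
qed

text \<open>A multiset stands for a monomial and F for its coefficient. One F thus describes a
  symmetric polynomial in every number of variables at once.\<close>

definition symmetric_fun :: "(nat multiset \<Rightarrow> 'r) \<Rightarrow> bool" where
  "symmetric_fun F \<longleftrightarrow> (\<forall>\<pi> a. bij \<pi> \<longrightarrow> F (image_mset \<pi> a) = F a)"

text \<open>Coefficients and values lie in different rings, linked by \<phi>. For two families of
  variables the coefficients in the second family will be polynomials in the first.\<close>

definition sym_eval :: "('r \<Rightarrow> 'a::comm_ring_1) \<Rightarrow> (nat \<Rightarrow> 'a) \<Rightarrow> nat \<Rightarrow> nat \<Rightarrow> (nat multiset \<Rightarrow> 'r) \<Rightarrow> 'a" where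
  "sym_eval \<phi> y N d F = (\<Sum>a\<in>msets N d. \<phi> (F a) * (\<Prod>i\<in>#a. y i))"

lemma bij_extension:
  assumes "finite S" "finite S'" "card S = card S'" "B \<subseteq> S" "B \<subseteq> S'"
  obtains \<pi> :: "nat \<Rightarrow> nat" where "bij \<pi>" "\<pi> ` S = S'" "\<And>i. i \<in> B \<Longrightarrow> \<pi> i = i"
proof -
  have fB: "finite B" using assms finite_subset by blast
  have "card (S - B) = card (S' - B)" using assms fB by (simp add: card_Diff_subset)
  then obtain h where h: "bij_betw h (S - B) (S' - B)" using assms finite_same_card_bij[of "S - B" "S' - B"] by auto
  let ?U = "S \<union> S'"
  have "card (?U - S) = card (?U - S')" using assms by (simp add: card_Diff_subset)
  then obtain k where k: "bij_betw k (?U - S) (?U - S')" using assms finite_same_card_bij[of "?U - S" "?U - S'"] by auto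
  define \<pi> where "\<pi> i = (if i \<in> B then i else if i \<in> S then h i else if i \<in> ?U then k i else i)" for i
  have 1: "bij_betw \<pi> B B" by (rule bij_betwI[where g = "\<lambda>i. i"]) (auto simp: \<pi>_def)
  have 2: "bij_betw \<pi> (S - B) (S' - B)" using h by (subst bij_betw_cong[where g = h]) (auto simp: \<pi>_def)
  have 3: "bij_betw \<pi> (?U - S) (?U - S')" using k assms(4) by (subst bij_betw_cong[where g = k]) (auto simp: \<pi>_def)
  have 4: "bij_betw \<pi> (- ?U) (- ?U)" using assms(4) by (intro bij_betwI[where g = "\<lambda>i. i"]) (auto simp: \<pi>_def)
  have 5: "bij_betw \<pi> (B \<union> (S - B)) (B \<union> (S' - B))" using 1 2 by (rule bij_betw_combine) auto
  then have S: "bij_betw \<pi> S S'" using assms(4,5) by (simp add: Un_absorb1 Un_Diff_cancel)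
  have "bij_betw \<pi> (S \<union> (?U - S)) (S' \<union> (?U - S'))" using S 3 by (rule bij_betw_combine) auto
  then have "bij_betw \<pi> ((S \<union> (?U - S)) \<union> (- ?U)) ((S' \<union> (?U - S')) \<union> (- ?U))" using 4 by (rule bij_betw_combine) auto
  moreover have "(S \<union> (?U - S)) \<union> (- ?U) = UNIV" "(S' \<union> (?U - S')) \<union> (- ?U) = UNIV" by auto
  ultimately have "bij \<pi>" by simp
  then show ?thesis using that[of \<pi>] S by (auto simp: \<pi>_def bij_betw_def)
qed

lemma card_set_mset_le: "card (set_mset a) \<le> size a"
  by (induction a) (auto simp: card_insert_if)

lemma image_mset_fix: "(\<And>i. i \<in># a \<Longrightarrow> f i = i) \<Longrightarrow> image_mset f a = a"
  using multiset.map_ident_strong by blast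

lemma image_mset_mset_set_bij: "bij \<pi> \<Longrightarrow> image_mset \<pi> (mset_set S) = mset_set (\<pi> ` S)"
  by (rule image_mset_mset_set) (auto intro: inj_on_subset bij_is_inj)

lemma mset_set_subset: "S \<subseteq> set_mset a \<Longrightarrow> mset_set S \<subseteq># a"
  by (rule mset_subset_eqI) (auto simp: count_mset_set' Suc_le_eq)

text \<open>
  The part of \<open>F\<close> on monomials with exactly \<open>l\<close> variables, \<open>l\<close> being the least number that occurs, is
  removed by subtracting the product of the \<open>l\<close>-th elementary symmetric function with a symmetric
  function of smaller degree.
\<close>

lemma symmetric_reduction:
  fixes F :: "nat multiset \<Rightarrow> 'r::comm_ring_1"
  assumes F: "symmetric_fun F" and van: "\<And>a. size a = d \<Longrightarrow> card (set_mset a) < l \<Longrightarrow> F a = 0"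
  shows "\<exists>G F'. symmetric_fun G \<and> symmetric_fun F' \<and>
    (\<forall>a. size a = d \<longrightarrow> card (set_mset a) < Suc l \<longrightarrow> F' a = 0) \<and>
    (\<forall>a. F a = F' a + (\<Sum>S | S \<subseteq> set_mset a \<and> card S = l. G (a - mset_set S)))"
proof -
  have Fs: "F (image_mset \<pi> a) = F a" if "bij \<pi>" for \<pi> a using F that by (simp add: symmetric_fun_def)
  define good where "good b S \<longleftrightarrow> finite S \<and> card S = l \<and> set_mset b \<subseteq> S" for b :: "nat multiset" and S
  have good_ex: "\<exists>S. good b S" if b: "card (set_mset b) \<le> l" for b
  proof -
    have "infinite (UNIV - set_mset b)" by simp
    then obtain S where "finite S" "card S = l - card (set_mset b)" "S \<subseteq> UNIV - set_mset b"
      using infinite_arbitrarily_large by blast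
    moreover from this have "set_mset b \<inter> S = {}" by blast
    ultimately have "good b (set_mset b \<union> S)" using b by (auto simp: good_def card_Un_disjoint)
    then show ?thesis by blast
  qed
  have good_card: "card (set_mset b) \<le> l" if "good b S" for b S using that card_mono[of S "set_mset b"] by (auto simp: good_def)
  \<comment> \<open>Candidate cofactor of the l-th elementary symmetric function: the coefficient of
    F at b times a squarefree monomial in l variables that include those of b. Symmetry of F makes
    the choice of the variables immaterial.\<close>
  define G where "G b = (if card (set_mset b) \<le> l then F (b + mset_set (SOME S. good b S)) else 0)" for b
  have G_eq: "G b = F (b + mset_set S)" if S: "good b S" for b S
  proof -
    define S' where "S' = (SOME S. good b S)"
    have S': "good b S'" unfolding S'_def using S by (rule someI)
    obtain \<pi> where \<pi>: "bij \<pi>" "\<pi> ` S' = S" "\<And>i. i \<in> set_mset b \<Longrightarrow> \<pi> i = i"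
      by (rule bij_extension[of S' S "set_mset b"]) (use S S' in \<open>auto simp: good_def\<close>)
    have "image_mset \<pi> (b + mset_set S') = b + mset_set S"
      using \<pi> by (simp add: image_mset_fix image_mset_mset_set_bij)
    then show ?thesis using Fs[OF \<pi>(1), of "b + mset_set S'"] good_card[OF S] by (simp add: G_def S'_def)
  qed
  have good_im: "good (image_mset \<pi> b) (\<pi> ` S)" if "bij \<pi>" "good b S" for \<pi> b S
    using that by (auto simp: good_def card_image[OF inj_on_subset[OF bij_is_inj]])
  have Gs: "G (image_mset \<pi> b) = G b" if \<pi>: "bij \<pi>" for \<pi> b
  proof (cases "card (set_mset b) \<le> l")
    case True
    then obtain S where S: "good b S" using good_ex by blast
    then show ?thesis using G_eq[OF S] G_eq[OF good_im[OF \<pi> S]] Fs[OF \<pi>, of "b + mset_set S"] \<pi>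
      by (simp add: image_mset_mset_set_bij)
  next
    case False
    moreover have "card (set_mset (image_mset \<pi> b)) = card (set_mset b)"
      using \<pi> by (simp add: card_image[OF inj_on_subset[OF bij_is_inj]])
    ultimately show ?thesis by (simp add: G_def)
  qed
  \<comment> \<open>The coefficient of a in the product with the l-th elementary symmetric function;
    S is the squarefree monomial taken from that factor.\<close>
  define K where "K a = (\<Sum>S | S \<subseteq> set_mset a \<and> card S = l. G (a - mset_set S))" for a
  have Ks: "K (image_mset \<pi> a) = K a" if \<pi>: "bij \<pi>" for \<pi> a
  proof -
    note sub = mset_set_subset[of _ a]
    have "K a = (\<Sum>S | S \<subseteq> set_mset a \<and> card S = l. G (image_mset \<pi> a - mset_set (\<pi> ` S)))"
      unfolding K_def
    proof (rule sum.cong)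
      fix S assume "S \<in> {S. S \<subseteq> set_mset a \<and> card S = l}"
      then have "image_mset \<pi> (a - mset_set S) = image_mset \<pi> a - mset_set (\<pi> ` S)"
        using sub[of S] \<pi> by (simp add: image_mset_Diff image_mset_mset_set_bij)
      then show "G (a - mset_set S) = G (image_mset \<pi> a - mset_set (\<pi> ` S))" using Gs[OF \<pi>, of "a - mset_set S"] by simp
    qed simp
    also have "\<dots> = K (image_mset \<pi> a)"
      unfolding K_def
    proof (rule sum.reindex_bij_witness[where i = "image (inv_into UNIV \<pi>)" and j = "image \<pi>"])
      fix S assume S: "S \<in> {S. S \<subseteq> set_mset (image_mset \<pi> a) \<and> card S = l}"
      show "\<pi> ` (inv_into UNIV \<pi> ` S) = S" using \<pi> by (simp add: image_image bij_is_surj surj_f_inv_f)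
      have "inv_into UNIV \<pi> ` S \<subseteq> inv_into UNIV \<pi> ` \<pi> ` set_mset a" using S by auto
      then show "inv_into UNIV \<pi> ` S \<in> {S. S \<subseteq> set_mset a \<and> card S = l}"
        using S \<pi> by (simp add: image_image bij_is_inj card_image[OF inj_on_subset[OF bij_is_inj[OF bij_imp_bij_inv]]])
    qed (use \<pi> in \<open>auto simp: image_image bij_is_inj card_image[OF inj_on_subset[OF bij_is_inj]]\<close>)
    finally show ?thesis by simp
  qed
  \<comment> \<open>If a has exactly l variables, only S = \<open>set_mset a\<close> contributes and
    its term is F a; if it has fewer, there is no S.\<close>
  have van': "F a - K a = 0" if "size a = d" "card (set_mset a) < Suc l" for a
  proof (cases "card (set_mset a) = l")
    case True
    have "S = set_mset a" if "S \<subseteq> set_mset a" "card S = l" for S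
      using that True card_subset_eq[of "set_mset a" S] by simp
    then have *: "{S. S \<subseteq> set_mset a \<and> card S = l} = {set_mset a}" using True by auto
    have "K a = G (a - mset_set (set_mset a))" unfolding K_def * by simp
    also have "\<dots> = F (a - mset_set (set_mset a) + mset_set (set_mset a))"
      using True by (intro G_eq) (auto simp: good_def dest: in_diffD)
    also have "\<dots> = F a" by (simp add: mset_set_set_mset_msubset)
    finally show ?thesis by simp
  next
    case False
    with that have l: "card (set_mset a) < l" by simp
    then have *: "{S. S \<subseteq> set_mset a \<and> card S = l} = {}"
      using card_mono[OF finite_set_mset[of a]] by (auto simp: not_le dest: order.strict_trans1)
    show ?thesis using van[OF that(1) l] unfolding K_def * by simp
  qed
  show ?thesis
    by (rule exI[of _ G], rule exI[of _ "\<lambda>a. F a - K a"])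
       (use Gs Fs Ks van' in \<open>auto simp: symmetric_fun_def K_def\<close>)
qed

text \<open>A squarefree monomial S times a monomial b is the monomial b + S, and b is recovered
  from the pair of this product and S.\<close>

lemma esym_mult_sym_eval:
  assumes "l \<le> d"
  shows "esym y {..<N} l * sym_eval \<phi> y N (d - l) G =
    (\<Sum>a\<in>msets N d. (\<Sum>S | S \<subseteq> set_mset a \<and> card S = l. \<phi> (G (a - mset_set S))) * (\<Prod>i\<in>#a. y i))"
proof -
  have fin: "finite S" if "S \<subseteq> set_mset a" for S and a :: "nat multiset" using that finite_subset by blast
  have finN: "finite S" if "S \<subseteq> {..<N}" for S using that finite_subset by blast
  note sub = mset_set_subset
  have "esym y {..<N} l * sym_eval \<phi> y N (d - l) G =
    (\<Sum>S | S \<subseteq> {..<N} \<and> card S = l. \<Sum>b\<in>msets N (d - l). (\<Prod>i\<in>S. y i) * (\<phi> (G b) * (\<Prod>i\<in>#b. y i)))"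
    by (simp add: esym_def sym_eval_def sum_product)
  also have "\<dots> = (\<Sum>(S, b)\<in>{S. S \<subseteq> {..<N} \<and> card S = l} \<times> msets N (d - l). (\<Prod>i\<in>S. y i) * (\<phi> (G b) * (\<Prod>i\<in>#b. y i)))"
    by (simp add: sum.cartesian_product)
  also have "\<dots> = (\<Sum>(a, S)\<in>(SIGMA a:msets N d. {S. S \<subseteq> set_mset a \<and> card S = l}). \<phi> (G (a - mset_set S)) * (\<Prod>i\<in>#a. y i))"
  proof (rule sum.reindex_bij_witness[where j = "\<lambda>(S, b). (b + mset_set S, S)" and i = "\<lambda>(a, S). (S, a - mset_set S)"])
    fix p assume "p \<in> {S. S \<subseteq> {..<N} \<and> card S = l} \<times> msets N (d - l)"
    then obtain S b where p: "p = (S, b)" "S \<subseteq> {..<N}" "card S = l" "b \<in> msets N (d - l)" by auto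
    note f = finN[OF p(2)]
    show "(case case p of (S, b) \<Rightarrow> (b + mset_set S, S) of (a, S) \<Rightarrow> (S, a - mset_set S)) = p" by (simp add: p)
    show "(case p of (S, b) \<Rightarrow> (b + mset_set S, S)) \<in> (SIGMA a:msets N d. {S. S \<subseteq> set_mset a \<and> card S = l})"
      using p f assms by (auto simp: multisets_of_size_def)
    show "(case case p of (S, b) \<Rightarrow> (b + mset_set S, S) of (a, S) \<Rightarrow> \<phi> (G (a - mset_set S)) * (\<Prod>i\<in>#a. y i)) =
        (case p of (S, b) \<Rightarrow> (\<Prod>i\<in>S. y i) * (\<phi> (G b) * (\<Prod>i\<in>#b. y i)))"
      using p by (simp add: prod_unfold_prod_mset mult_ac)
  next
    fix q assume "q \<in> (SIGMA a:msets N d. {S. S \<subseteq> set_mset a \<and> card S = l})"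
    then obtain a S where q: "q = (a, S)" "a \<in> msets N d" "S \<subseteq> set_mset a" "card S = l" by auto
    note f = fin[OF q(3)] and s = sub[OF q(3)]
    show "(case case q of (a, S) \<Rightarrow> (S, a - mset_set S) of (S, b) \<Rightarrow> (b + mset_set S, S)) = q"
      using q s by simp
    show "(case q of (a, S) \<Rightarrow> (S, a - mset_set S)) \<in> {S. S \<subseteq> {..<N} \<and> card S = l} \<times> msets N (d - l)"
      using q f s by (auto simp: multisets_of_size_def size_Diff_submset dest: in_diffD)
  qed
  also have "\<dots> = (\<Sum>a\<in>msets N d. \<Sum>S | S \<subseteq> set_mset a \<and> card S = l. \<phi> (G (a - mset_set S)) * (\<Prod>i\<in>#a. y i))"
    by (subst sum.Sigma) (auto simp: finite_msets)
  finally show ?thesis by (simp add: sum_distrib_right)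
qed

text \<open>Existence in the theorem on symmetric polynomials, with one P for all N, y and \<phi>;
  \<open>E l\<close> is a preimage of the l-th elementary symmetric function. The outer induction is
  on the degree d. The inner one raises l, the least number of variables that a monomial of F may
  have; once l > d nothing of degree d is left.\<close>

theorem symmetric_polynomials:
  fixes F :: "nat multiset \<Rightarrow> 'r::comm_ring_1" and E :: "nat \<Rightarrow> 'r"
  assumes "symmetric_fun F"
  shows "\<exists>P. \<forall>N (y :: nat \<Rightarrow> 'a::comm_ring_1) \<phi>. rhom \<phi> \<longrightarrow> (\<forall>l\<ge>1. \<phi> (E l) = esym y {..<N} l) \<longrightarrow>
     sym_eval \<phi> y N d F = \<phi> P"
proof -
  define Q where "Q d F P \<longleftrightarrow> (\<forall>N (y :: nat \<Rightarrow> 'a) \<phi>. rhom \<phi> \<longrightarrow> (\<forall>l\<ge>1. \<phi> (E l) = esym y {..<N} l) \<longrightarrow>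
     sym_eval \<phi> y N d F = \<phi> P)" for d F P
  have "\<exists>P. Q d F P" if "symmetric_fun F" "\<And>a. size a = d \<Longrightarrow> card (set_mset a) < l \<Longrightarrow> F a = 0" for d l F
    using that
  proof (induction d arbitrary: l F rule: less_induct)
    case (less d)
    show ?case using less.prems
    proof (induction "Suc d - l" arbitrary: l F rule: less_induct)
      case inner: less
      consider "l > d" | "d = 0" "l = 0" | "d > 0" "l = 0" | "1 \<le> l" "l \<le> d" by linarith
      then show ?case
      proof cases
        case 1
        have "F a = 0" if "size a = d" for a using inner.prems(2)[OF that] card_set_mset_le[of a] 1 that by simp
        then have "Q d F 0" unfolding Q_def sym_eval_def by (auto simp: rhom_0 multisets_of_size_def intro!: sum.neutral)
        then show ?thesis by blast
      next
        case 2
        then have "Q d F (F {#})" unfolding Q_def sym_eval_def by simp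
        then show ?thesis by blast
      next
        case 3
        \<comment> \<open>A monomial of positive degree involves a variable, so l may be raised to
          1. Only for l \<ge> 1 does the cofactor have smaller degree.\<close>
        have "F a = 0" if "size a = d" "card (set_mset a) < 1" for a
          using that 3 by auto
        then show ?thesis using inner.hyps[of 1 F] inner.prems(1) 3 by auto
      next
        case 4
        obtain G F' where GF: "symmetric_fun G" "symmetric_fun F'"
          "\<And>a. size a = d \<Longrightarrow> card (set_mset a) < Suc l \<Longrightarrow> F' a = 0"
          "\<And>a. F a = F' a + (\<Sum>S | S \<subseteq> set_mset a \<and> card S = l. G (a - mset_set S))"
          using symmetric_reduction[OF inner.prems] by blast
        have "Suc d - Suc l < Suc d - l" using 4 by arith
        then obtain P' where P': "Q d F' P'" using inner.hyps[of "Suc l" F'] GF(2,3) by blast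
        obtain PG where PG: "Q (d - l) G PG" using less.IH[of "d - l" G 0] GF(1) 4 by auto
        have "Q d F (P' + E l * PG)" unfolding Q_def
        proof (intro allI impI)
          fix N and y :: "nat \<Rightarrow> 'a" and \<phi> :: "'r \<Rightarrow> 'a"
          assume \<phi>: "rhom \<phi>" and E: "\<forall>l\<ge>1. \<phi> (E l) = esym y {..<N} l"
          have "sym_eval \<phi> y N d F = sym_eval \<phi> y N d F' +
            (\<Sum>a\<in>msets N d. (\<Sum>S | S \<subseteq> set_mset a \<and> card S = l. \<phi> (G (a - mset_set S))) * (\<Prod>i\<in>#a. y i))"
            unfolding sym_eval_def by (subst GF(4)) (simp add: rhom_add[OF \<phi>] rhom_sum[OF \<phi>] distrib_right sum.distrib)
          also have "\<dots> = \<phi> P' + \<phi> (E l) * \<phi> PG"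
            using P' PG \<phi> E 4 by (simp add: esym_mult_sym_eval[symmetric] Q_def)
          finally show "sym_eval \<phi> y N d F = \<phi> (P' + E l * PG)" by (simp add: rhom_add[OF \<phi>] rhom_mult[OF \<phi>])
        qed
        then show ?thesis by blast
      qed
    qed
  qed
  from this[of F d 0] assms show ?thesis by (auto simp: Q_def)
qed

section \<open>Uniqueness: polynomials are determined by their values at elementary symmetric
  functions\<close>

lemma zeval_cong:
  assumes "\<And>m v. m \<in> Poly_Mapping.keys P \<Longrightarrow> v \<in> Poly_Mapping.keys m \<Longrightarrow> a v = b v"
  shows "zeval (type_ring :: 'a::comm_ring_1 ring) a P = zeval type_ring b P"
  unfolding zeval_type_ring using assms by (intro sum.cong prod.cong arg_cong2[of _ _ _ _ "(*)"]) simp_all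

text \<open>Distinct monomials are distinct characters, hence linearly independent by Artin's argument.\<close>

lemma monomials_independent:
  fixes k :: "('v \<Rightarrow>\<^sub>0 nat) \<Rightarrow> complex"
  assumes "finite M" "\<And>c :: 'v \<Rightarrow> complex. (\<Sum>m\<in>M. k m * (\<Prod>v\<in>Poly_Mapping.keys m. c v ^ Poly_Mapping.lookup m v)) = 0" "m \<in> M"
  shows "k m = 0"
  using assms
proof (induction M arbitrary: k m rule: finite_induct)
  case (insert m0 M)
  define X where "X m c = (\<Prod>v\<in>Poly_Mapping.keys m. c v ^ Poly_Mapping.lookup m v)" for m :: "'v \<Rightarrow>\<^sub>0 nat" and c :: "'v \<Rightarrow> complex"
  have mult: "X m (\<lambda>v. c v * d v) = X m c * X m d" for m c d
    by (simp add: X_def power_mult_distrib prod.distrib)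
  have rel: "k m0 * X m0 c + (\<Sum>m\<in>M. k m * X m c) = 0" for c
    using insert.prems(1)[of c] insert.hyps by (simp add: X_def)
  have rel': "(\<Sum>m\<in>M. k m * X m c) = - (k m0 * X m0 c)" for c
    using rel[of c] by (simp add: eq_neg_iff_add_eq_0 add.commute)
  \<comment> \<open>Subtracting \<open>X m0 d\<close> times the relation at c from the relation at
    the product of c and d eliminates m0.\<close>
  have 0: "k m * (X m d - X m0 d) = 0" if m: "m \<in> M" for m d
  proof (rule insert.IH[OF _ m])
    fix c
    have "(\<Sum>m\<in>M. k m * (X m d - X m0 d) * X m c) = (\<Sum>m\<in>M. k m * X m (\<lambda>v. c v * d v)) - X m0 d * (\<Sum>m\<in>M. k m * X m c)"
      by (simp add: mult sum_distrib_left sum_subtractf[symmetric] algebra_simps)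
    also have "\<dots> = - (k m0 * X m0 (\<lambda>v. c v * d v)) - X m0 d * (- (k m0 * X m0 c))"
      by (simp only: rel')
    also have "\<dots> = 0" by (simp add: mult)
    finally show "(\<Sum>m\<in>M. k m * (X m d - X m0 d) * (\<Prod>v\<in>Poly_Mapping.keys m. c v ^ Poly_Mapping.lookup m v)) = 0"
      by (simp add: X_def)
  qed
  have km: "k m = 0" if m: "m \<in> M" for m
  proof -
    have "m \<noteq> m0" using m insert.hyps by blast
    then obtain v where v: "Poly_Mapping.lookup m v \<noteq> Poly_Mapping.lookup m0 v" by (meson poly_mapping_eqI)
    \<comment> \<open>A point that separates the two monomials: it is 2 at a variable where the
      exponents differ and 1 elsewhere.\<close>
    define d where "d = (\<lambda>w. if w = v then 2 else 1 :: complex)"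
    have X: "X m d = 2 ^ Poly_Mapping.lookup m v" for m
    proof (cases "v \<in> Poly_Mapping.keys m")
      case True
      have "X m d = (\<Prod>w\<in>Poly_Mapping.keys m. if w = v then 2 ^ Poly_Mapping.lookup m w else 1)"
        unfolding X_def d_def by (intro prod.cong) auto
      with True show ?thesis by simp
    next
      case False
      then show ?thesis unfolding X_def d_def by (subst prod.neutral) (auto simp: in_keys_iff)
    qed
    have "(2::complex) ^ Poly_Mapping.lookup m v = of_nat (2 ^ Poly_Mapping.lookup m v)"
      "(2::complex) ^ Poly_Mapping.lookup m0 v = of_nat (2 ^ Poly_Mapping.lookup m0 v)" by simp_all
    then have "X m d \<noteq> X m0 d" unfolding X using v by (simp only: of_nat_eq_iff power_inject_exp)  simp
    then show ?thesis using 0[OF m, of d] by simp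
  qed
  moreover have "k m0 = 0" using rel[of "\<lambda>_. 1"] km by (simp add: X_def)
  ultimately show ?case using insert.prems(2) by auto
qed simp

lemma zpoly_eq_0I: assumes "\<And>c :: 'v \<Rightarrow> complex. zeval type_ring c P = 0" shows "P = 0"
proof (rule poly_mapping_eqI)
  fix m
  have "m \<in> Poly_Mapping.keys P \<Longrightarrow> complex_of_int (Poly_Mapping.lookup P m) = 0"
    by (rule monomials_independent[OF finite_keys[of P], of "\<lambda>m. of_int (Poly_Mapping.lookup P m)"])
       (use assms in \<open>simp_all add: zeval_type_ring\<close>)
  then show "Poly_Mapping.lookup P m = Poly_Mapping.lookup 0 m" by (auto simp: in_keys_iff)
qed

lemma degree_0_coeff_1: "degree p = 0 \<Longrightarrow> Polynomial.coeff p 0 = 1 \<Longrightarrow> p = 1"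
  by (auto elim!: degree_eq_zeroE simp: one_pCons)

lemma linear_factorization:
  fixes p :: "complex poly"
  assumes "Polynomial.coeff p 0 = 1" "degree p \<le> N"
  shows "\<exists>x. p = (\<Prod>k<N. [:1, x k:])"
  using assms
proof (induction N arbitrary: p)
  case 0
  then show ?case using degree_0_coeff_1[of p] by simp
next
  case (Suc N)
  show ?case
  proof (cases "degree p = 0")
    case True
    then have "p = 1" using Suc.prems(1) by (rule degree_0_coeff_1)
    then show ?thesis by (intro exI[of _ "\<lambda>_. 0"]) (simp add: one_pCons[symmetric])
  next
    case False
    then have "\<not> constant (poly p)" by (simp add: constant_degree)
    then obtain r where r: "poly p r = 0" using fundamental_theorem_of_algebra by blast
    then obtain q where q: "p = [:- r, 1:] * q" by (auto simp: poly_eq_0_iff_dvd dvd_def)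
    have r0: "r \<noteq> 0" using r Suc.prems(1) by (auto simp: poly_0_coeff_0)
    define q' where "q' = smult (- r) q"
    have p: "p = q' * [:1, - 1 / r:]"
      using r0 by (simp add: q q'_def algebra_simps)
    have "Polynomial.coeff q' 0 = 1" using Suc.prems(1) by (simp add: p coeff_mult)
    moreover have "degree q' \<le> N"
    proof -
      have "q' \<noteq> 0" using p False by auto
      then have "degree p = degree q' + degree [:1, - 1 / r:]" unfolding p using r0 by (intro degree_mult_eq) auto
      then show ?thesis using Suc.prems(2) r0 by simp
    qed
    ultimately obtain x where "q' = (\<Prod>k<N. [:1, x k:])" using Suc.IH by blast
    then have "p = (\<Prod>k<Suc N. [:1, (x(N := - 1 / r)) k:])" by (simp add: p)
    then show ?thesis by blast
  qed
qed

text \<open>Prescribed coefficients are put into a polynomial with constant term 1, which splits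
  over the complex numbers. This replaces a proof that the elementary symmetric functions are
  algebraically independent.\<close>

lemma realize_coeffs:
  fixes c :: "nat \<Rightarrow> complex"
  obtains N x where "\<And>i. i < K \<Longrightarrow> esym x {..<N::nat} (Suc i) = c i"
proof -
  define p where "p = Poly (1 # map c [0..<K])"
  have co: "Polynomial.coeff p (Suc i) = c i" if "i < K" for i
    using that by (simp add: p_def nth_default_def)
  have "Polynomial.coeff p 0 = 1" by (simp add: p_def)
  then obtain x where "p = (\<Prod>k<degree p. [:1, x k:])" using linear_factorization by blast
  then have "esym x {..<degree p} (Suc i) = c i" if "i < K" for i
    using co[OF that] coeff_prod_linear[of "{..<degree p}" x "Suc i"] by simp
  then show ?thesis by (rule that)
qed

lemma finite_vars: "finite (\<Union>m\<in>Poly_Mapping.keys P. Poly_Mapping.keys m)"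
  by simp

text \<open>P - Q involves finitely many variables, so at any complex point its value is one at
  elementary symmetric functions and vanishes.\<close>

lemma zpoly_eqI:
  assumes "\<And>N x. zeval type_ring (\<lambda>i. esym (x :: nat \<Rightarrow> complex) {..<N::nat} (Suc i)) P = zeval type_ring (\<lambda>i. esym x {..<N} (Suc i)) Q"
  shows "P = Q"
proof -
  have "P - Q = 0"
  proof (rule zpoly_eq_0I)
    fix c :: "nat \<Rightarrow> complex"
    obtain K where K: "\<And>m v. m \<in> Poly_Mapping.keys (P - Q) \<Longrightarrow> v \<in> Poly_Mapping.keys m \<Longrightarrow> v < K"
      using finite_vars[of "P - Q"] unfolding finite_nat_set_iff_bounded by blast
    obtain N x where x: "\<And>i. i < K \<Longrightarrow> esym x {..<N::nat} (Suc i) = c i" using realize_coeffs by blast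
    have "zeval type_ring c (P - Q) = zeval type_ring (\<lambda>i. esym x {..<N} (Suc i)) (P - Q)"
      by (rule zeval_cong) (simp add: x K)
    then show "zeval type_ring c (P - Q) = 0" using assms[of x N] by (simp add: rhom_diff[OF zeval_rhom])
  qed
  then show ?thesis by simp
qed

lemma zpoly_eqI2:
  assumes "\<And>N x M y. zeval type_ring (case_sum (\<lambda>i. esym (x :: nat \<Rightarrow> complex) {..<N::nat} (Suc i)) (\<lambda>j. esym y {..<M::nat} (Suc j))) P
    = zeval type_ring (case_sum (\<lambda>i. esym x {..<N} (Suc i)) (\<lambda>j. esym y {..<M} (Suc j))) Q"
  shows "P = Q"
proof -
  have "P - Q = 0"
  proof (rule zpoly_eq_0I)
    fix c :: "nat + nat \<Rightarrow> complex"
    let ?V = "\<Union>m\<in>Poly_Mapping.keys (P - Q). Poly_Mapping.keys m"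
    have "finite (Inl -` ?V)" "finite (Inr -` ?V)"
      using finite_vars[of "P - Q"] by (auto intro!: finite_vimageI)
    then obtain K L where K: "\<forall>i\<in>Inl -` ?V. i < K" and L: "\<forall>i\<in>Inr -` ?V. i < L"
      unfolding finite_nat_set_iff_bounded by metis
    obtain N x where x: "\<And>i. i < K \<Longrightarrow> esym x {..<N::nat} (Suc i) = c (Inl i)"
      using realize_coeffs[of K "\<lambda>i. c (Inl i)"] by blast
    obtain M y where y: "\<And>i. i < L \<Longrightarrow> esym y {..<M::nat} (Suc i) = c (Inr i)"
      using realize_coeffs[of L "\<lambda>i. c (Inr i)"] by blast
    have "c v = case_sum (\<lambda>i. esym x {..<N} (Suc i)) (\<lambda>j. esym y {..<M} (Suc j)) v" if "v \<in> ?V" for v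
    proof (cases v)
      case (Inl i)
      then show ?thesis using that x[of i] K by simp
    next
      case (Inr i)
      then show ?thesis using that y[of i] L by simp
    qed
    then have "zeval type_ring c (P - Q) = zeval type_ring (case_sum (\<lambda>i. esym x {..<N} (Suc i)) (\<lambda>j. esym y {..<M} (Suc j))) (P - Q)"
      by (intro zeval_cong) blast
    then show "zeval type_ring c (P - Q) = 0" using assms[of x N y M] by (simp add: rhom_diff[OF zeval_rhom])
  qed
  then show ?thesis by simp
qed

section \<open>Existence and evaluation of the universal polynomials\<close>

lemma size_sum_mset: "size (\<Sum>x\<in>A. f x :: 'a multiset) = (\<Sum>x\<in>A. size (f x))"
  by (induction A rule: infinite_finite_induct) simp_all

lemma set_sum_mset: "finite A \<Longrightarrow> set_mset (\<Sum>x\<in>A. f x) = (\<Union>x\<in>A. set_mset (f x))"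
  by (induction A rule: finite_induct) simp_all

lemma prod_sum_mset: "(\<Prod>i\<in>#(\<Sum>x\<in>A. f x). y i) = (\<Prod>x\<in>A. \<Prod>i\<in>#f x. y i :: 'a::comm_ring_1)"
  by (induction A rule: infinite_finite_induct) simp_all

lemma image_sum_mset: "image_mset g (\<Sum>x\<in>A. f x) = (\<Sum>x\<in>A. image_mset g (f x))"
  by (induction A rule: infinite_finite_induct) simp_all

text \<open>Its cardinality is the coefficient of the monomial a in the coefficient of t^n of the
  product of all 1 + x_S t, where S runs over the m-element sets and x_S is the product of its
  variables.\<close>

definition lam_family :: "nat \<Rightarrow> nat \<Rightarrow> nat multiset \<Rightarrow> nat set set set" where
  "lam_family m n a = {T. finite T \<and> card T = n \<and> (\<forall>S\<in>T. finite S \<and> card S = m) \<and> (\<Sum>S\<in>T. mset_set S) = a}"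

lemma lam_family_image: assumes \<pi>: "bij \<pi>" "T \<in> lam_family m n a"
  shows "image \<pi> ` T \<in> lam_family m n (image_mset \<pi> a)"
proof -
  have i: "inj_on (image \<pi>) A" for A using \<pi>(1) by (meson bij_is_inj inj_image_eq_iff inj_onI)
  have "(\<Sum>S\<in>image \<pi> ` T. mset_set S) = image_mset \<pi> a"
    using \<pi> by (subst sum.reindex[OF i]) (auto simp: lam_family_def image_sum_mset image_mset_mset_set_bij)
  then show ?thesis using \<pi> i by (auto simp: lam_family_def card_image inj_on_subset[OF bij_is_inj])
qed

lemma lam_family_symmetric: "symmetric_fun (\<lambda>a. of_nat (card (lam_family m n a)))"
  unfolding symmetric_fun_def
proof (intro allI impI)
  fix \<pi> :: "nat \<Rightarrow> nat" and a assume \<pi>: "bij \<pi>"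
  let ?\<pi>' = "inv_into UNIV \<pi>"
  have \<pi>': "bij ?\<pi>'" using \<pi> by (rule bij_imp_bij_inv)
  have inv: "?\<pi>' \<circ> \<pi> = id" "\<pi> \<circ> ?\<pi>' = id" using \<pi> by (auto simp: bij_is_inj surj_iff[symmetric] bij_is_surj)
  have ii: "image ?\<pi>' ` image \<pi> ` T = T" "image \<pi> ` image ?\<pi>' ` T = T" for T
    by (auto simp: image_comp inv image_image)
  have a: "image_mset ?\<pi>' (image_mset \<pi> a) = a" by (simp add: multiset.map_comp inv)
  have "bij_betw (image (image \<pi>)) (lam_family m n a) (lam_family m n (image_mset \<pi> a))"
    by (rule bij_betwI[where g = "image (image ?\<pi>')"])
       (use lam_family_image[OF \<pi>] lam_family_image[OF \<pi>', of _ m n "image_mset \<pi> a"] ii a in auto)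
  then show "of_nat (card (lam_family m n (image_mset \<pi> a))) = of_nat (card (lam_family m n a))"
    by (simp add: bij_betw_same_card)
qed

lemma lam_esym_eval:
  assumes "rhom \<phi>"
  shows "esym (\<lambda>S. \<Prod>i\<in>S. x i) {S. S \<subseteq> {..<N} \<and> card S = m} n = sym_eval \<phi> x N (n * m) (\<lambda>a. of_nat (card (lam_family m n a)))"
proof -
  let ?B = "{S. S \<subseteq> {..<N} \<and> card S = m}"
  define D where "D = {T. T \<subseteq> ?B \<and> card T = n}"
  have fB: "finite ?B" by simp
  have fD: "finite D" unfolding D_def using fB by simp
  have fT: "finite T" if "T \<in> D" for T using that fB finite_subset unfolding D_def by blast
  have fS: "finite S" if "S \<subseteq> {..<N}" for S using that finite_subset by blast
  define g where "g T = (\<Sum>S\<in>T. mset_set S)" for T :: "nat set set"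
  have gD: "g T \<in> msets N (n * m)" if T: "T \<in> D" for T
  proof -
    have "size (g T) = (\<Sum>S\<in>T. m)" unfolding g_def size_sum_mset using T by (intro sum.cong) (auto simp: D_def)
    moreover have "set_mset (g T) \<subseteq> {..<N}" 
    proof -
      have "set_mset (mset_set S) \<subseteq> {..<N}" if "S \<in> T" for S
      proof -
        have "S \<subseteq> {..<N}" using that T by (auto simp: D_def)
        then show ?thesis using fS[of S] by simp
      qed
      then show ?thesis unfolding g_def set_sum_mset[OF fT[OF T]] by blast
    qed
    ultimately show ?thesis using T by (simp add: multisets_of_size_def D_def)
  qed
  have h: "(\<Prod>S\<in>T. \<Prod>i\<in>S. x i) = (\<Prod>i\<in>#g T. x i)" for T
    by (simp add: g_def prod_sum_mset prod_unfold_prod_mset)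
  have fib: "{T \<in> D. g T = a} = lam_family m n a" if a: "a \<in> msets N (n * m)" for a
  proof (intro equalityI subsetI)
    fix T assume T: "T \<in> lam_family m n a"
    have "S \<subseteq> {..<N}" if S: "S \<in> T" for S
    proof -
      have "finite T" "finite S" "(\<Sum>S\<in>T. mset_set S) = a" using T S by (auto simp: lam_family_def)
      then have "S \<subseteq> set_mset a" using S set_sum_mset[of T mset_set] by auto
      then show ?thesis using a by (auto simp: multisets_of_size_def)
    qed
    then show "T \<in> {T \<in> D. g T = a}" using T by (auto simp: D_def g_def lam_family_def)
  qed (auto simp: D_def g_def lam_family_def fS intro: finite_subset[OF _ fB])
  have "esym (\<lambda>S. \<Prod>i\<in>S. x i) ?B n = (\<Sum>T\<in>D. \<Prod>i\<in>#g T. x i)"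
    by (simp add: esym_def D_def h)
  also have "\<dots> = (\<Sum>a\<in>msets N (n * m). \<Sum>T | T \<in> D \<and> g T = a. \<Prod>i\<in>#g T. x i)"
    by (rule sum.group[symmetric]) (use fD finite_msets gD in auto)
  also have "\<dots> = (\<Sum>a\<in>msets N (n * m). of_nat (card (lam_family m n a)) * (\<Prod>i\<in>#a. x i))"
  proof (rule sum.cong)
    fix a assume a: "a \<in> msets N (n * m)"
    have "(\<Sum>T | T \<in> D \<and> g T = a. \<Prod>i\<in>#g T. x i) = (\<Sum>T | T \<in> D \<and> g T = a. \<Prod>i\<in>#a. x i)" by (rule sum.cong) auto
    then show "(\<Sum>T | T \<in> D \<and> g T = a. \<Prod>i\<in>#g T. x i) = of_nat (card (lam_family m n a)) * (\<Prod>i\<in>#a. x i)"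
      by (simp add: fib[OF a])
  qed simp
  finally show ?thesis by (simp add: sym_eval_def rhom_of_nat[OF assms])
qed

text \<open>Zero-one matrices with n ones and with row and column sums a and b. Their number is the
  coefficient of x^a y^b in the n-th elementary symmetric function of the products x_i y_j.\<close>

definition mult_family :: "nat \<Rightarrow> nat multiset \<Rightarrow> nat multiset \<Rightarrow> (nat \<times> nat) set set" where
  "mult_family n b a = {T. finite T \<and> card T = n \<and> image_mset fst (mset_set T) = a \<and> image_mset snd (mset_set T) = b}"

lemma mult_family_image: assumes "bij \<pi>" "bij \<tau>" "T \<in> mult_family n b a"
  shows "map_prod \<pi> \<tau> ` T \<in> mult_family n (image_mset \<tau> b) (image_mset \<pi> a)"
proof -
  have i: "inj_on (map_prod \<pi> \<tau>) A" for A
    using prod.inj_map[OF bij_is_inj[OF assms(1)] bij_is_inj[OF assms(2)]] by (rule inj_on_subset) simp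
  have m: "mset_set (map_prod \<pi> \<tau> ` T) = image_mset (map_prod \<pi> \<tau>) (mset_set T)"
    by (rule image_mset_mset_set[symmetric, OF i])
  have "image_mset fst (mset_set (map_prod \<pi> \<tau> ` T)) = image_mset \<pi> (image_mset fst (mset_set T))"
    "image_mset snd (mset_set (map_prod \<pi> \<tau> ` T)) = image_mset \<tau> (image_mset snd (mset_set T))"
    unfolding m by (simp_all add: multiset.map_comp comp_def)
  then show ?thesis using assms i by (auto simp: mult_family_def card_image)
qed

lemma mult_family_card: assumes \<pi>: "bij \<pi>" and \<tau>: "bij \<tau>"
  shows "card (mult_family n (image_mset \<tau> b) (image_mset \<pi> a)) = card (mult_family n b a)"
proof -
  let ?\<pi>' = "inv_into UNIV \<pi>" and ?\<tau>' = "inv_into UNIV \<tau>"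
  have p: "?\<pi>' (\<pi> i) = i" "\<pi> (?\<pi>' i) = i" "?\<tau>' (\<tau> i) = i" "\<tau> (?\<tau>' i) = i" for i
    using \<pi> \<tau> by (simp_all add: bij_is_inj bij_is_surj surj_f_inv_f)
  have a: "image_mset ?\<pi>' (image_mset \<pi> a) = a" "image_mset ?\<tau>' (image_mset \<tau> b) = b" for a b
    by (simp_all add: multiset.map_comp comp_def p)
  have ii: "map_prod ?\<pi>' ?\<tau>' ` map_prod \<pi> \<tau> ` T = T" "map_prod \<pi> \<tau> ` map_prod ?\<pi>' ?\<tau>' ` T = T" for T
    by (simp_all add: image_image map_prod_def case_prod_unfold p)
  have "bij_betw (image (map_prod \<pi> \<tau>)) (mult_family n b a) (mult_family n (image_mset \<tau> b) (image_mset \<pi> a))"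
    by (rule bij_betwI[where g = "image (map_prod ?\<pi>' ?\<tau>')"])
       (use mult_family_image[OF \<pi> \<tau>] mult_family_image[OF bij_imp_bij_inv[OF \<pi>] bij_imp_bij_inv[OF \<tau>], of _ n "image_mset \<tau> b" "image_mset \<pi> a"] ii a in auto)
  then show ?thesis by (simp add: bij_betw_same_card)
qed

lemma mult_esym_eval:
  "esym (\<lambda>(i, j). x i * y j :: 'a::comm_ring_1) ({..<N} \<times> {..<M}) n =
   (\<Sum>b\<in>msets M n. (\<Sum>a\<in>msets N n. of_nat (card (mult_family n b a)) * (\<Prod>i\<in>#a. x i)) * (\<Prod>j\<in>#b. y j))"
proof -
  let ?B = "{..<N} \<times> {..<M}"
  define D where "D = {T. T \<subseteq> ?B \<and> card T = n}"
  have fB: "finite ?B" by simp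
  have fD: "finite D" unfolding D_def using fB by simp
  have fT: "finite T" if "T \<in> D" for T using that fB finite_subset unfolding D_def by blast
  define g where "g T = (image_mset snd (mset_set T), image_mset fst (mset_set T))" for T :: "(nat \<times> nat) set"
  have gD: "g T \<in> msets M n \<times> msets N n" if T: "T \<in> D" for T
    using T fT[OF T] by (auto simp: g_def D_def multisets_of_size_def)
  have h: "(\<Prod>p\<in>T. case p of (i, j) \<Rightarrow> x i * y j) = (\<Prod>i\<in>#snd (g T). x i) * (\<Prod>j\<in>#fst (g T). y j)" for T
    by (simp add: g_def prod_unfold_prod_mset multiset.map_comp comp_def case_prod_unfold prod_mset.distrib)
  have fib: "{T \<in> D. g T = (b, a)} = mult_family n b a" if a: "b \<in> msets M n" "a \<in> msets N n" for a b
  proof (intro equalityI subsetI)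
    fix T assume T: "T \<in> mult_family n b a"
    then have f: "finite T" by (simp add: mult_family_def)
    have "a = image_mset fst (mset_set T)" "b = image_mset snd (mset_set T)" using T by (auto simp: mult_family_def)
    then have "set_mset a = fst ` T" "set_mset b = snd ` T" using f by simp_all
    then have "fst ` T \<subseteq> {..<N}" "snd ` T \<subseteq> {..<M}"
      using a by (simp_all add: multisets_of_size_def)
    then have "T \<subseteq> ?B" using subset_fst_snd[of T] by blast
    then show "T \<in> {T \<in> D. g T = (b, a)}" using T by (auto simp: D_def g_def mult_family_def)
  qed (auto simp: D_def g_def mult_family_def intro: finite_subset[OF _ fB])
  have "esym (\<lambda>(i, j). x i * y j) ?B n = (\<Sum>T\<in>D. (\<Prod>i\<in>#snd (g T). x i) * (\<Prod>j\<in>#fst (g T). y j))"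
    by (simp add: esym_def D_def h)
  also have "\<dots> = (\<Sum>q\<in>msets M n \<times> msets N n. \<Sum>T | T \<in> D \<and> g T = q. (\<Prod>i\<in>#snd (g T). x i) * (\<Prod>j\<in>#fst (g T). y j))"
    by (rule sum.group[symmetric]) (use fD gD in \<open>simp_all add: finite_msets image_subset_iff\<close>)
  also have "\<dots> = (\<Sum>(b, a)\<in>msets M n \<times> msets N n. of_nat (card (mult_family n b a)) * (\<Prod>i\<in>#a. x i) * (\<Prod>j\<in>#b. y j))"
  proof (rule sum.cong)
    fix q assume "q \<in> msets M n \<times> msets N n"
    then obtain b a where q: "q = (b, a)" "b \<in> msets M n" "a \<in> msets N n" by auto
    have "(\<Sum>T | T \<in> D \<and> g T = q. (\<Prod>i\<in>#snd (g T). x i) * (\<Prod>j\<in>#fst (g T). y j)) = (\<Sum>T | T \<in> D \<and> g T = q. (\<Prod>i\<in>#a. x i) * (\<Prod>j\<in>#b. y j))"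
      by (rule sum.cong) (auto simp: q)
    then show "(\<Sum>T | T \<in> D \<and> g T = q. (\<Prod>i\<in>#snd (g T). x i) * (\<Prod>j\<in>#fst (g T). y j)) = (case q of (b, a) \<Rightarrow> of_nat (card (mult_family n b a)) * (\<Prod>i\<in>#a. x i) * (\<Prod>j\<in>#b. y j))"
      using fib[OF q(2,3)] by (simp add: q mult.assoc)
  qed simp
  finally show ?thesis by (simp add: sum.cartesian_product sum_distrib_right)
qed

lemma esym_zvar_eval: "zeval (type_ring :: 'a::comm_ring_1 ring) x (esym zvar I n) = esym x I n"
  by (simp add: rhom_esym[OF zeval_rhom])

lemma univ_lam_exists:
  "\<exists>P. \<forall>N. zeval type_ring (\<lambda>i. esym (zvar :: nat \<Rightarrow> nat zpoly) {..<N} (Suc i)) P =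
     esym (\<lambda>S. \<Prod>i\<in>S. zvar i) {S. S \<subseteq> {..<N} \<and> card S = m} n"
proof -
  obtain P where P: "\<And>N (y :: nat \<Rightarrow> nat zpoly) \<phi>. rhom \<phi> \<Longrightarrow> (\<forall>l\<ge>1. \<phi> (zvar (l - 1)) = esym y {..<N} l) \<Longrightarrow>
     sym_eval \<phi> y N (n * m) (\<lambda>a. of_nat (card (lam_family m n a))) = \<phi> P"
    using symmetric_polynomials[OF lam_family_symmetric, of "\<lambda>l. zvar (l - 1) :: nat zpoly" "n * m" m n] by blast
  have "zeval type_ring (\<lambda>i. esym (zvar :: nat \<Rightarrow> nat zpoly) {..<N} (Suc i)) P =
     esym (\<lambda>S. \<Prod>i\<in>S. zvar i) {S. S \<subseteq> {..<N} \<and> card S = m} n" for N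
    unfolding lam_esym_eval[OF zeval_rhom[of "\<lambda>i. esym (zvar :: nat \<Rightarrow> nat zpoly) {..<N} (Suc i)"]]
    by (rule P[OF zeval_rhom, symmetric]) simp
  then show ?thesis by blast
qed

text \<open>Substituting values for the variables transports the defining identities to every
  commutative ring. Over the complex numbers this gives uniqueness, so the definite description
  denotes and inherits them.\<close>

lemma univ_lam_eval:
  fixes x :: "nat \<Rightarrow> 'a::comm_ring_1"
  shows "zeval type_ring (\<lambda>i. esym x {..<N} (Suc i)) (univ_lam_poly m n) =
    esym (\<lambda>S. \<Prod>i\<in>S. x i) {S. S \<subseteq> {..<N} \<and> card S = m} n"
proof -
  define spec where "spec P \<longleftrightarrow> (\<forall>N. zeval type_ring (\<lambda>i. esym (zvar :: nat \<Rightarrow> nat zpoly) {..<N} (Suc i)) P =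
     esym (\<lambda>S. \<Prod>i\<in>S. zvar i) {S. S \<subseteq> {..<N} \<and> card S = m} n)" for P
  have ev: "zeval type_ring (\<lambda>i. esym x {..<N} (Suc i)) P = esym (\<lambda>S. \<Prod>i\<in>S. x i) {S. S \<subseteq> {..<N} \<and> card S = m} n"
    if "spec P" for P N and x :: "nat \<Rightarrow> 'b::comm_ring_1"
  proof -
    let ?h = "zeval type_ring x"
    have "?h (zeval type_ring (\<lambda>i. esym zvar {..<N} (Suc i)) P) = ?h (esym (\<lambda>S. \<Prod>i\<in>S. zvar i) {S. S \<subseteq> {..<N} \<and> card S = m} n)"
      using that by (simp add: spec_def)
    then show ?thesis
      by (simp add: rhom_zeval[OF zeval_rhom] comp_def esym_zvar_eval rhom_esym[OF zeval_rhom] rhom_prod[OF zeval_rhom])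
  qed
  have "univ_lam_poly m n = (THE P. spec P)"
    unfolding univ_lam_poly_def spec_def Let_def by (simp add: coeff_prod_linear)
  moreover obtain P where P: "spec P" using univ_lam_exists unfolding spec_def by blast
  moreover have "Q = P" if "spec Q" for Q
    by (rule zpoly_eqI) (simp add: ev[OF that] ev[OF P])
  ultimately have "spec (univ_lam_poly m n)" by (metis theI)
  then show ?thesis by (rule ev)
qed

text \<open>The theorem on symmetric polynomials is used twice. For fixed b the x-part is symmetric
  and gives a polynomial \<open>PP b\<close>; these polynomials are in turn the coefficients of a
  symmetric function of the y variables.\<close>

lemma univ_mult_exists:
  "\<exists>P. \<forall>N M. zeval type_ring (case_sum (\<lambda>i. esym (\<lambda>i. zvar (Inl i) :: (nat + nat) zpoly) {..<N} (Suc i))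
        (\<lambda>j. esym (\<lambda>j. zvar (Inr j)) {..<M} (Suc j))) P =
     esym (\<lambda>(i, j). zvar (Inl i) * zvar (Inr j)) ({..<N} \<times> {..<M}) n"
proof -
  define F where "F b a = (of_nat (card (mult_family n b a)) :: (nat + nat) zpoly)" for b a
  have Fs: "symmetric_fun (F b)" for b
    using mult_family_card[OF _ bij_id, of _ n b] by (auto simp: symmetric_fun_def F_def)
  have Fb: "F (image_mset \<tau> b) = F b" if "bij \<tau>" for \<tau> b
    using mult_family_card[OF bij_id that, of n b] by (auto simp: F_def fun_eq_iff)
  define good where "good f P \<longleftrightarrow> (\<forall>N (y :: nat \<Rightarrow> (nat + nat) zpoly) \<phi>. rhom \<phi> \<longrightarrow> (\<forall>l\<ge>1. \<phi> (zvar (Inl (l - 1))) = esym y {..<N} l) \<longrightarrow>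
     sym_eval \<phi> y N n f = \<phi> P)" for f and P :: "(nat + nat) zpoly"
  have "\<exists>P. good (F b) P" for b
    using symmetric_polynomials[OF Fs, of "\<lambda>l. zvar (Inl (l - 1))" n b] unfolding good_def .
  \<comment> \<open>The choice depends on b only through \<open>F b\<close>, which is invariant
    under permuting b. Hence \<open>PP\<close> is itself symmetric.\<close>
  define PP where "PP b = (SOME P. good (F b) P)" for b
  have PP: "good (F b) (PP b)" for b unfolding PP_def by (rule someI_ex) fact
  have "symmetric_fun PP" by (simp add: symmetric_fun_def PP_def Fb)
  then obtain P where P: "\<And>N (y :: nat \<Rightarrow> (nat + nat) zpoly) \<phi>. rhom \<phi> \<Longrightarrow> (\<forall>l\<ge>1. \<phi> (zvar (Inr (l - 1))) = esym y {..<N} l) \<Longrightarrow>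
     sym_eval \<phi> y N n PP = \<phi> P"
    using symmetric_polynomials[of PP "\<lambda>l. zvar (Inr (l - 1)) :: (nat + nat) zpoly" n] by blast
  have "zeval type_ring (case_sum (\<lambda>i. esym (\<lambda>i. zvar (Inl i)) {..<N} (Suc i)) (\<lambda>j. esym (\<lambda>j. zvar (Inr j)) {..<M} (Suc j))) P =
     esym (\<lambda>(i, j). zvar (Inl i) * zvar (Inr j)) ({..<N} \<times> {..<M}) n" for N M :: nat
  proof -
    let ?x = "\<lambda>i. zvar (Inl i) :: (nat + nat) zpoly" and ?y = "\<lambda>j. zvar (Inr j) :: (nat + nat) zpoly"
    let ?\<phi> = "zeval type_ring (case_sum (\<lambda>i. esym ?x {..<N} (Suc i)) (\<lambda>j. esym ?y {..<M} (Suc j)))"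
    have r: "rhom ?\<phi>" by (rule zeval_rhom)
    have "sym_eval ?\<phi> ?y M n PP = ?\<phi> P" by (rule P[OF r]) simp
    moreover have "?\<phi> (PP b) = (\<Sum>a\<in>msets N n. of_nat (card (mult_family n b a)) * (\<Prod>i\<in>#a. ?x i))" for b
    proof -
      have "sym_eval ?\<phi> ?x N n (F b) = ?\<phi> (PP b)" using PP[of b] r unfolding good_def by simp
      then show ?thesis by (simp add: sym_eval_def F_def rhom_of_nat[OF r])
    qed
    ultimately show ?thesis by (simp add: sym_eval_def mult_esym_eval)
  qed
  then show ?thesis by blast
qed

lemma coeff_prod_prod: "Polynomial.coeff (\<Prod>i<N. \<Prod>j<M. [:1, x i * y j:]) n = esym (\<lambda>(i, j). x i * y j) ({..<N::nat} \<times> {..<M::nat}) n"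
proof -
  have "(\<Prod>i<N. \<Prod>j<M. [:1, x i * y j:]) = (\<Prod>p\<in>{..<N} \<times> {..<M}. [:1, case p of (i, j) \<Rightarrow> x i * y j:])"
    by (simp add: prod.cartesian_product case_prod_unfold)
  then show ?thesis by (simp only: coeff_prod_linear[OF finite_cartesian_product[OF finite_lessThan finite_lessThan]])
qed

lemma univ_mult_eval:
  fixes x y :: "nat \<Rightarrow> 'a::comm_ring_1"
  shows "zeval type_ring (case_sum (\<lambda>i. esym x {..<N} (Suc i)) (\<lambda>j. esym y {..<M} (Suc j))) (univ_mult_poly n) =
    esym (\<lambda>(i, j). x i * y j) ({..<N} \<times> {..<M}) n"
proof -
  define spec where "spec P \<longleftrightarrow> (\<forall>N M. zeval type_ring (case_sum (\<lambda>i. esym (\<lambda>i. zvar (Inl i) :: (nat + nat) zpoly) {..<N} (Suc i))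
        (\<lambda>j. esym (\<lambda>j. zvar (Inr j)) {..<M} (Suc j))) P =
     esym (\<lambda>(i, j). zvar (Inl i) * zvar (Inr j)) ({..<N} \<times> {..<M}) n)" for P
  have ev: "zeval type_ring (case_sum (\<lambda>i. esym x {..<N} (Suc i)) (\<lambda>j. esym y {..<M} (Suc j))) P =
    esym (\<lambda>(i, j). x i * y j) ({..<N} \<times> {..<M}) n"
    if "spec P" for P N M and x y :: "nat \<Rightarrow> 'b::comm_ring_1"
  proof -
    let ?h = "zeval type_ring (case_sum x y)"
    have "?h (zeval type_ring (case_sum (\<lambda>i. esym (\<lambda>i. zvar (Inl i)) {..<N} (Suc i)) (\<lambda>j. esym (\<lambda>j. zvar (Inr j)) {..<M} (Suc j))) P)
      = ?h (esym (\<lambda>(i, j). zvar (Inl i) * zvar (Inr j)) ({..<N} \<times> {..<M}) n)"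
      using that by (simp add: spec_def)
    moreover have "?h \<circ> case_sum (\<lambda>i. esym (\<lambda>i. zvar (Inl i)) {..<N} (Suc i)) (\<lambda>j. esym (\<lambda>j. zvar (Inr j)) {..<M} (Suc j)) =
      case_sum (\<lambda>i. esym x {..<N} (Suc i)) (\<lambda>j. esym y {..<M} (Suc j))"
      by (rule ext) (auto simp: rhom_esym[OF zeval_rhom] split: sum.split)
    ultimately show ?thesis
      by (simp add: rhom_zeval[OF zeval_rhom] rhom_esym[OF zeval_rhom] rhom_mult[OF zeval_rhom] case_prod_unfold)
  qed
  have "univ_mult_poly n = (THE P. spec P)"
    unfolding univ_mult_poly_def spec_def Let_def by (simp only: coeff_prod_linear[OF finite_lessThan] coeff_prod_prod)
  moreover obtain P where P: "spec P" using univ_mult_exists unfolding spec_def by blast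
  moreover have "Q = P" if "spec Q" for Q
    by (rule zpoly_eqI2) (simp add: ev[OF that] ev[OF P])
  ultimately have "spec (univ_mult_poly n)" by (metis theI)
  then show ?thesis by (rule ev)
qed

section \<open>Power sums\<close>

text \<open>Variable i stands for the coefficient of t^(i+1); this restores the constant coefficient
  and the usual numbering.\<close>

definition with_one :: "(nat \<Rightarrow> 'a::comm_ring_1) \<Rightarrow> nat \<Rightarrow> 'a" where
  "with_one e n = (case n of 0 \<Rightarrow> 1 | Suc i \<Rightarrow> e i)"

text \<open>\<open>newton e n\<close> is \<open>(-1)\<^sup>n\<^sup>+\<^sup>1\<close> times the \<open>n\<close>-th power sum, expressed by the elementary symmetric functions \<open>e\<close>.\<close>

fun newton :: "(nat \<Rightarrow> 'a::comm_ring_1) \<Rightarrow> nat \<Rightarrow> 'a" where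
  "newton e n = of_nat n * with_one e n - (\<Sum>i\<in>{1..<n}. newton e i * with_one e (n - i))"

declare newton.simps [simp del]

definition psum :: "(nat \<Rightarrow> 'a::comm_ring_1) \<Rightarrow> nat \<Rightarrow> 'a" where
  "psum e n = (- 1) ^ Suc n * newton e n"

lemma with_one_simps [simp]: "with_one e 0 = 1" "with_one e (Suc n) = e n"
  by (simp_all add: with_one_def)

lemma newton_0 [simp]: "newton e 0 = 0"
  by (subst newton.simps) simp

lemma newton_rel: "of_nat n * with_one e n = (\<Sum>i\<le>n. newton e i * with_one e (n - i))"
proof (cases n)
  case (Suc m)
  have "{..n} = insert 0 (insert n {1..<n})" using Suc by auto
  then have "(\<Sum>i\<le>n. newton e i * with_one e (n - i)) = newton e n + (\<Sum>i\<in>{1..<n}. newton e i * with_one e (n - i))"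
    using Suc by simp
  then show ?thesis by (simp add: newton.simps[of e n])
qed simp

text \<open>In the n-th relation the newest unknown has coefficient \<open>with_one e 0 = 1\<close>,
  so no division is involved and the ring is arbitrary.\<close>

lemma newton_unique:
  assumes w: "w 0 = 0" "\<And>n. of_nat n * with_one e n = (\<Sum>i\<le>n. w i * with_one e (n - i))"
  shows "w n = newton e n"
proof (induction n rule: less_induct)
  case (less n)
  have "(\<Sum>i\<le>n. w i * with_one e (n - i)) = w n + (\<Sum>i<n. w i * with_one e (n - i))"
    by (simp add: lessThan_Suc_atMost[symmetric])
  moreover have "(\<Sum>i\<le>n. newton e i * with_one e (n - i)) = newton e n + (\<Sum>i<n. newton e i * with_one e (n - i))"
    by (simp add: lessThan_Suc_atMost[symmetric])
  moreover have "(\<Sum>i<n. w i * with_one e (n - i)) = (\<Sum>i<n. newton e i * with_one e (n - i))"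
    using less.IH by simp
  ultimately show ?case using w(2)[of n] newton_rel[of n e] by simp
qed

lemma rhom_newton: assumes "rhom \<phi>" shows "\<phi> (newton e n) = newton (\<lambda>i. \<phi> (e i)) n"
proof (rule newton_unique[of "\<lambda>n. \<phi> (newton e n)"])
  have E: "with_one (\<lambda>i. \<phi> (e i)) n = \<phi> (with_one e n)" for n
    using rhom_1[OF assms] by (cases n) auto
  show "of_nat n * with_one (\<lambda>i. \<phi> (e i)) n = (\<Sum>i\<le>n. \<phi> (newton e i) * with_one (\<lambda>i. \<phi> (e i)) (n - i))" for n
    using arg_cong[OF newton_rel[of n e], of \<phi>]
    by (simp add: E rhom_mult[OF assms] rhom_sum[OF assms] rhom_of_nat[OF assms])
qed (simp add: rhom_0[OF assms])

lemma rhom_psum: assumes "rhom \<phi>" shows "\<phi> (psum e n) = psum (\<lambda>i. \<phi> (e i)) n"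
  by (simp add: psum_def rhom_mult[OF assms] rhom_power[OF assms] rhom_uminus[OF assms] rhom_1[OF assms] rhom_newton[OF assms])

text \<open>For the series E with coefficients \<open>with_one e\<close>, the relations say that
  \<open>newton e\<close> is the logarithmic derivative t E'/E. Products of series thereby become
  sums.\<close>

lemma newton_fps_unique:
  fixes e :: "nat \<Rightarrow> 'a::comm_ring_1"
  assumes "fps_nth W 0 = 0" "fps_X * fps_deriv (Abs_fps (with_one e)) = W * Abs_fps (with_one e)"
  shows "fps_nth W n = newton e n"
proof (rule newton_unique[of "fps_nth W"])
  fix n
  have "fps_nth (fps_X * fps_deriv (Abs_fps (with_one e))) n = of_nat n * with_one e n"
    by (cases n) simp_all
  then show "of_nat n * with_one e n = (\<Sum>i\<le>n. fps_nth W i * with_one e (n - i))"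
    by (simp add: assms(2) fps_mult_nth atLeast0AtMost)
qed (rule assms)

lemma newton_fps:
  fixes e :: "nat \<Rightarrow> 'a::comm_ring_1"
  shows "fps_X * fps_deriv (Abs_fps (with_one e)) = Abs_fps (newton e) * Abs_fps (with_one e)"
proof (rule fps_ext)
  fix n
  have "fps_nth (fps_X * fps_deriv (Abs_fps (with_one e))) n = of_nat n * with_one e n"
    by (cases n) simp_all
  then show "fps_nth (fps_X * fps_deriv (Abs_fps (with_one e))) n = fps_nth (Abs_fps (newton e) * Abs_fps (with_one e)) n"
    by (simp add: fps_mult_nth atLeast0AtMost newton_rel)
qed

lemma with_one_fps_mult:
  "Abs_fps (with_one e) * Abs_fps (with_one f) = Abs_fps (with_one (\<lambda>i. \<Sum>j\<le>Suc i. with_one e j * with_one f (Suc i - j)))"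
proof (rule fps_ext)
  fix n
  have "with_one (\<lambda>i. \<Sum>j\<le>Suc i. with_one e j * with_one f (Suc i - j)) n = (\<Sum>j\<le>n. with_one e j * with_one f (n - j))"
    by (cases n) (simp_all only: with_one_simps atMost_0 sum.insert sum.empty finite.emptyI empty_iff not_False_eq_True diff_self_eq_0 mult_1_left add_0_right)
  then show "fps_nth (Abs_fps (with_one e) * Abs_fps (with_one f)) n = fps_nth (Abs_fps (with_one (\<lambda>i. \<Sum>j\<le>Suc i. with_one e j * with_one f (Suc i - j)))) n"
    by (simp only: fps_mult_nth atLeast0AtMost fps_nth_Abs_fps)
qed

lemma leibniz_arith:
  fixes x :: "'b::comm_ring_1"
  shows "x * (a * b' + a' * b) = x * a' * b + a * (x * b')" "v * a * b + a * (w * b) = (v + w) * (a * b)"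
  by (simp_all add: algebra_simps)

lemma newton_prod:
  fixes e f :: "nat \<Rightarrow> 'a::comm_ring_1"
  shows "newton (\<lambda>i. \<Sum>j\<le>Suc i. with_one e j * with_one f (Suc i - j)) n = newton e n + newton f n"
proof -
  let ?A = "Abs_fps (with_one e)" and ?B = "Abs_fps (with_one f)"
  have "fps_X * fps_deriv (?A * ?B) = (fps_X * fps_deriv ?A) * ?B + ?A * (fps_X * fps_deriv ?B)"
    by (subst fps_deriv_mult) (rule leibniz_arith)
  also have "\<dots> = (Abs_fps (newton e) + Abs_fps (newton f)) * (?A * ?B)"
    unfolding newton_fps by (rule leibniz_arith)
  finally have X: "fps_X * fps_deriv (?A * ?B) = (Abs_fps (newton e) + Abs_fps (newton f)) * (?A * ?B)" .
  have "fps_nth (Abs_fps (newton e) + Abs_fps (newton f)) 0 = 0" by (simp only: fps_add_nth fps_nth_Abs_fps newton_0 add_0_right)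
  then have "fps_nth (Abs_fps (newton e) + Abs_fps (newton f)) n = newton (\<lambda>i. \<Sum>j\<le>Suc i. with_one e j * with_one f (Suc i - j)) n"
    by (rule newton_fps_unique) (rule X[unfolded with_one_fps_mult])
  then show ?thesis unfolding fps_add_nth fps_nth_Abs_fps by (rule sym)
qed

lemma newton_esym:
  fixes x :: "'i \<Rightarrow> 'a::comm_ring_1"
  assumes "finite I" "n \<ge> 1"
  shows "newton (\<lambda>i. esym x I (Suc i)) n = (- 1) ^ Suc n * (\<Sum>k\<in>I. x k ^ n)"
proof -
  define F where "F I = fps_of_poly (\<Prod>k\<in>I. [:1, x k:])" for I
  define lin where "lin k = fps_of_poly [:1, x k:]" for k
  \<comment> \<open>The expansion of xt/(1 + xt), the logarithmic derivative of a single
    factor.\<close>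
  define V where "V k = Abs_fps (\<lambda>n. if n = 0 then 0 else (- 1) ^ Suc n * x k ^ n)" for k
  have nth: "fps_nth (lin k) n = (if n = 0 then 1 else if n = 1 then x k else 0)" for k n
    unfolding lin_def fps_of_poly_nth by (cases n; cases "n - 1") simp_all
  have V: "V k * lin k = fps_X * fps_deriv (lin k)" for k
  proof (rule fps_ext)
    fix n
    have "lin k = 1 + fps_X * fps_const (x k)"
      unfolding lin_def by (simp add: fps_of_poly_pCons mult.commute)
    then have "V k * lin k = V k + fps_X * (fps_const (x k) * V k)"
      by (simp only: distrib_left mult_1_right mult.commute[of "V k"] mult.assoc)
    then have "fps_nth (V k * lin k) n = fps_nth (V k) n + (if n = 0 then 0 else x k * fps_nth (V k) (n - 1))"
      by (simp only: fps_add_nth fps_X_mult_nth fps_mult_left_const_nth)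
    moreover have "fps_nth (fps_X * fps_deriv (lin k)) n = (if n = 1 then x k else 0)"
      by (cases n) (simp_all add: nth)
    moreover have "fps_nth (V k) n + (if n = 0 then 0 else x k * fps_nth (V k) (n - 1)) = (if n = 1 then x k else 0)"
    proof (cases n)
      case (Suc m)
      then show ?thesis by (cases m) (simp_all add: V_def)
    qed (simp add: V_def)
    ultimately show "fps_nth (V k * lin k) n = fps_nth (fps_X * fps_deriv (lin k)) n" by simp
  qed
  have X: "fps_X * fps_deriv (F I) = (\<Sum>k\<in>I. V k) * F I"
    using assms(1)
  proof (induction I)
    case (insert k I)
    have F: "F (insert k I) = lin k * F I"
      using insert.hyps by (simp add: F_def fps_of_poly_mult lin_def)
    have "fps_X * fps_deriv (F (insert k I)) = fps_X * fps_deriv (lin k) * F I + lin k * (fps_X * fps_deriv (F I))"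
      unfolding F by (subst fps_deriv_mult) (rule leibniz_arith)
    also have "\<dots> = V k * lin k * F I + lin k * ((\<Sum>k\<in>I. V k) * F I)"
      by (simp only: insert.IH V)
    also have "\<dots> = (V k + (\<Sum>k\<in>I. V k)) * (lin k * F I)"
      by (rule leibniz_arith)
    finally show ?case using insert.hyps by (simp add: F)
  qed (simp add: F_def)
  have F: "F I = Abs_fps (with_one (\<lambda>i. esym x I (Suc i)))"
  proof (rule fps_ext)
    fix n show "fps_nth (F I) n = fps_nth (Abs_fps (with_one (\<lambda>i. esym x I (Suc i)))) n"
      using assms(1) by (cases n) (simp_all add: F_def coeff_prod_linear esym_0)
  qed
  have "fps_nth (\<Sum>k\<in>I. V k) 0 = 0" by (simp add: fps_sum_nth V_def)
  then have "newton (\<lambda>i. esym x I (Suc i)) n = fps_nth (\<Sum>k\<in>I. V k) n"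
    by (rule newton_fps_unique[symmetric]) (rule X[unfolded F])
  also have "\<dots> = (\<Sum>k\<in>I. (- 1) ^ Suc n * x k ^ n)"
    unfolding fps_sum_nth V_def using assms(2) by (intro sum.cong) simp_all
  finally show ?thesis by (simp only: sum_distrib_left)
qed

lemma psum_esym:
  fixes x :: "'i \<Rightarrow> 'a::comm_ring_1"
  assumes "finite I" "n \<ge> 1"
  shows "psum (\<lambda>i. esym x I (Suc i)) n = (\<Sum>k\<in>I. x k ^ n)"
proof -
  have "(- 1 :: 'a) ^ Suc n * (- 1) ^ Suc n = 1" by (rule minus_one_mult_self)
  then show ?thesis unfolding psum_def newton_esym[OF assms] mult.assoc[symmetric] by (simp only: mult_1_left)
qed

lemma zeval_psum: "zeval (type_ring :: 'a::comm_ring_1 ring) b (psum e n) = psum (\<lambda>i. zeval type_ring b (e i)) n"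
  by (rule rhom_psum[OF zeval_rhom])

lemma univ_mult_0: "univ_mult_poly 0 = 1"
  by (rule zpoly_eqI2) (simp add: univ_mult_eval esym_0 rhom_1[OF zeval_rhom])

lemma univ_lam_0: "univ_lam_poly m 0 = 1"
  by (rule zpoly_eqI) (simp add: univ_lam_eval esym_0 rhom_1[OF zeval_rhom])

text \<open>At elementary symmetric functions it reads: the sum of all (x_i y_j)^n is the product of
  the two power sums.\<close>

lemma psum_univ_mult: assumes "n \<ge> 1"
  shows "psum (\<lambda>i. univ_mult_poly (Suc i)) n = psum (\<lambda>i. zvar (Inl i)) n * psum (\<lambda>i. zvar (Inr i)) n"
  by (rule zpoly_eqI2)
     (use assms in \<open>simp add: rhom_mult[OF zeval_rhom] zeval_psum univ_mult_eval psum_esym power_mult_distrib case_prod_unfold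
       sum_product sum.cartesian_product\<close>)

lemma psum_univ_lam_eval:
  fixes x :: "nat \<Rightarrow> 'a::comm_ring_1"
  assumes "r \<ge> 1"
  shows "zeval type_ring (\<lambda>i. esym x {..<N} (Suc i)) (psum (\<lambda>i. univ_lam_poly m (Suc i)) r) = esym (\<lambda>i. x i ^ r) {..<N} m"
proof -
  have "zeval type_ring (\<lambda>i. esym x {..<N} (Suc i)) (psum (\<lambda>i. univ_lam_poly m (Suc i)) r) =
      (\<Sum>S | S \<subseteq> {..<N} \<and> card S = m. (\<Prod>i\<in>S. x i) ^ r)"
    using assms by (simp add: zeval_psum univ_lam_eval psum_esym)
  then show ?thesis by (simp add: esym_def prod_power_distrib)
qed

lemma psum_univ_lam_0: "r \<ge> 1 \<Longrightarrow> psum (\<lambda>i. univ_lam_poly 0 (Suc i)) r = 1"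
  by (rule zpoly_eqI) (simp add: psum_univ_lam_eval esym_0 rhom_1[OF zeval_rhom])

text \<open>Newton's identities for the variables x_i^r. Their i-th power sum is the (ir)-th power
  sum of the x_i, and the r-th power sum of the products x_S is their m-th elementary symmetric
  function. The term i = 0 is zero, like \<open>newton e 0\<close>.\<close>

lemma psum_univ_lam:
  assumes "r \<ge> 1"
  shows "of_nat m * psum (\<lambda>i. univ_lam_poly m (Suc i)) r =
    (\<Sum>i\<le>m. (if i = 0 then 0 else (- 1) ^ Suc i * psum zvar (i * r)) * psum (\<lambda>j. univ_lam_poly (m - i) (Suc j)) r)"
proof (rule zpoly_eqI)
  fix N and x :: "nat \<Rightarrow> complex"
  let ?h = "zeval type_ring (\<lambda>i. esym x {..<N} (Suc i))"
  have e: "with_one (\<lambda>i. esym (\<lambda>i. x i ^ r) {..<N} (Suc i)) n = esym (\<lambda>i. x i ^ r) {..<N} n" for n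
    by (cases n) (simp_all add: esym_0)
  have v: "?h (if i = 0 then 0 else (- 1) ^ Suc i * psum zvar (i * r)) = newton (\<lambda>i. esym (\<lambda>i. x i ^ r) {..<N} (Suc i)) i" for i
    using assms by (auto simp: rhom_0[OF zeval_rhom] rhom_mult[OF zeval_rhom] rhom_power[OF zeval_rhom] rhom_uminus[OF zeval_rhom]
       rhom_1[OF zeval_rhom] zeval_psum psum_esym newton_esym mult.commute simp flip: power_mult)
  show "?h (of_nat m * psum (\<lambda>i. univ_lam_poly m (Suc i)) r) = ?h (\<Sum>i\<le>m. (if i = 0 then 0 else (- 1) ^ Suc i * psum zvar (i * r)) * psum (\<lambda>j. univ_lam_poly (m - i) (Suc j)) r)"
    using newton_rel[of m "\<lambda>i. esym (\<lambda>i. x i ^ r) {..<N} (Suc i)"] assms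
    by (simp add: rhom_mult[OF zeval_rhom] rhom_sum[OF zeval_rhom] rhom_of_nat[OF zeval_rhom] psum_univ_lam_eval v e del: if_split)
qed

section \<open>The ghost components of \<open>\<Lambda>\<close>\<close>

lemma newton_psum: "newton e (Suc i) = (- 1) ^ i * psum e (Suc i)"
  by (simp add: psum_def mult.assoc[symmetric])

lemma newton_psum_rel:
  "of_nat (Suc n) * with_one e (Suc n) = (\<Sum>i\<le>n. (- 1) ^ i * (psum e (Suc i) * with_one e (n - i)))"
proof -
  have "of_nat (Suc n) * with_one e (Suc n) = (\<Sum>i\<le>Suc n. newton e i * with_one e (Suc n - i))"
    by (rule newton_rel)
  also have "\<dots> = (\<Sum>i\<le>n. newton e (Suc i) * with_one e (n - i))"
    by (subst sum.atMost_Suc_shift) simp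
  finally show ?thesis by (simp only: newton_psum mult.assoc)
qed

lemma psum_prod: "psum (\<lambda>i. \<Sum>j\<le>Suc i. with_one e j * with_one f (Suc i - j)) n = psum e n + psum f n"
  unfolding psum_def newton_prod by (rule distrib_left)

lemma psum_zero: assumes "n \<ge> 1" shows "psum (\<lambda>_. 0 :: 'a::comm_ring_1) n = 0"
proof -
  have "esym (\<lambda>_::unit. 0 :: 'a) {} (Suc i) = 0" for i by (simp add: coeff_prod_linear[symmetric])
  then show ?thesis using psum_esym[of "{}" n "\<lambda>_::unit. 0 :: 'a"] assms by simp
qed

lemma psum_one: assumes "n \<ge> 1" shows "psum (\<lambda>i. if i = 0 then 1 else 0 :: 'a::comm_ring_1) n = 1"
proof -
  have "esym (\<lambda>_::unit. 1 :: 'a) {()} (Suc i) = (if i = 0 then 1 else 0)" for i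
    by (simp add: coeff_prod_linear[symmetric] coeff_pCons split: nat.split)
  then show ?thesis using psum_esym[of "{()}" n "\<lambda>_::unit. 1 :: 'a"] assms by simp
qed

lemma fps_ring_sel [simp]:
  "f \<in> carrier (fps_ring A) \<longleftrightarrow> (\<forall>n. f n \<in> carrier A)"
  "f \<otimes>\<^bsub>fps_ring A\<^esub> g = (\<lambda>n. \<Oplus>\<^bsub>A\<^esub>i\<in>{..n}. f i \<otimes>\<^bsub>A\<^esub> g (n - i))"
  "\<one>\<^bsub>fps_ring A\<^esub> = (\<lambda>n. if n = 0 then \<one>\<^bsub>A\<^esub> else \<zero>\<^bsub>A\<^esub>)"
  "\<zero>\<^bsub>fps_ring A\<^esub> = (\<lambda>n. \<zero>\<^bsub>A\<^esub>)"
  "f \<oplus>\<^bsub>fps_ring A\<^esub> g = (\<lambda>n. f n \<oplus>\<^bsub>A\<^esub> g n)"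
  by (simp_all add: fps_ring_def)

text \<open>
  The ghost component of \<open>\<Prod>(1 + x\<^sub>i t)\<close> is the power sum \<open>\<Sum>x\<^sub>i\<^sup>n\<close>.
\<close>

definition ghost :: "('a, 'z) ring_scheme \<Rightarrow> (nat \<Rightarrow> 'a) \<Rightarrow> nat \<Rightarrow> 'a" where
  "ghost R f n = zeval R (\<lambda>i. f (Suc i)) (psum zvar n)"

lemma Lambda_sel:
  "f \<in> carrier (Lambda R) \<longleftrightarrow> f 0 = \<one>\<^bsub>R\<^esub> \<and> (\<forall>n. f n \<in> carrier R)"
  "f \<otimes>\<^bsub>Lambda R\<^esub> g = (\<lambda>n. zeval R (case_sum (\<lambda>i. f (Suc i)) (\<lambda>j. g (Suc j))) (univ_mult_poly n))"
  "\<one>\<^bsub>Lambda R\<^esub> = (\<lambda>n. if n \<le> 1 then \<one>\<^bsub>R\<^esub> else \<zero>\<^bsub>R\<^esub>)"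
  "\<zero>\<^bsub>Lambda R\<^esub> = \<one>\<^bsub>fps_ring R\<^esub>"
  "f \<oplus>\<^bsub>Lambda R\<^esub> g = f \<otimes>\<^bsub>fps_ring R\<^esub> g"
  "lam (Lambda R) m f = (\<lambda>n. zeval R (\<lambda>i. f (Suc i)) (univ_lam_poly m n))"
  by (simp_all add: Lambda_def)

context cring
begin

context
  fixes h :: "'c::comm_ring_1 \<Rightarrow> 'a"
  assumes h: "h \<in> ring_hom type_ring R"
begin

lemma type_hom_closed: "h x \<in> carrier R"
  using ring_hom_closed[OF h, of x] by simp

lemma type_hom_mult: "h (x * y) = h x \<otimes> h y"
  using ring_hom_mult[OF h, of x y] by simp

lemma type_hom_add: "h (x + y) = h x \<oplus> h y"
  using ring_hom_add[OF h, of x y] by simp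

lemma type_hom_1: "h 1 = \<one>"
  using ring_hom_one[OF h] by simp

lemma type_hom_0: "h 0 = \<zero>"
  using type_hom_add[of 0 0] type_hom_closed[of 0] by (metis add.r_cancel_one' add_0)

lemma type_hom_sum: "h (sum f A) = (\<Oplus>x\<in>A. h (f x))"
  by (induction A rule: infinite_finite_induct) (auto simp: type_hom_0 type_hom_add type_hom_closed finsum_infinite)

lemma type_hom_of_nat: "h (of_nat n) = em (int n)"
  by (induction n) (simp_all add: type_hom_0 type_hom_1 type_hom_add em_add)

lemma type_hom_sign: "h ((- 1) ^ n) = em ((- 1) ^ n)"
proof -
  have "h (- 1) \<oplus> \<one> = \<zero>" using type_hom_add[of "- 1" 1] by (simp add: type_hom_0 type_hom_1)
  then have "h (- 1) = em (- 1)" using type_hom_closed[of "- 1"] minus_equality[of "h (- 1)" \<one>] by (simp add: em_uminus)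
  then show ?thesis
    by (induction n) (simp_all only: power_0 power_Suc type_hom_mult em_mult type_hom_1 em_1)
qed

lemma type_hom_fps_mult:
  "(\<lambda>n. h (fps_nth (P * Q) n)) = (\<lambda>n. h (fps_nth P n)) \<otimes>\<^bsub>fps_ring R\<^esub> (\<lambda>n. h (fps_nth Q n))"
  by (simp add: fps_mult_nth atLeast0AtMost type_hom_sum type_hom_mult)

lemma type_hom_fps_1: "(\<lambda>n. h (fps_nth 1 n)) = \<one>\<^bsub>fps_ring R\<^esub>"
  by (auto simp: type_hom_0 type_hom_1)

lemma ghost_type_hom: "ghost R (\<lambda>n. h (with_one e n)) r = h (psum e r)"
proof -
  have "h (psum e r) = h (zeval type_ring e (psum zvar r))" by (simp add: zeval_psum)
  also have "\<dots> = zeval R (h \<circ> e) (psum zvar r)" by (rule zeval_hom_comp[OF h])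
  finally show ?thesis by (simp add: ghost_def comp_def)
qed

lemma Lambda_type_hom: "(\<lambda>n. h (with_one e n)) \<in> carrier (Lambda R)"
  by (simp add: Lambda_sel type_hom_1 type_hom_closed)

end

text \<open>
  Identities of power series over \<open>R\<close> are images of identities between power series over a polynomial ring, where those of
  the library are available.
\<close>

lemma fps_lift:
  assumes "f \<in> carrier (fps_ring R)" "g \<in> carrier (fps_ring R)" "k \<in> carrier (fps_ring R)"
  obtains h :: "(nat + nat + nat) zpoly \<Rightarrow> 'a" and P Q S where "h \<in> ring_hom type_ring R"
    "f = (\<lambda>n. h (fps_nth P n))" "g = (\<lambda>n. h (fps_nth Q n))" "k = (\<lambda>n. h (fps_nth S n))"
proof -
  define a where "a = case_sum f (case_sum g k)"
  have a: "a v \<in> carrier R" for v using assms by (auto simp: a_def split: sum.split)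
  show ?thesis
    by (rule that[of "zeval R a" "Abs_fps (\<lambda>i. zvar (Inl i))" "Abs_fps (\<lambda>i. zvar (Inr (Inl i)))" "Abs_fps (\<lambda>i. zvar (Inr (Inr i)))"])
       (simp_all add: zeval_ring_hom[OF a] zeval_zvar[OF a], simp_all add: a_def)
qed

lemma fps_ring_comm_monoid: "comm_monoid (fps_ring R)"
proof (rule comm_monoidI)
  fix f g k assume A: "f \<in> carrier (fps_ring R)" "g \<in> carrier (fps_ring R)" "k \<in> carrier (fps_ring R)"
  obtain h :: "(nat + nat + nat) zpoly \<Rightarrow> 'a" and P Q S where h: "h \<in> ring_hom type_ring R" and
    e: "f = (\<lambda>n. h (fps_nth P n))" "g = (\<lambda>n. h (fps_nth Q n))" "k = (\<lambda>n. h (fps_nth S n))" by (rule fps_lift[OF A])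
  show "f \<otimes>\<^bsub>fps_ring R\<^esub> g \<otimes>\<^bsub>fps_ring R\<^esub> k = f \<otimes>\<^bsub>fps_ring R\<^esub> (g \<otimes>\<^bsub>fps_ring R\<^esub> k)"
    unfolding e type_hom_fps_mult[OF h, symmetric] mult.assoc ..
next
  fix f g assume A: "f \<in> carrier (fps_ring R)" "g \<in> carrier (fps_ring R)"
  obtain h :: "(nat + nat + nat) zpoly \<Rightarrow> 'a" and P Q S where h: "h \<in> ring_hom type_ring R" and
    e: "f = (\<lambda>n. h (fps_nth P n))" "g = (\<lambda>n. h (fps_nth Q n))" "g = (\<lambda>n. h (fps_nth S n))" by (rule fps_lift[OF A A(2)])
  show "f \<otimes>\<^bsub>fps_ring R\<^esub> g = g \<otimes>\<^bsub>fps_ring R\<^esub> f"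
    unfolding e(1,2) type_hom_fps_mult[OF h, symmetric] by (simp only: mult.commute)
  show "f \<otimes>\<^bsub>fps_ring R\<^esub> g \<in> carrier (fps_ring R)" using A by (auto intro!: finsum_closed)
next
  fix f assume A: "f \<in> carrier (fps_ring R)"
  obtain h :: "(nat + nat + nat) zpoly \<Rightarrow> 'a" and P Q S where h: "h \<in> ring_hom type_ring R" and
    e: "f = (\<lambda>n. h (fps_nth P n))" "f = (\<lambda>n. h (fps_nth Q n))" "f = (\<lambda>n. h (fps_nth S n))" by (rule fps_lift[OF A A A])
  show "\<one>\<^bsub>fps_ring R\<^esub> \<otimes>\<^bsub>fps_ring R\<^esub> f = f"
    unfolding e(1) type_hom_fps_1[OF h, symmetric] type_hom_fps_mult[OF h, symmetric] by (simp only: mult_1_left)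
qed simp

lemma fps_ring_abelian_group: "abelian_group (fps_ring R)"
proof (rule abelian_groupI)
  fix f assume f: "f \<in> carrier (fps_ring R)"
  show "\<exists>g\<in>carrier (fps_ring R). g \<oplus>\<^bsub>fps_ring R\<^esub> f = \<zero>\<^bsub>fps_ring R\<^esub>"
    by (rule bexI[of _ "\<lambda>n. \<ominus> f n"]) (use f in \<open>auto simp: l_neg\<close>)
qed (auto simp: a_assoc fun_eq_iff intro: a_comm)

lemma fps_ring_minus: assumes "f \<in> carrier (fps_ring R)" shows "\<ominus>\<^bsub>fps_ring R\<^esub> f = (\<lambda>n. \<ominus> f n)"
proof -
  interpret F: abelian_group "fps_ring R" by (rule fps_ring_abelian_group)
  show ?thesis by (rule F.minus_equality) (use assms in \<open>auto simp: l_neg\<close>)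
qed

text \<open>The series with indeterminate coefficients and constant term 1 is invertible over the
  polynomial ring, and its inverse specialises to R.\<close>

lemma fps_ring_inverse:
  assumes f: "f \<in> carrier (fps_ring R)" "f 0 = \<one>"
  shows "\<exists>g\<in>carrier (fps_ring R). g 0 = \<one> \<and> g \<otimes>\<^bsub>fps_ring R\<^esub> f = \<one>\<^bsub>fps_ring R\<^esub>"
proof -
  define a where "a i = f (Suc i)" for i
  have a: "a i \<in> carrier R" for i using f by (simp add: a_def)
  let ?h = "zeval R a" and ?F = "Abs_fps (with_one zvar) :: nat zpoly fps"
  note h = zeval_ring_hom[OF a]
  let ?N = "fps_right_inverse ?F 1"
  have N: "?F * ?N = 1" by (rule fps_right_inverse) simp
  then have N0: "fps_nth ?N 0 = 1" using arg_cong[OF N, of "\<lambda>f. fps_nth f 0"] by simp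
  have "?h (with_one zvar n) = f n" for n
    using f by (cases n) (simp_all add: type_hom_1[OF h] zeval_zvar[OF a], simp add: a_def)
  then have F: "(\<lambda>n. ?h (fps_nth ?F n)) = f" by (simp add: fun_eq_iff)
  have "(\<lambda>n. ?h (fps_nth ?N n)) \<otimes>\<^bsub>fps_ring R\<^esub> (\<lambda>n. ?h (fps_nth ?F n)) = \<one>\<^bsub>fps_ring R\<^esub>"
    unfolding type_hom_fps_mult[OF h, symmetric] mult.commute[of ?N] N by (rule type_hom_fps_1[OF h])
  then show ?thesis unfolding F
    by (intro bexI[of _ "\<lambda>n. ?h (fps_nth ?N n)"] conjI) (simp_all add: N0 type_hom_1[OF h] type_hom_closed[OF h])
qed

lemma fps_ring_Units: assumes "f \<in> carrier (fps_ring R)" "f 0 = \<one>" shows "f \<in> Units (fps_ring R)"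
proof -
  interpret F: comm_monoid "fps_ring R" by (rule fps_ring_comm_monoid)
  obtain g where g: "g \<in> carrier (fps_ring R)" "g \<otimes>\<^bsub>fps_ring R\<^esub> f = \<one>\<^bsub>fps_ring R\<^esub>"
    using fps_ring_inverse[OF assms] by blast
  then have "f \<otimes>\<^bsub>fps_ring R\<^esub> g = \<one>\<^bsub>fps_ring R\<^esub>" using F.m_comm[of f g] assms(1) by (simp only:)
  then show ?thesis unfolding Units_def using g assms(1) by blast
qed

text \<open>Since c starts with \<one>, the n-th equation isolates u n and v n next to terms that
  agree by induction.\<close>

lemma conv_unique:
  fixes u v c :: "nat \<Rightarrow> 'a"
  assumes u: "\<And>n. u n \<in> carrier R" and v: "\<And>n. v n \<in> carrier R" and c: "\<And>n. c n \<in> carrier R" "c 0 = \<one>"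
    and eq: "\<And>n. (\<Oplus>i\<in>{..n}. u i \<otimes> c (n - i)) = (\<Oplus>i\<in>{..n}. v i \<otimes> c (n - i))"
  shows "u n = v n"
proof (induction n rule: less_induct)
  case (less n)
  have s: "(\<Oplus>i\<in>{..n}. w i \<otimes> c (n - i)) = w n \<oplus> (\<Oplus>i\<in>{..<n}. w i \<otimes> c (n - i))" if "\<And>n. w n \<in> carrier R" for w
  proof -
    have "{..n} = insert n {..<n}" by auto
    then show ?thesis using that c by (simp add: finsum_insert)
  qed
  have "(\<Oplus>i\<in>{..<n}. u i \<otimes> c (n - i)) = (\<Oplus>i\<in>{..<n}. v i \<otimes> c (n - i))"
    using less.IH v c by (intro finsum_cong') auto
  then show ?case using eq[of n] u v c by (simp add: s[OF u] s[OF v] add.right_cancel finsum_closed)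
qed

lemma em_sign_sq: "x \<in> carrier R \<Longrightarrow> em ((- 1) ^ n) \<otimes> (em ((- 1) ^ n) \<otimes> x) = x"
  by (simp add: m_assoc[symmetric] em_mult[symmetric])

lemma ghost_closed: "f \<in> carrier (Lambda R) \<Longrightarrow> ghost R f n \<in> carrier R"
  unfolding ghost_def by (rule zeval_closed) (simp add: Lambda_sel)

lemma ghost_rel:
  assumes f: "f \<in> carrier (Lambda R)"
  shows "em (int (Suc n)) \<otimes> f (Suc n) = (\<Oplus>i\<in>{..n}. em ((- 1) ^ i) \<otimes> (ghost R f (Suc i) \<otimes> f (n - i)))"
proof -
  define a where "a i = f (Suc i)" for i
  have a: "a i \<in> carrier R" for i using f by (simp add: a_def Lambda_sel)
  note h = zeval_ring_hom[OF a]
  have z: "zeval R a (with_one zvar n) = f n" for n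
    using f by (cases n) (simp_all add: type_hom_1[OF h] zeval_zvar[OF a] Lambda_sel, simp add: a_def)
  have g: "zeval R a (psum zvar n) = ghost R f n" for n
  proof -
    have "a = (\<lambda>i. f (Suc i))" by (rule ext) (rule a_def)
    then show ?thesis by (simp only: ghost_def)
  qed
  show ?thesis using arg_cong[OF newton_psum_rel[of n zvar], of "zeval R a"]
    by (simp only: type_hom_mult[OF h] type_hom_sum[OF h] type_hom_of_nat[OF h] type_hom_sign[OF h] z g)
qed

text \<open>Newton's identities are solved for the p n, where the coefficient is a sign times f 0 =
  \<one>; this works over every R.\<close>

lemma ghost_unique:
  assumes f: "f \<in> carrier (Lambda R)" and p: "\<And>n. p n \<in> carrier R"
    and rel: "\<And>n. em (int (Suc n)) \<otimes> f (Suc n) = (\<Oplus>i\<in>{..n}. em ((- 1) ^ i) \<otimes> (p (Suc i) \<otimes> f (n - i)))"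
  shows "ghost R f (Suc n) = p (Suc n)"
proof -
  have c: "f n \<in> carrier R" "f 0 = \<one>" for n using f by (simp_all add: Lambda_sel)
  note g = ghost_closed[OF f]
  have "em ((- 1) ^ n) \<otimes> ghost R f (Suc n) = em ((- 1) ^ n) \<otimes> p (Suc n)"
    by (rule conv_unique[of "\<lambda>n. em ((- 1) ^ n) \<otimes> ghost R f (Suc n)" "\<lambda>n. em ((- 1) ^ n) \<otimes> p (Suc n)" f])
       (use ghost_rel[OF f] rel in \<open>simp_all add: c g p m_assoc\<close>)
  then have "em ((- 1) ^ n) \<otimes> (em ((- 1) ^ n) \<otimes> ghost R f (Suc n)) = em ((- 1) ^ n) \<otimes> (em ((- 1) ^ n) \<otimes> p (Suc n))"
    by (rule arg_cong)
  then show ?thesis unfolding em_sign_sq[OF g] em_sign_sq[OF p] .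
qed

end

section \<open>\<Lambda>(R) as a ring and its Adams operations, for R without torsion\<close>

locale torsion_free_cring = cring +
  assumes torsion_free: "\<lbrakk>x \<in> carrier R; [(n :: nat)] \<cdot>\<^bsub>R\<^esub> x = \<zero>; n > 0\<rbrakk> \<Longrightarrow> x = \<zero>"
begin

text \<open>Newton's identities are now solved for the coefficients of f, which requires cancelling
  the integer n in front of the n-th one.\<close>

lemma ghost_inj:
  assumes f: "f \<in> carrier (Lambda R)" and g: "g \<in> carrier (Lambda R)" and eq: "\<And>n. ghost R f (Suc n) = ghost R g (Suc n)"
  shows "f = g"
proof -
  have c: "f n \<in> carrier R" "g n \<in> carrier R" "f 0 = \<one>" "g 0 = \<one>" for n using f g by (simp_all add: Lambda_sel)
  have "f n = g n" for n
  proof (induction n rule: less_induct)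
    case (less n)
    show ?case
    proof (cases n)
      case (Suc m)
      have "em (int n) \<otimes> f n = em (int n) \<otimes> g n"
        unfolding Suc ghost_rel[OF f] ghost_rel[OF g] eq
        using less.IH ghost_closed[OF g] c unfolding Suc by (intro finsum_cong') auto
      then have "em (int n) \<otimes> (f n \<ominus> g n) = \<zero>" using c by (simp add: minus_eq r_distr r_minus r_neg)
      then have z: "[n] \<cdot> (f n \<ominus> g n) = \<zero>" using c by (simp add: add_pow_nat_em)
      have "n > 0" using Suc by simp
      with z have "f n \<ominus> g n = \<zero>" by (intro torsion_free[of "f n \<ominus> g n" n]) (simp_all add: c)
      then have "f n \<ominus> g n \<oplus> g n = g n" by (simp add: c)
      then show ?thesis by (simp add: minus_eq a_assoc l_neg c(1,2))
    next
      case 0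
      then show ?thesis by (simp only: c(3,4))
    qed
  qed
  then show ?thesis by (rule ext)
qed

text \<open>Two elements of \<Lambda>(R) are specialisations of two series with independent
  indeterminate coefficients, so their sum and product can be studied over a polynomial
  ring.\<close>

lemma Lambda_pair_hom:
  assumes f: "f \<in> carrier (Lambda R)" and g: "g \<in> carrier (Lambda R)"
  defines "h \<equiv> zeval R (case_sum (\<lambda>i. f (Suc i)) (\<lambda>j. g (Suc j)))"
  shows "h \<in> ring_hom type_ring R" "(\<lambda>n. h (with_one (\<lambda>i. zvar (Inl i)) n)) = f" "(\<lambda>n. h (with_one (\<lambda>j. zvar (Inr j)) n)) = g"
proof -
  define a where "a = case_sum (\<lambda>i. f (Suc i)) (\<lambda>j. g (Suc j))"
  have a: "a v \<in> carrier R" for v using f g by (auto simp: a_def Lambda_sel split: sum.split)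
  have ha: "h = zeval R a" by (simp add: h_def a_def)
  show h: "h \<in> ring_hom type_ring R" unfolding ha by (rule zeval_ring_hom[OF a])
  have "h (with_one (\<lambda>i. zvar (Inl i)) n) = f n" "h (with_one (\<lambda>j. zvar (Inr j)) n) = g n" for n
    using f g by (cases n; simp add: type_hom_1[OF h] Lambda_sel; simp add: ha zeval_zvar[OF a]; simp add: a_def)+
  then show "(\<lambda>n. h (with_one (\<lambda>i. zvar (Inl i)) n)) = f" "(\<lambda>n. h (with_one (\<lambda>j. zvar (Inr j)) n)) = g" by auto
qed

lemma Lambda_add:
  assumes f: "f \<in> carrier (Lambda R)" and g: "g \<in> carrier (Lambda R)"
  shows "f \<oplus>\<^bsub>Lambda R\<^esub> g \<in> carrier (Lambda R)" "ghost R (f \<oplus>\<^bsub>Lambda R\<^esub> g) r = ghost R f r \<oplus> ghost R g r"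
proof -
  let ?h = "zeval R (case_sum (\<lambda>i. f (Suc i)) (\<lambda>j. g (Suc j)))"
  let ?e = "with_one (\<lambda>i. zvar (Inl i) :: (nat + nat) zpoly)" and ?e' = "with_one (\<lambda>j. zvar (Inr j) :: (nat + nat) zpoly)"
  note h = Lambda_pair_hom(1)[OF f g] and F = Lambda_pair_hom(2)[OF f g] and G = Lambda_pair_hom(3)[OF f g]
  have "with_one (\<lambda>i. \<Sum>j\<le>Suc i. ?e j * ?e' (Suc i - j)) n = (\<Sum>j\<le>n. ?e j * ?e' (n - j))" for n
    by (cases n) (simp_all del: sum.atMost_Suc)
  then have s: "f \<oplus>\<^bsub>Lambda R\<^esub> g = (\<lambda>n. ?h (with_one (\<lambda>i. \<Sum>j\<le>Suc i. ?e j * ?e' (Suc i - j)) n))"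
    using fun_cong[OF F] fun_cong[OF G] by (simp add: Lambda_sel type_hom_sum[OF h] type_hom_mult[OF h])
  show "f \<oplus>\<^bsub>Lambda R\<^esub> g \<in> carrier (Lambda R)" unfolding s by (rule Lambda_type_hom[OF h])
  have "ghost R (f \<oplus>\<^bsub>Lambda R\<^esub> g) r = ?h (psum (\<lambda>i. zvar (Inl i)) r) \<oplus> ?h (psum (\<lambda>i. zvar (Inr i)) r)"
    unfolding s ghost_type_hom[OF h] psum_prod type_hom_add[OF h] ..
  then show "ghost R (f \<oplus>\<^bsub>Lambda R\<^esub> g) r = ghost R f r \<oplus> ghost R g r"
    unfolding ghost_type_hom[OF h, symmetric] F G .
qed

lemma Lambda_mult:
  assumes f: "f \<in> carrier (Lambda R)" and g: "g \<in> carrier (Lambda R)"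
  shows "f \<otimes>\<^bsub>Lambda R\<^esub> g \<in> carrier (Lambda R)"
    "r \<ge> 1 \<Longrightarrow> ghost R (f \<otimes>\<^bsub>Lambda R\<^esub> g) r = ghost R f r \<otimes> ghost R g r"
proof -
  let ?h = "zeval R (case_sum (\<lambda>i. f (Suc i)) (\<lambda>j. g (Suc j)))"
  note h = Lambda_pair_hom(1)[OF f g] and F = Lambda_pair_hom(2)[OF f g] and G = Lambda_pair_hom(3)[OF f g]
  have "with_one (\<lambda>i. univ_mult_poly (Suc i)) n = univ_mult_poly n" for n by (cases n) (simp_all add: univ_mult_0)
  then have s: "f \<otimes>\<^bsub>Lambda R\<^esub> g = (\<lambda>n. ?h (with_one (\<lambda>i. univ_mult_poly (Suc i)) n))"
    by (simp add: Lambda_sel)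
  show "f \<otimes>\<^bsub>Lambda R\<^esub> g \<in> carrier (Lambda R)" unfolding s by (rule Lambda_type_hom[OF h])
  assume "r \<ge> 1"
  then have "ghost R (f \<otimes>\<^bsub>Lambda R\<^esub> g) r = ?h (psum (\<lambda>i. zvar (Inl i)) r) \<otimes> ?h (psum (\<lambda>i. zvar (Inr i)) r)"
    unfolding s ghost_type_hom[OF h] by (simp only: psum_univ_mult type_hom_mult[OF h])
  then show "ghost R (f \<otimes>\<^bsub>Lambda R\<^esub> g) r = ghost R f r \<otimes> ghost R g r"
    unfolding ghost_type_hom[OF h, symmetric] F G .
qed

lemma Lambda_constants:
  "\<zero>\<^bsub>Lambda R\<^esub> \<in> carrier (Lambda R)" "\<one>\<^bsub>Lambda R\<^esub> \<in> carrier (Lambda R)"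
  "r \<ge> 1 \<Longrightarrow> ghost R \<zero>\<^bsub>Lambda R\<^esub> r = \<zero>" "r \<ge> 1 \<Longrightarrow> ghost R \<one>\<^bsub>Lambda R\<^esub> r = \<one>"
proof -
  define h where "h = zeval R (\<lambda>_ :: nat. \<one>)"
  have h: "h \<in> ring_hom type_ring R" unfolding h_def by (rule zeval_ring_hom) simp
  have z: "\<zero>\<^bsub>Lambda R\<^esub> = (\<lambda>n. h (with_one (\<lambda>_. 0) n))"
    by (auto simp: Lambda_sel fun_eq_iff with_one_def type_hom_0[OF h] type_hom_1[OF h] split: nat.split)
  have o: "\<one>\<^bsub>Lambda R\<^esub> = (\<lambda>n. h (with_one (\<lambda>i. if i = 0 then 1 else 0) n))"
    by (auto simp: Lambda_sel fun_eq_iff with_one_def type_hom_0[OF h] type_hom_1[OF h] split: nat.split)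
  show "\<zero>\<^bsub>Lambda R\<^esub> \<in> carrier (Lambda R)" unfolding z by (rule Lambda_type_hom[OF h])
  show "\<one>\<^bsub>Lambda R\<^esub> \<in> carrier (Lambda R)" unfolding o by (rule Lambda_type_hom[OF h])
  assume "r \<ge> 1"
  then show "ghost R \<zero>\<^bsub>Lambda R\<^esub> r = \<zero>" "ghost R \<one>\<^bsub>Lambda R\<^esub> r = \<one>"
    unfolding z o ghost_type_hom[OF h] by (simp_all only: psum_zero psum_one type_hom_0[OF h] type_hom_1[OF h])
qed

text \<open>By \<open>ghost_inj\<close> each identity may be checked on ghost components, where it
  is an axiom of R. Additive inverses are inverse power series.\<close>

lemma Lambda_cring: "cring (Lambda R)"
proof -
  note L = Lambda_add(1) Lambda_mult(1) Lambda_constants(1,2)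
  note G = Lambda_add(2) Lambda_mult(2) Lambda_constants(3,4) ghost_closed
  show ?thesis
  proof (intro cringI abelian_groupI comm_monoidI; (rule ghost_inj)?)
    fix f assume f: "f \<in> carrier (Lambda R)"
    then obtain g where g: "g \<in> carrier (fps_ring R)" "g 0 = \<one>" "g \<otimes>\<^bsub>fps_ring R\<^esub> f = \<one>\<^bsub>fps_ring R\<^esub>"
      using fps_ring_inverse[of f] by (auto simp: Lambda_sel simp del: fps_ring_sel(2,3))
    then show "\<exists>g\<in>carrier (Lambda R). g \<oplus>\<^bsub>Lambda R\<^esub> f = \<zero>\<^bsub>Lambda R\<^esub>"
      by (intro bexI[of _ g]) (simp_all add: Lambda_sel del: fps_ring_sel(2,3))
  qed (simp_all add: L G a_ac m_ac l_distr r_distr del: fps_ring_sel)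
qed

lemma ghost_hom: assumes "r \<ge> 1" shows "(\<lambda>f. ghost R f r) \<in> ring_hom (Lambda R) R"
  by (rule ring_hom_memI) (use assms in \<open>auto simp: Lambda_add(2) Lambda_mult(2) Lambda_constants ghost_closed\<close>)

context
  fixes f assumes f: "f \<in> carrier (Lambda R)"
begin

lemma Lambda_lam:
  shows "lam (Lambda R) m f \<in> carrier (Lambda R)"
    "ghost R (lam (Lambda R) m f) r = zeval R (\<lambda>i. f (Suc i)) (psum (\<lambda>i. univ_lam_poly m (Suc i)) r)"
proof -
  have h: "zeval R (\<lambda>i. f (Suc i)) \<in> ring_hom type_ring R"
    by (rule zeval_ring_hom) (use f in \<open>simp add: Lambda_sel\<close>)
  have "with_one (\<lambda>i. univ_lam_poly m (Suc i)) n = univ_lam_poly m n" for n by (cases n) (simp_all add: univ_lam_0)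
  then have s: "lam (Lambda R) m f = (\<lambda>n. zeval R (\<lambda>i. f (Suc i)) (with_one (\<lambda>i. univ_lam_poly m (Suc i)) n))"
    by (simp add: Lambda_sel)
  show "lam (Lambda R) m f \<in> carrier (Lambda R)" unfolding s by (rule Lambda_type_hom[OF h])
  show "ghost R (lam (Lambda R) m f) r = zeval R (\<lambda>i. f (Suc i)) (psum (\<lambda>i. univ_lam_poly m (Suc i)) r)"
    unfolding s by (rule ghost_type_hom[OF h])
qed

text \<open>The constant coefficient of the series of the \<lambda>^i(f) is the one of \<Lambda>(R),
  so that series has the inverse used in \<open>adams\<close>.\<close>

lemma lam_0: "lam (Lambda R) 0 f = \<one>\<^bsub>Lambda R\<^esub>"
proof (rule ghost_inj)
  have "zeval R (\<lambda>i. f (Suc i)) 1 = \<one>" by (rule zeval_1) (use f in \<open>simp add: Lambda_sel\<close>)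
  then show "ghost R (lam (Lambda R) 0 f) (Suc n) = ghost R \<one>\<^bsub>Lambda R\<^esub> (Suc n)" for n
    by (simp add: Lambda_lam(2) psum_univ_lam_0 Lambda_constants(4))
qed (simp_all only: Lambda_lam(1) Lambda_constants)

lemma ghost_lam_rel:
  assumes "r \<ge> 1"
  shows "em (int m) \<otimes> ghost R (lam (Lambda R) m f) r =
    (\<Oplus>i\<in>{..m}. (if i = 0 then \<zero> else em ((- 1) ^ Suc i) \<otimes> ghost R f (i * r)) \<otimes> ghost R (lam (Lambda R) (m - i) f) r)"
proof -
  let ?h = "zeval R (\<lambda>i. f (Suc i))"
  have h: "?h \<in> ring_hom type_ring R" by (rule zeval_ring_hom) (use f in \<open>simp add: Lambda_sel\<close>)
  have i: "?h (if i = 0 then 0 else (- 1) ^ Suc i * psum zvar (i * r)) = (if i = 0 then \<zero> else em ((- 1) ^ Suc i) \<otimes> ghost R f (i * r))" for i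
    by (simp only: if_distrib[of ?h] type_hom_0[OF h] type_hom_mult[OF h] type_hom_sign[OF h] ghost_def)
  show ?thesis using arg_cong[OF psum_univ_lam[OF assms, of m], of ?h]
    by (simp only: type_hom_mult[OF h] type_hom_sum[OF h] type_hom_of_nat[OF h] i Lambda_lam(2))
qed

text \<open>Multiplying the quotient in \<open>adams\<close> by the series of the \<lambda>^i(f)
  gives a convolution equation in \<Lambda>(R). Its image under the r-th ghost component and
  \<open>ghost_lam_rel\<close> have the same right side, so \<open>conv_unique\<close> determines
  the quotient; the sign in \<open>adams\<close> cancels the remaining (-1)^n.\<close>

lemma adams_ghost:
  "adams (Lambda R) n f \<in> carrier (Lambda R)"
  "n \<ge> 1 \<Longrightarrow> r \<ge> 1 \<Longrightarrow> ghost R (adams (Lambda R) n f) r = ghost R f (n * r)"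
proof -
  let ?A = "Lambda R"
  interpret A: cring ?A by (rule Lambda_cring)
  interpret F: comm_monoid "fps_ring ?A" by (rule A.fps_ring_comm_monoid)
  define l where "l i = lam ?A i f" for i
  have l: "l \<in> carrier (fps_ring ?A)" "l 0 = \<one>\<^bsub>?A\<^esub>" by (simp_all add: l_def Lambda_lam(1) lam_0)
  then have lU: "l \<in> Units (fps_ring ?A)" by (rule A.fps_ring_Units)
  have lc: "l i \<in> carrier ?A" for i using l(1) by simp
  have d: "s_deriv ?A l \<in> carrier (fps_ring ?A)" using lc by (simp add: s_deriv_def)
  have md: "\<ominus>\<^bsub>fps_ring ?A\<^esub> s_deriv ?A l \<in> carrier (fps_ring ?A)"
    using d by (simp add: A.fps_ring_minus[OF d])
  define q where "q = (\<ominus>\<^bsub>fps_ring ?A\<^esub> s_deriv ?A l) \<otimes>\<^bsub>fps_ring ?A\<^esub> inv\<^bsub>fps_ring ?A\<^esub> l"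
  have q: "q \<in> carrier (fps_ring ?A)" unfolding q_def by (rule F.m_closed[OF md F.Units_inv_closed[OF lU]])
  then have qc: "q i \<in> carrier ?A" for i by simp
  have ql': "q \<otimes>\<^bsub>fps_ring ?A\<^esub> l = \<ominus>\<^bsub>fps_ring ?A\<^esub> s_deriv ?A l"
    unfolding q_def using F.m_assoc[OF md F.Units_inv_closed[OF lU] l(1)] F.Units_l_inv[OF lU] F.r_one[OF md] by (simp only:)
  have ql: "(\<Oplus>\<^bsub>?A\<^esub>i\<in>{..m}. q i \<otimes>\<^bsub>?A\<^esub> l (m - i)) = \<ominus>\<^bsub>?A\<^esub> ([m] \<cdot>\<^bsub>?A\<^esub> l m)" for m
    using fun_cong[OF ql'[unfolded A.fps_ring_minus[OF d]], of m] by (simp only: fps_ring_sel s_deriv_def)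
  have ad: "adams ?A n f = (\<ominus>\<^bsub>?A\<^esub> \<one>\<^bsub>?A\<^esub>) [^]\<^bsub>?A\<^esub> n \<otimes>\<^bsub>?A\<^esub> q n"
    unfolding adams_def Let_def q_def l_def ..
  show "adams ?A n f \<in> carrier ?A" unfolding ad by (intro A.m_closed A.nat_pow_closed A.a_inv_closed A.one_closed qc)
  assume n: "n \<ge> 1" and r: "r \<ge> 1"
  define \<gamma> where "\<gamma> x = ghost R x r" for x
  interpret H: ring_hom_cring ?A R \<gamma>
    using ghost_hom[OF r] unfolding \<gamma>_def by unfold_locales
  \<comment> \<open>The expected ghost components of the coefficients of q. The value at 0 is zero
    because \<open>s_deriv\<close> has no constant term.\<close>
  define v where "v i = (if i = 0 then \<zero> else em ((- 1) ^ i) \<otimes> ghost R f (i * r))" for i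
  have v: "v i \<in> carrier R" for i using ghost_closed[OF f] by (simp add: v_def)
  have gl: "\<gamma> (l i) \<in> carrier R" for i using lc by simp
  have vs: "v i = \<ominus> (if i = 0 then \<zero> else em ((- 1) ^ Suc i) \<otimes> ghost R f (i * r))" for i
    using ghost_closed[OF f] by (simp add: v_def em_uminus l_minus)
  have "\<gamma> (q n) = v n" for n
  proof (rule conv_unique[of "\<lambda>n. \<gamma> (q n)" v "\<lambda>n. \<gamma> (l n)"])
    fix m
    have pw: "\<gamma> ([k] \<cdot>\<^bsub>?A\<^esub> x) = [k] \<cdot> \<gamma> x" if "x \<in> carrier ?A" for k :: nat and x
      by (induction k) (use that in simp_all)
    have "(\<Oplus>i\<in>{..m}. \<gamma> (q i) \<otimes> \<gamma> (l (m - i))) = \<gamma> (\<Oplus>\<^bsub>?A\<^esub>i\<in>{..m}. q i \<otimes>\<^bsub>?A\<^esub> l (m - i))"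
      using qc lc by (subst H.hom_finsum) (auto simp: comp_def intro!: finsum_cong')
    also have "\<dots> = \<ominus> (em (int m) \<otimes> \<gamma> (l m))"
      unfolding ql using lc by (simp add: pw add_pow_nat_em)
    also have "\<dots> = em (- 1) \<otimes> (\<Oplus>i\<in>{..m}. (if i = 0 then \<zero> else em ((- 1) ^ Suc i) \<otimes> ghost R f (i * r)) \<otimes> \<gamma> (l (m - i)))"
      unfolding \<gamma>_def l_def ghost_lam_rel[OF r]
      by (rule em_minus_1[symmetric], rule finsum_closed) (auto simp: Lambda_lam(1) ghost_closed f)
    also have "\<dots> = (\<Oplus>i\<in>{..m}. v i \<otimes> \<gamma> (l (m - i)))"
      using gl ghost_closed[OF f] by (subst finsum_rdistr) (auto simp: vs em_minus_1 l_minus intro!: finsum_cong')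
    finally show "(\<Oplus>i\<in>{..m}. \<gamma> (q i) \<otimes> \<gamma> (l (m - i))) = (\<Oplus>i\<in>{..m}. v i \<otimes> \<gamma> (l (m - i)))" .
  qed (use qc v gl l in simp_all)
  moreover have "\<gamma> ((\<ominus>\<^bsub>?A\<^esub> \<one>\<^bsub>?A\<^esub>) [^]\<^bsub>?A\<^esub> k) = em ((- 1) ^ k)" for k :: nat
    by (induction k) (simp_all add: em_mult em_uminus r_minus)
  ultimately have "\<gamma> (adams ?A n f) = em ((- 1) ^ n) \<otimes> (em ((- 1) ^ n) \<otimes> ghost R f (n * r))"
    unfolding ad using qc n by (simp add: v_def)
  then show "ghost R (adams ?A n f) r = ghost R f (n * r)"
    using ghost_closed[OF f] by (simp add: em_sign_sq \<gamma>_def)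
qed

end

end

section \<open>Exterior traces as elements of \<Lambda>(k), and the theorem\<close>

context rigid_karoubian_tensor_category
begin

lemma scalars_torsion_free_cring: "torsion_free_cring KR"
  by (intro torsion_free_cring.intro scalars_cring torsion_free_cring_axioms.intro) (rule scalars_torsion_free)

lemma chi_Lambda: "f \<in> mor C X X \<Longrightarrow> chi X f \<in> carrier (Lambda KR)"
  by (simp add: Lambda_sel chi_newton)

lemma chi_ghost: assumes "f \<in> mor C X X"
  shows "ghost KR (chi X f) (Suc n) = val (pwr X (mk X X f) (Suc n))"
proof -
  interpret K: torsion_free_cring KR by (rule scalars_torsion_free_cring)
  show ?thesis
    by (rule K.ghost_unique[OF chi_Lambda[OF assms], of "\<lambda>n. val (pwr X (mk X X f) n)"])
       (use assms in simp, rule chi_newton(3)[OF assms])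
qed

lemma chi_adams:
  assumes f: "f \<in> mor C X X" and f': "f' \<in> mor C X X" and pw: "mk X X f' = pwr X (mk X X f) n" and n: "n \<ge> 1"
  shows "chi X f' = adams (Lambda KR) n (chi X f)"
proof -
  interpret K: torsion_free_cring KR by (rule scalars_torsion_free_cring)
  note L = chi_Lambda[OF f]
  show ?thesis
  proof (rule K.ghost_inj[OF chi_Lambda[OF f'] K.adams_ghost(1)[OF L]])
    fix r
    \<comment> \<open>\<open>chi_ghost\<close> concerns positive indices, so the positive number
      \<open>n * Suc r\<close> is written as a successor.\<close>
    obtain k where k: "n * Suc r = Suc k" using n by (cases "n * Suc r") auto
    have "ghost KR (chi X f') (Suc r) = val (pwr X (pwr X (mk X X f) n) (Suc r))" by (simp only: chi_ghost[OF f'] pw)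
    also have "\<dots> = val (pwr X (mk X X f) (Suc r * n))" using f by (subst pwr_mult) simp_all
    also have "\<dots> = ghost KR (chi X f) (n * Suc r)" unfolding mult.commute[of "Suc r"] k by (rule chi_ghost[OF f, symmetric])
    also have "\<dots> = ghost KR (adams (Lambda KR) n (chi X f)) (Suc r)" by (rule K.adams_ghost(2)[OF L n, symmetric]) simp
    finally show "ghost KR (chi X f') (Suc r) = ghost KR (adams (Lambda KR) n (chi X f)) (Suc r)" .
  qed
qed

lemma representation_pwr:
  assumes "Group.monoid G" "representation C G X \<rho>" "g \<in> carrier G"
  shows "\<rho> (g [^]\<^bsub>G\<^esub> n) \<in> mor C X X" "mk X X (\<rho> (g [^]\<^bsub>G\<^esub> n)) = pwr X (mk X X (\<rho> g)) n"
proof -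
  interpret G: Group.monoid G by fact
  have \<rho>: "\<rho> \<in> hom G (End_ring C X)" "\<rho> \<one>\<^bsub>G\<^esub> = idm C X" using assms(2) by (simp_all add: representation_def)
  have c: "\<rho> h \<in> mor C X X" if "h \<in> carrier G" for h using hom_in_carrier[OF \<rho>(1) that] by (simp add: End_ring_simps)
  show "\<rho> (g [^]\<^bsub>G\<^esub> n) \<in> mor C X X" using assms(3) by (intro c) simp
  show "mk X X (\<rho> (g [^]\<^bsub>G\<^esub> n)) = pwr X (mk X X (\<rho> g)) n"
  proof (induction n)
    case 0
    show ?case by (simp add: \<rho> ID_def)
  next
    case (Suc n)
    have "\<rho> (g [^]\<^bsub>G\<^esub> Suc n) = \<rho> g \<bullet> \<rho> (g [^]\<^bsub>G\<^esub> n)"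
      using hom_mult[OF \<rho>(1) assms(3) G.nat_pow_closed[OF assms(3), of n]] G.nat_pow_Suc2[OF assms(3), of n]
      by (simp add: End_ring_simps)
    moreover have "mk X X (\<rho> g) \<star> mk X X (\<rho> (g [^]\<^bsub>G\<^esub> n)) = mk X X (\<rho> g \<bullet> \<rho> (g [^]\<^bsub>G\<^esub> n))"
      using assms(3) by (intro cp_mk c) simp_all
    ultimately show ?case by (simp add: Suc.IH)
  qed
qed

end

theorem theorem6p5:
  fixes C :: "('o, 'm) tensor_cat"
    and G :: "('g, 'z) monoid_scheme"
    and X :: 'o and \<rho> :: "'g \<Rightarrow> 'm" and g :: 'g and n :: nat
  assumes "rigid_karoubian_tensor_category C"
    and "Group.monoid G"
    and "representation C G X \<rho>"
    and "g \<in> carrier G"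
    and "n \<ge> 1"
  shows "chi_bar C X \<rho> (g [^]\<^bsub>G\<^esub> n) = adams (Lambda (scalars C)) n (chi_bar C X \<rho> g)"
proof -
  interpret rigid_karoubian_tensor_category C by fact
  note rep = representation_pwr[OF assms(2-4)]
  have g: "\<rho> g \<in> mor C X X" using hom_in_carrier[of \<rho> G "End_ring C X" g] assms(3,4)
    by (simp add: representation_def End_ring_simps)
  have bar: "chi_bar C X \<rho> h = chi X (\<rho> h)" for h by (simp add: chi_bar_def chi_def fun_eq_iff)
  show ?thesis unfolding bar by (rule chi_adams[OF g rep assms(5)])
qed

end
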